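(* Let $p$ be a prime, let $\bar{\mathbb F}_p$ be a fixed algebraic closure of $\mathbb F_p$, and let $X_p$ be the set of all injective group homomorphisms $\sigma:\bar{\mathbb F}_p^\times\to(\mathbb Q^{\rm cyc})^\times$. Then: (1) $G_p$ acts freely and transitively on $X_p$. (2) The quotient of $X_p$ by $f_p^{\hat{\mathbb Z}}$ is (canonically) isomorphic to $\Sigma_p=\mathrm{Val}_p(\mathbb Q^{\rm cyc})$.
   Context: $\mathbb Q^{\rm cyc}$ is the field generated over $\mathbb Q$ by all (abstract) roots of unity; $\mu^{(p)}\subset\mathbb Q^{\rm cyc}$ is the group of roots of unity of order prime to $p$ (the image of any $\sigma\in X_p$). $G_p=\prod_{\ell\ne p}\mathbb Z_\ell^*$ ($\ell$ prime) is the group of automorphisms of $\mu^{(p)}$; it acts on $X_p$ by $\sigma\mapsto g\circ\sigma$. $f_p\in G_p$ is the automorphism $\xi\mapsto\xi^p$, and $f_p^{\hat{\mathbb Z}}$ is the closed subgroup of $G_p$ generated by $f_p$. $\mathrm{Val}_p(\mathbb Q^{\rm cyc})$ is the set of extensions of the $p$-adic valuation of $\mathbb Q$ to $\mathbb Q^{\rm cyc}$. $\Sigma_p$ is the set of bijections $s$ of the monoid $\mathcal M(p)=\{0\}\cup\mu^{(p)}$ which commute with all their conjugates $R\circ s\circ R^{-1}$ under multiplications $R$ by elements of $\mu^{(p)}$ and fulfill $s(0)=1$, $s^p=\mathrm{id}$. It is identified with $\mathrm{Val}_p(\mathbb Q^{\rm cyc})$ by sending $v$ to $s_v(x)=\epsilon^{-1}(\epsilon(x)+1)$,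 where $\epsilon$ is the monoid isomorphism from $\mathcal M(p)$ to the residue field of the restriction of $v$ to $\mathbb Q(\mu^{(p)})$ given by the residue map. The canonical map $X_p\to\Sigma_p$ inducing the isomorphism in (2) sends $\sigma$ to $s(x)=\sigma(\sigma^{-1}(x)+1)$ for $x\ne-1$, $s(-1)=0$, where $\sigma$ is extended by $\sigma(0)=0$ and $-1$ stands for $\sigma(-1)$. *)

theory Defs
  imports
    "HOL-Analysis.Function_Topology"
    "HOL-Library.Extended_Real"
    "HOL-Algebra.Algebraic_Closure_Type"
    "HOL-Algebra.Generated_Fields"
    "HOL-Algebra.QuotRing"
    "HOL-Algebra.Group_Action"
begin

text \<open>
  The abstract roots of unity are realised as the roots of unity of an arbitrary algebraically
  closed field \<open>'c\<close> of characteristic \<open>0\<close>. Algebraic closedness is required only in the final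
  theorem; it guarantees that all roots of unity are present. The prime field of \<open>'c\<close> is the field
  of rational numbers, so \<^const>\<open>generate_field\<close> yields the field generated over it.
\<close>

definition Qcyc :: "'c::field_char_0 ring" where
  "Qcyc = ring_of_type_algebra
     \<lparr>carrier := generate_field ring_of_type_algebra {z :: 'c. \<exists>n>0. z ^ n = 1}\<rparr>"

definition mu :: "nat \<Rightarrow> 'c::field_char_0 set" where
  "mu p = {z. \<exists>n>0. coprime n p \<and> z ^ n = 1}"

definition mu_group :: "nat \<Rightarrow> 'c::field_char_0 monoid" where
  "mu_group p = (mult_of Qcyc)\<lparr>carrier := mu p\<rparr>"


subsection \<open>The profinite group of automorphisms\<close>

definition Gp :: "nat \<Rightarrow> ('c::field_char_0 \<Rightarrow> 'c) monoid" where
  "Gp p = AutoGroup (mu_group p)"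

text \<open>
  For each \<open>n\<close> prime to \<open>p\<close>, the automorphisms fixing all \<open>n\<close>-th roots of unity form a subgroup;
  these subgroups are a neighbourhood basis of the identity for pointwise convergence on the
  discrete set \<^term>\<open>mu p\<close>. This is therefore the usual profinite topology of the product of the
  groups of \<open>l\<close>-adic units, where a unit \<open>g\<close> acts on roots of unity by \<open>z \<mapsto> z^g\<close>.
\<close>

definition Gp_topology :: "nat \<Rightarrow> ('c::field_char_0 \<Rightarrow> 'c) topology" where
  "Gp_topology p =
     subtopology (product_topology (\<lambda>_. discrete_topology (mu p)) (mu p)) (carrier (Gp p))"

definition frob :: "nat \<Rightarrow> 'c::field_char_0 \<Rightarrow> 'c" where
  "frob p = (\<lambda>z\<in>mu p. z ^ p)"

definition frob_group :: "nat \<Rightarrow> ('c::field_char_0 \<Rightarrow> 'c) monoid" where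
  "frob_group p = (Gp p)
     \<lparr>carrier := \<Inter>{H. subgroup H (Gp p) \<and> closedin (Gp_topology p) H \<and> frob p \<in> H}\<rparr>"


subsection \<open>The set of embeddings and its action\<close>

text \<open>Maps are taken to be extensional, so that equality of maps is equality on their domain.\<close>

definition X_set :: "('a, 'm) ring_scheme \<Rightarrow> ('a \<Rightarrow> 'c::field_char_0) set" where
  "X_set F = mon (mult_of F) (mult_of Qcyc) \<inter> extensional (carrier (mult_of F))"

definition act ::
    "('a, 'm) ring_scheme \<Rightarrow> ('c::field_char_0 \<Rightarrow> 'c) \<Rightarrow> ('a \<Rightarrow> 'c) \<Rightarrow> 'a \<Rightarrow> 'c" where
  "act F g = (\<lambda>\<sigma>\<in>X_set F. compose (carrier (mult_of F)) g \<sigma>)"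


subsection \<open>The set of successor maps\<close>

definition Mp :: "nat \<Rightarrow> 'c::field_char_0 set" where
  "Mp p = {0} \<union> mu p"

definition mult_by :: "nat \<Rightarrow> 'c::field_char_0 \<Rightarrow> 'c \<Rightarrow> 'c" where
  "mult_by p a = (\<lambda>x\<in>Mp p. a * x)"

definition conjugate :: "nat \<Rightarrow> 'c::field_char_0 \<Rightarrow> ('c \<Rightarrow> 'c) \<Rightarrow> 'c \<Rightarrow> 'c" where
  "conjugate p a s =
     mult_by p a \<otimes>\<^bsub>BijGroup (Mp p)\<^esub> s \<otimes>\<^bsub>BijGroup (Mp p)\<^esub> inv\<^bsub>BijGroup (Mp p)\<^esub> mult_by p a"

definition Sigma_set :: "nat \<Rightarrow> ('c::field_char_0 \<Rightarrow> 'c) set" where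
  "Sigma_set p = {s \<in> carrier (BijGroup (Mp p)).
     (\<forall>a\<in>mu p. s \<otimes>\<^bsub>BijGroup (Mp p)\<^esub> conjugate p a s = conjugate p a s \<otimes>\<^bsub>BijGroup (Mp p)\<^esub> s) \<and>
     s 0 = 1 \<and> s [^]\<^bsub>BijGroup (Mp p)\<^esub> p = \<one>\<^bsub>BijGroup (Mp p)\<^esub>}"

definition extend0 :: "('a, 'm) ring_scheme \<Rightarrow> ('a \<Rightarrow> 'c::field_char_0) \<Rightarrow> 'a \<Rightarrow> 'c" where
  "extend0 F \<sigma> = (\<lambda>y\<in>carrier F. if y = \<zero>\<^bsub>F\<^esub> then 0 else \<sigma> y)"

definition s_of_embedding ::
    "nat \<Rightarrow> ('a, 'm) ring_scheme \<Rightarrow> ('a \<Rightarrow> 'c::field_char_0) \<Rightarrow> 'c \<Rightarrow> 'c" where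
  "s_of_embedding p F \<sigma> =
     (\<lambda>x\<in>Mp p. if x = \<sigma> (\<ominus>\<^bsub>F\<^esub> \<one>\<^bsub>F\<^esub>) then 0
              else extend0 F \<sigma> (the_inv_into (carrier F) (extend0 F \<sigma>) x \<oplus>\<^bsub>F\<^esub> \<one>\<^bsub>F\<^esub>))"


subsection \<open>Extensions of the p-adic valuation\<close>

definition padic_valuation :: "nat \<Rightarrow> rat \<Rightarrow> ereal" where
  "padic_valuation p r =
     (if r = 0 then \<infinity>
      else ereal (real (multiplicity (int p) (fst (quotient_of r)))
                  - real (multiplicity (int p) (snd (quotient_of r)))))"

text \<open>
  Valuations are additive and normalised by the value \<open>1\<close> at \<open>p\<close>. As the cyclotomic field is
  algebraic over the rationals, the value group of any extension embeds uniquely into the reals.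
\<close>

definition Val :: "nat \<Rightarrow> ('c::field_char_0 \<Rightarrow> ereal) set" where
  "Val p = {v \<in> extensional (carrier Qcyc).
     (\<forall>x\<in>carrier Qcyc. v x \<noteq> -\<infinity> \<and> (v x = \<infinity> \<longleftrightarrow> x = 0)) \<and>
     (\<forall>x\<in>carrier Qcyc. \<forall>y\<in>carrier Qcyc. v (x * y) = v x + v y) \<and>
     (\<forall>x\<in>carrier Qcyc. \<forall>y\<in>carrier Qcyc. v (x + y) \<ge> min (v x) (v y)) \<and>
     (\<forall>r. v (of_rat r) = padic_valuation p r)}"

definition Q_mu :: "nat \<Rightarrow> 'c::field_char_0 set" where
  "Q_mu p = generate_field ring_of_type_algebra (mu p)"

definition val_ring :: "nat \<Rightarrow> ('c::field_char_0 \<Rightarrow> ereal) \<Rightarrow> 'c ring" where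
  "val_ring p v = Qcyc\<lparr>carrier := {x \<in> Q_mu p. v x \<ge> 0}\<rparr>"

definition val_ideal :: "nat \<Rightarrow> ('c::field_char_0 \<Rightarrow> ereal) \<Rightarrow> 'c set" where
  "val_ideal p v = {x \<in> Q_mu p. v x > 0}"

definition residue_field :: "nat \<Rightarrow> ('c::field_char_0 \<Rightarrow> ereal) \<Rightarrow> 'c set ring" where
  "residue_field p v = val_ring p v Quot val_ideal p v"

definition residue_map :: "nat \<Rightarrow> ('c::field_char_0 \<Rightarrow> ereal) \<Rightarrow> 'c \<Rightarrow> 'c set" where
  "residue_map p v = (\<lambda>x\<in>Mp p. val_ideal p v +>\<^bsub>val_ring p v\<^esub> x)"

definition s_of_val :: "nat \<Rightarrow> ('c::field_char_0 \<Rightarrow> ereal) \<Rightarrow> 'c \<Rightarrow> 'c" where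
  "s_of_val p v =
     (\<lambda>x\<in>Mp p. the_inv_into (Mp p) (residue_map p v)
        (residue_map p v x \<oplus>\<^bsub>residue_field p v\<^esub> \<one>\<^bsub>residue_field p v\<^esub>))"

end

theory Submission
  imports
    "HOL-Analysis.Abstract_Topological_Spaces"
    Defs
    "Jordan_Normal_Form.Char_Poly"
    "HOL-Number_Theory.Number_Theory"
begin

text \<open>
  Let \<open>A\<close> be the ring generated by all roots of unity. A prime ideal \<open>P\<close> of \<open>A\<close> above \<open>p\<close> has
  \<open>Mp p\<close> as a system of representatives of \<open>A/P\<close>, and \<open>x \<mapsto> x + 1\<close> on \<open>A/P\<close> becomes an element \<open>s\<close> of
  \<open>Sigma_set p\<close>. Conversely \<open>x \<oplus> y = y s(x/y)\<close> turns \<open>Mp p\<close> into a field of characteristic \<open>p\<close>; that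
  \<open>s\<close> commutes with its conjugates gives associativity. An integral relation between roots of unity
  of order prime to \<open>p\<close> also holds in this field, because the Galois group of a cyclotomic field is as
  large as possible; so \<open>A\<close> maps onto it, with kernel a prime ideal above \<open>p\<close>. Valuations extending
  the \<open>p\<close>-adic one correspond to the same prime ideals, since a nonzero element of \<open>A\<close> has a power which
  is a power of \<open>p\<close> up to units at \<open>P\<close>.

  All these primes are conjugate under \<open>Gp p\<close>. The stabilizer of \<open>P\<close> acts on \<open>A/P\<close> by field
  automorphisms, which on each finite level are powers of Frobenius by counting roots modulo \<open>P\<close>; hence
  it is the closure of the group generated by Frobenius. An embedding transports the field structure to
  \<open>Mp p\<close>, and two embeddings give the same one exactly when they differ by an element of the
  stabilizer.
\<close>

section \<open>Elements of prescribed order\<close>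

text \<open>Every element of A is written as \<open>ipoly f z\<close> with an integral polynomial f
  and one root of unity z. Finitely many elements share one primitive root, so questions about A
  become questions about integral polynomials at a single point; irreducibility enters only through
  \<open>conjugate_root\<close>. Mapping A onto the field on \<open>Mp p\<close> meets an obstacle:
  a root of unity of order divisible by p has no counterpart there. It is sent to its component of
  order prime to p, and the substance is that this is well defined: a relation at a root of order n
  p^(k+1) must survive at an element of order n in characteristic p. The other obstacle is the
  passage to the limit over all orders, both for the conjugacy of the primes and for the existence
  of an embedding. The orders p^(k!) - 1 form a single divisibility chain, so compatible choices can
  be made one level at a time. A mismatch between neighbouring levels is a power of Frobenius in the
  first case and an exponent prime to the order in the second; both lift to the upper level.\<close>

lemma (in comm_group) ord_mult_coprime:
  assumes x: "x \<in> carrier G" and y: "y \<in> carrier G" and co: "coprime (ord x) (ord y)"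
  shows "ord (x \<otimes> y) = ord x * ord y"
proof (rule dvd_antisym)
  have *: "ord x dvd i \<and> ord y dvd i" if i: "(x \<otimes> y) [^] i = \<one>" for i :: nat
  proof -
    have e: "x [^] i \<otimes> y [^] i = \<one>" using i x y by (simp add: nat_pow_distrib)
    have "y [^] (i * ord y) = \<one>" "x [^] (i * ord x) = \<one>"
      using x y by (simp_all add: pow_eq_id)
    hence "x [^] (i * ord y) = (x [^] i \<otimes> y [^] i) [^] ord y"
      "y [^] (i * ord x) = (x [^] i \<otimes> y [^] i) [^] ord x"
      using x y by (simp_all add: nat_pow_distrib nat_pow_pow)
    hence 1: "ord x dvd i * ord y" and 2: "ord y dvd i * ord x"
      using e x y by (simp_all flip: pow_eq_id)
    show ?thesis using 1 2 co by (simp add: coprime_dvd_mult_left_iff coprime_commute)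
  qed
  show "ord x * ord y dvd ord (x \<otimes> y)"
    using *[of "ord (x \<otimes> y)"] x y co by (simp add: divides_mult)
  show "ord (x \<otimes> y) dvd ord x * ord y"
    using x y abelian_ord_mul_divides by blast
qed

text \<open>Induction splits off the full power of one prime l: an element killed by
  \<open>l ^ Suc k\<close> but not by \<open>l ^ k\<close> has order exactly
  \<open>l ^ Suc k\<close>, and coprime orders multiply. The existence of elements of order n thus
  reduces to prime powers, both for roots of unity and for the units of an algebraic
  closure.\<close>

lemma (in comm_group) exists_ord:
  fixes n :: nat
  assumes "n > 0"
    and "\<And>l k. prime l \<Longrightarrow> l dvd n \<Longrightarrow>
           \<exists>x\<in>carrier G. x [^] (l ^ Suc k :: nat) = \<one> \<and> x [^] (l ^ k :: nat) \<noteq> \<one>"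
  shows "\<exists>x\<in>carrier G. ord x = n"
  using assms
proof (induction n rule: less_induct)
  case (less n)
  show ?case
  proof (cases "n = 1")
    case True
    then show ?thesis by (intro bexI[of _ \<one>]) auto
  next
    case False
    then obtain l where l: "prime l" "l dvd n" using prime_factor_nat by blast
    obtain m where m: "n = l ^ multiplicity l n * m" "\<not> l dvd m"
      using multiplicity_decompose'[of n l] l less.prems(1)
      by (metis not_prime_unit neq0_conv)
    define k where "k = multiplicity l n - 1"
    have mpos: "multiplicity l n > 0"
      using l less.prems(1) by (simp add: prime_multiplicity_gt_zero_iff)
    hence n: "n = l ^ Suc k * m" using m k_def by simp
    have m0: "m > 0" using less.prems(1) n by (cases m) auto
    have lt: "m < n" using n m0 prime_gt_1_nat[OF l(1)]
      by (metis One_nat_def less_not_refl mpos mult_less_cancel2 n_less_m_mult_n nat_mult_1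
          one_less_power m(1))
    obtain y where y: "y \<in> carrier G" "ord y = m"
      using less.IH[OF lt m0] less.prems(2) n by (metis dvd_mult)
    obtain x where x: "x \<in> carrier G" "x [^] (l ^ Suc k) = \<one>" "x [^] (l ^ k) \<noteq> \<one>"
      using less.prems(2)[OF l] by blast
    have "ord x dvd l ^ Suc k" using x by (simp only: pow_eq_id)
    then obtain j where j: "j \<le> Suc k" "ord x = l ^ j"
      using divides_primepow_nat[OF l(1)] by blast
    have "\<not> ord x dvd l ^ k" using x by (simp only: pow_eq_id not_False_eq_True)
    hence "\<not> j \<le> k" using j(2) by (auto intro: le_imp_power_dvd)
    hence ox: "ord x = l ^ Suc k" using j by (metis le_SucE)
    have "coprime (l ^ Suc k) m"
      using m(2) l(1) by (simp add: prime_imp_coprime)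
    thus ?thesis
      using ord_mult_coprime[OF x(1) y(1)] ox y n x(1) by (intro bexI[of _ "x \<otimes> y"]) auto
  qed
qed

section \<open>Roots of unity\<close>

definition primroot :: "nat \<Rightarrow> 'c::field_char_0 \<Rightarrow> bool" where
  "primroot n x \<longleftrightarrow> (\<forall>i. x ^ i = 1 \<longleftrightarrow> n dvd i)"

lemma primrootD: "primroot n x \<Longrightarrow> x ^ i = 1 \<longleftrightarrow> n dvd i"
  by (simp add: primroot_def)

lemma primroot_nonzero: "primroot n x \<Longrightarrow> n > 0 \<Longrightarrow> x \<noteq> 0"
  by (metis primroot_def dvd_refl power_0_left zero_neq_one neq0_conv)

lemma primroot_power:
  assumes "primroot (d * n) x" "d > 0"
  shows "primroot n (x ^ d)"
  using assms by (simp add: primroot_def flip: power_mult)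

lemma pow_type_algebra: "x [^]\<^bsub>ring_of_type_algebra\<^esub> (n::nat) = x ^ n"
  by (induction n) (auto simp: ring_of_type_algebra_def power_commutes)

lemma primroot_exists:
  fixes n :: nat
  assumes n: "n > 0"
  shows "\<exists>x::'c::{alg_closed_field,field_char_0}. primroot n x"
proof -
  let ?R = "ring_of_type_algebra :: 'c ring"
  interpret R: field ?R by (rule field_from_type_algebra)
  interpret G: comm_group "Multiplicative_Group.mult_of ?R"
    using R.field_mult_group R.m_comm by (auto intro!: group.group_comm_groupI)
  have pw: "x [^]\<^bsub>Multiplicative_Group.mult_of ?R\<^esub> (i::nat) = x ^ i" for x i
    by (simp only: Multiplicative_Group.nat_pow_mult_of pow_type_algebra)
  have c: "carrier (Multiplicative_Group.mult_of ?R) = - {0}" "\<one>\<^bsub>Multiplicative_Group.mult_of ?R\<^esub> = 1"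
    by (auto simp: ring_of_type_algebra_def)
  have "\<exists>x\<in>carrier (Multiplicative_Group.mult_of ?R). G.ord x = n"
  proof (rule G.exists_ord[OF n])
    fix l k :: nat assume l: "prime l"
    \<comment> \<open>The quotient of X^(l^(k+1)) - 1 by X^(l^k) - 1. At a root x, the power y =
      x^(l^k) satisfies y^l = 1, while y = 1 would turn the sum into l, which is nonzero in
      characteristic 0.\<close>
    define q :: "'c poly" where "q = (\<Sum>i<l. monom 1 (i * l ^ k))"
    have l2: "l \<ge> 2" using l by (rule prime_ge_2_nat)
    have "poly.coeff q ((l - 1) * l ^ k) = (\<Sum>i<l. if i = l - 1 then 1 else 0)"
      unfolding q_def coeff_sum using l2 by (intro sum.cong) auto
    also have "\<dots> = 1" using l2 by simp
    finally have "Polynomial.degree q \<ge> (l - 1) * l ^ k" by (intro le_degree) simp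
    hence "Polynomial.degree q > 0" using l2 by (metis gr0I le_zero_eq mult_eq_0_iff power_not_zero
          not_numeral_le_zero diff_is_0_eq numeral_le_one_iff semiring_norm(69) order_trans)
    then obtain x where x: "poly q x = 0" using alg_closed_imp_poly_has_root by blast
    define y where "y = x ^ (l ^ k)"
    have s: "(\<Sum>i<l. y ^ i) = 0"
      using x unfolding q_def y_def by (simp add: poly_sum poly_monom mult.commute flip: power_mult)
    have "y \<noteq> 1" using s l2 by auto
    moreover have "y ^ l = 1" using s power_diff_1_eq[of y l] by simp
    ultimately have "x ^ (l ^ Suc k) = 1" "x ^ (l ^ k) \<noteq> 1"
      unfolding y_def by (simp_all add: mult.commute flip: power_mult)
    moreover have "x \<noteq> 0"
    proof
      assume "x = 0"
      moreover have "l ^ Suc k > 0" using l2 by simp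
      ultimately show False using \<open>x ^ (l ^ Suc k) = 1\<close> by (simp add: power_0_left)
    qed
    ultimately show "\<exists>x\<in>carrier (Multiplicative_Group.mult_of ?R). x [^]\<^bsub>Multiplicative_Group.mult_of ?R\<^esub> (l ^ Suc k) = \<one>\<^bsub>Multiplicative_Group.mult_of ?R\<^esub>
        \<and> x [^]\<^bsub>Multiplicative_Group.mult_of ?R\<^esub> (l ^ k) \<noteq> \<one>\<^bsub>Multiplicative_Group.mult_of ?R\<^esub>"
      unfolding pw c by blast
  qed
  then obtain x where x: "x \<in> carrier (Multiplicative_Group.mult_of ?R)" "G.ord x = n" by blast
  have "x ^ i = 1 \<longleftrightarrow> n dvd i" for i
    using G.pow_eq_id[OF x(1), of i] x(2) pw c by auto
  thus ?thesis unfolding primroot_def by blast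
qed

lemma roots_of_unity_eq:
  assumes c: "primroot n (c::'c::field_char_0)" and n: "n > 0"
  shows "{z. z ^ n = 1} = (\<lambda>i. c ^ i) ` {..<n}" "inj_on (\<lambda>i. c ^ i) {..<n}"
    "card {z::'c. z ^ n = 1} = n" "finite {z::'c. z ^ n = 1}"
proof -
  have c0: "c \<noteq> 0" using primroot_nonzero[OF c n] .
  show inj: "inj_on (\<lambda>i. c ^ i) {..<n}"
  proof (rule linorder_inj_onI')
    fix i j assume ij: "i \<in> {..<n}" "j \<in> {..<n}" "i < j"
    show "c ^ i \<noteq> c ^ j"
    proof
      assume "c ^ i = c ^ j"
      hence "c ^ (j - i) = 1" using c0 ij by (simp add: power_diff)
      hence "n dvd j - i" using c by (simp add: primrootD)
      thus False using ij by (auto dest: dvd_imp_le)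
    qed
  qed
  let ?f = "monom 1 n - 1 :: 'c poly"
  have deg: "Polynomial.degree (monom (1::'c) n) = n" by (simp add: degree_monom_eq)
  have "poly.coeff ?f n = 1" using n by simp
  hence f0: "?f \<noteq> 0" by force
  have S: "{z. z ^ n = 1} = {z. poly ?f z = 0}" by (simp add: poly_monom)
  show fin: "finite {z::'c. z ^ n = 1}" unfolding S by (rule poly_roots_finite[OF f0])
  have "card {z. poly ?f z = 0} \<le> Polynomial.degree ?f" by (rule card_poly_roots_bound[OF f0])
  also have "\<dots> \<le> n" using deg by (intro degree_diff_le) auto
  finally have le: "card {z::'c. z ^ n = 1} \<le> n" unfolding S .
  have sub: "(\<lambda>i. c ^ i) ` {..<n} \<subseteq> {z. z ^ n = 1}"
    using c by (auto simp: primrootD power_mult[symmetric])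
  have "card ((\<lambda>i. c ^ i) ` {..<n}) = n" using inj by (simp add: card_image)
  thus "{z. z ^ n = 1} = (\<lambda>i. c ^ i) ` {..<n}" "card {z::'c. z ^ n = 1} = n"
    using le sub fin by (metis card_seteq, metis card_mono le_antisym)
qed

lemma primroot_generates:
  assumes "primroot n (c::'c::field_char_0)" "n > 0" "z ^ n = 1"
  obtains i where "i < n" "z = c ^ i"
  using roots_of_unity_eq(1)[OF assms(1,2)] assms(3) by auto

lemma monom_minus_one_eq_prod:
  assumes c: "primroot n (c::'c::field_char_0)" and n: "n > 0"
  shows "monom 1 n - 1 = (\<Prod>z::'c | z ^ n = 1. [:- z, 1:])" (is "?f = ?g")
proof (rule poly_eqI_degree_lead_coeff[of _ n _ "{z::'c. z ^ n = 1}"])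
  have fin: "finite {z::'c. z ^ n = 1}" by (rule roots_of_unity_eq(4)[OF c n])
  have d: "Polynomial.degree ?g = n"
    by (simp add: degree_prod_eq_sum_degree roots_of_unity_eq(3)[OF c n])
  have "lead_coeff ?g = 1" by (simp add: lead_coeff_prod)
  hence lc: "poly.coeff ?g n = 1" using d by simp
  show "poly.coeff ?f n = poly.coeff ?g n" using lc n by simp
  show "Polynomial.degree ?f \<le> n" by (intro degree_diff_le) (auto simp: degree_monom_eq)
  show "Polynomial.degree ?g \<le> n" using d by simp
  show "card {z::'c. z ^ n = 1} \<ge> n" using roots_of_unity_eq(3)[OF c n] by simp
  fix z :: 'c assume "z \<in> {z. z ^ n = 1}"
  thus "poly ?f z = poly ?g z" using fin
    by (auto simp: poly_prod poly_monom intro!: prod_zero[symmetric])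
qed

text \<open>The error term is kept as an explicit multiple of p, so that the identity can be used in
  characteristic 0 and reduced modulo a prime ideal above p afterwards.\<close>

lemma freshman:
  fixes x y :: "'a::comm_semiring_1"
  assumes "prime p"
  shows "(x + y) ^ p = x ^ p + y ^ p
    + of_nat p * (\<Sum>k\<in>{1..<p}. of_nat ((p choose k) div p) * x ^ k * y ^ (p - k))"
proof -
  have p: "p \<ge> 2" by (rule prime_ge_2_nat[OF assms])
  have "(x + y) ^ p = (\<Sum>k\<le>p. of_nat (p choose k) * x ^ k * y ^ (p - k))"
    by (rule binomial_ring)
  also have "{..p} = insert 0 (insert p {1..<p})" using p by auto
  also have "(\<Sum>k\<in>insert 0 (insert p {1..<p}). of_nat (p choose k) * x ^ k * y ^ (p - k))
      = y ^ p + (x ^ p + (\<Sum>k\<in>{1..<p}. of_nat (p choose k) * x ^ k * y ^ (p - k)))"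
    using p by simp
  also have "(\<Sum>k\<in>{1..<p}. of_nat (p choose k) * x ^ k * y ^ (p - k))
      = (\<Sum>k\<in>{1..<p}. of_nat p * (of_nat ((p choose k) div p) * x ^ k * y ^ (p - k)))"
  proof (intro sum.cong refl)
    fix k assume "k \<in> {1..<p}"
    hence "p dvd (p choose k)" using assms by (intro dvd_choose_prime) auto
    hence "of_nat (p choose k) = (of_nat p * of_nat ((p choose k) div p) :: 'a)"
      by (metis dvd_mult_div_cancel of_nat_mult)
    thus "of_nat (p choose k) * x ^ k * y ^ (p - k)
        = of_nat p * (of_nat ((p choose k) div p) * x ^ k * y ^ (p - k))"
      by (simp add: mult.assoc)
  qed
  finally show ?thesis by (simp add: sum_distrib_left add_ac)
qed

section \<open>Integral polynomials at roots of unity\<close>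

definition ipoly :: "int poly \<Rightarrow> 'a::comm_ring_1 \<Rightarrow> 'a" where
  "ipoly f x = poly (map_poly of_int f) x"

lemma ipoly_0 [simp]: "ipoly 0 x = 0"
  by (simp add: ipoly_def)

lemma ipoly_pCons [simp]: "ipoly (pCons a f) x = of_int a + x * ipoly f x"
  by (simp add: ipoly_def of_int_hom.map_poly_pCons_hom)

lemma ipoly_1 [simp]: "ipoly 1 x = 1"
  by (simp add: one_pCons)

lemma ipoly_add [simp]: "ipoly (f + g) x = ipoly f x + ipoly g x"
  by (simp add: ipoly_def of_int_poly_hom.hom_add)

lemma ipoly_uminus [simp]: "ipoly (- f) x = - ipoly f x"
  using ipoly_add[of f "- f" x] by (simp add: eq_neg_iff_add_eq_0 add.commute del: ipoly_add)

lemma ipoly_diff [simp]: "ipoly (f - g) x = ipoly f x - ipoly g x"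
  using ipoly_add[of f "- g" x] by simp

lemma ipoly_smult [simp]: "ipoly (smult a f) x = of_int a * ipoly f x"
  by (induction f) (auto simp: algebra_simps)

lemma ipoly_mult [simp]: "ipoly (f * g) x = ipoly f x * ipoly g x"
  by (induction f) (auto simp: algebra_simps)

lemma ipoly_power [simp]: "ipoly (f ^ n) x = ipoly f x ^ n"
  by (induction n) auto

lemma ipoly_sum [simp]: "ipoly (sum f A) x = (\<Sum>i\<in>A. ipoly (f i) x)"
  by (induction A rule: infinite_finite_induct) auto

lemma ipoly_prod [simp]: "ipoly (prod f A) x = (\<Prod>i\<in>A. ipoly (f i) x)"
  by (induction A rule: infinite_finite_induct) auto

lemma ipoly_monom [simp]: "ipoly (monom a n) x = of_int a * x ^ n"
  by (induction n) (auto simp: monom_0 monom_Suc)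

lemma ipoly_pcompose [simp]: "ipoly (pcompose f g) x = ipoly f (ipoly g x)"
  by (induction f) (auto simp: pcompose_pCons)

text \<open>Evaluated at a root of unity w, this bounds the change of a value when w is replaced by
  w^q: it is a multiple of w^q - w.\<close>

lemma ipoly_power_diff_dvd:
  "\<exists>h. pcompose f (monom 1 i) - f = h * (monom 1 i - monom 1 1 :: int poly)"
proof (induction f)
  case 0
  then show ?case by (intro exI[of _ 0]) simp
next
  case (pCons a f)
  then obtain h where h: "pcompose f (monom 1 i) - f = h * (monom 1 i - monom 1 1)" by blast
  have "pcompose (pCons a f) (monom 1 i) - pCons a f
      = monom 1 i * (pcompose f (monom 1 i) - f) + (monom 1 i - monom 1 1) * f"
    by (simp add: pcompose_pCons algebra_simps monom_Suc monom_0)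
  also have "\<dots> = (monom 1 i * h + f) * (monom 1 i - monom 1 1)"
    unfolding h by (simp add: algebra_simps)
  finally show ?case by blast
qed

lemma monic_division:
  fixes f m :: "int poly"
  assumes "lead_coeff m = 1"
  obtains q r where "f = m * q + r" "r = 0 \<or> Polynomial.degree r < Polynomial.degree m"
proof -
  obtain q r where qr: "pseudo_divmod f m = (q, r)" by (cases "pseudo_divmod f m")
  have "m \<noteq> 0" using assms by auto
  from pseudo_divmod[OF this qr] assms that show ?thesis by simp
qed

lemma ipoly_altdef:
  "ipoly f x = (\<Sum>j<n. of_int (poly.coeff f j) * x ^ j)" if "\<forall>j\<ge>n. poly.coeff f j = 0"
proof -
  have "f = (\<Sum>j<n. monom (poly.coeff f j) j)"
  proof (rule poly_eqI)
    fix k show "poly.coeff f k = poly.coeff (\<Sum>j<n. monom (poly.coeff f j) j) k"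
      using that by (simp add: coeff_sum)
  qed
  hence "ipoly f x = ipoly (\<Sum>j<n. monom (poly.coeff f j) j) x" by (rule arg_cong)
  also have "\<dots> = (\<Sum>j<n. of_int (poly.coeff f j) * x ^ j)" by simp
  finally show ?thesis .
qed

lemma fermat_int: "prime p \<Longrightarrow> int p dvd a ^ p - a"
proof (induction a rule: int_induct[where k = 0])
  case base
  then show ?case using prime_gt_0_nat[of p] by (simp add: power_0_left)
next
  case (step1 i)
  obtain S where "(i + 1) ^ p = i ^ p + 1 ^ p + of_nat p * S"
    using freshman[OF step1.prems] by blast
  hence eq: "(i + 1) ^ p - (i + 1) = (i ^ p - i) + int p * S" by simp
  show ?case unfolding eq by (intro dvd_add step1.IH step1.prems dvd_triv_left)
next
  case (step2 i)
  obtain S where "(i - 1 + 1) ^ p = (i - 1) ^ p + 1 ^ p + of_nat p * S"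
    using freshman[OF step2.prems] by blast
  hence eq: "(i - 1) ^ p - (i - 1) = (i ^ p - i) - int p * S" by simp
  show ?case unfolding eq by (rule dvd_diff[OF step2.IH[OF step2.prems] dvd_triv_left])
qed

text \<open>The congruence f(X)^p = f(X^p) modulo p. The constant term is split off by
  \<open>freshman\<close>, and Fermat's little theorem removes the p-th power from it.\<close>

lemma poly_power_prime:
  fixes f :: "int poly"
  assumes p: "prime p"
  shows "\<exists>g. f ^ p = pcompose f (monom 1 p) + smult (int p) g"
proof (induction f)
  case 0
  then show ?case using prime_gt_0_nat[OF p] by (intro exI[of _ 0]) (simp add: power_0_left)
next
  case (pCons a f)
  then obtain g where g: "f ^ p = pcompose f (monom 1 p) + smult (int p) g" by blast
  obtain b where "a ^ p - a = int p * b" using fermat_int[OF p] by (metis dvdE)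
  hence b: "[:a:] ^ p = [:a:] + smult (int p) [:b:]"
    by (simp add: poly_const_pow algebra_simps)
  have X: "pCons a f = [:a:] + monom 1 1 * f" by (simp add: monom_Suc monom_0)
  have Xp: "(monom 1 1 * f) ^ p = monom 1 p * (pcompose f (monom 1 p) + smult (int p) g)"
    by (simp add: power_mult_distrib monom_power g)
  obtain S where S: "([:a:] + monom 1 1 * f) ^ p
      = [:a:] ^ p + (monom 1 1 * f) ^ p + of_nat p * S"
    using freshman[OF p] by blast
  have "pCons a f ^ p = pcompose (pCons a f) (monom 1 p)
     + smult (int p) ([:b:] + monom 1 p * g + S)"
    unfolding X S b Xp
    by (simp add: pcompose_add pcompose_mult pcompose_pCons algebra_simps smult_add_right of_nat_poly
        monom_Suc monom_0)
  thus ?case by blast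
qed

text \<open>Values at a single root of unity already form a ring, because finitely many roots of
  unity are powers of one primitive root. This spares a generated-subring definition and gives every
  element a polynomial.\<close>

definition cycint :: "'c::field_char_0 set" where
  "cycint = {ipoly f z | f z. \<exists>n>0. z ^ n = 1}"

lemma cycintI: "n > 0 \<Longrightarrow> z ^ n = 1 \<Longrightarrow> ipoly f z \<in> cycint"
  by (auto simp: cycint_def)

lemma cycint_primroot: "n > 0 \<Longrightarrow> primroot n c \<Longrightarrow> ipoly f c \<in> cycint"
  by (rule cycintI[of n]) (auto simp: primrootD)

lemma cycint_level:
  assumes "a \<in> cycint"
  obtains n where "n > 0"
    "\<And>N c. \<lbrakk>N > 0; n dvd N; primroot N c\<rbrakk> \<Longrightarrow> \<exists>f. a = ipoly f (c::'c::field_char_0)"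
proof -
  obtain f z n where a: "a = ipoly f z" "n > 0" "z ^ n = 1" using assms by (auto simp: cycint_def)
  have "\<exists>f. a = ipoly f c" if N: "N > 0" "n dvd N" "primroot N c" for N c
  proof -
    have "z ^ N = 1" using a(3) N(2) by (auto simp: power_mult elim!: dvdE)
    then obtain i where "z = c ^ i" using primroot_generates N by metis
    hence "a = ipoly (pcompose f (monom 1 i)) c" using a by simp
    thus ?thesis by blast
  qed
  with a(2) show ?thesis by (rule that)
qed

text \<open>The factor m lets the caller force the level to be divisible by a given number; with m =
  p it supplies roots of unity of p-power order.\<close>

lemma cycint_common_level:
  fixes a b :: "'c::{alg_closed_field,field_char_0}"
  assumes "a \<in> cycint" "b \<in> cycint" "m > 0"
  obtains n c f g where "n > 0" "m dvd n" "primroot n c" "a = ipoly f c" "b = ipoly g c"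
proof -
  obtain n1 where n1: "n1 > 0"
    "\<And>N c. \<lbrakk>N > 0; n1 dvd N; primroot N c\<rbrakk> \<Longrightarrow> \<exists>f. a = ipoly f c"
    using cycint_level[OF assms(1)] by blast
  obtain n2 where n2: "n2 > 0"
    "\<And>N c. \<lbrakk>N > 0; n2 dvd N; primroot N c\<rbrakk> \<Longrightarrow> \<exists>f. b = ipoly f c"
    using cycint_level[OF assms(2)] by blast
  let ?n = "m * n1 * n2"
  have n: "?n > 0" using assms n1 n2 by simp
  obtain c :: 'c where c: "primroot ?n c" using primroot_exists[OF n] by blast
  have "\<exists>f. a = ipoly f c" by (rule n1(2)[OF n _ c]) simp
  moreover have "\<exists>g. b = ipoly g c" by (rule n2(2)[OF n _ c]) simp
  ultimately show ?thesis using that[OF n _ c] by auto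
qed

context
  fixes T :: "'c::{alg_closed_field,field_char_0} itself"
begin

lemma cycint_add: "a \<in> cycint \<Longrightarrow> b \<in> cycint \<Longrightarrow> a + b \<in> (cycint :: 'c set)"
  by (rule cycint_common_level[of a b 1]) (auto simp flip: ipoly_add intro: cycint_primroot)

lemma cycint_mult: "a \<in> cycint \<Longrightarrow> b \<in> cycint \<Longrightarrow> a * b \<in> (cycint :: 'c set)"
  by (rule cycint_common_level[of a b 1]) (auto simp flip: ipoly_mult intro: cycint_primroot)

lemma cycint_of_int [simp]: "of_int a \<in> (cycint :: 'c set)"
  using cycintI[of 1 1 "[:a:]"] by simp

lemma cycint_of_nat [simp]: "of_nat a \<in> (cycint :: 'c set)"
  using cycint_of_int[of "int a"] by simp

lemma cycint_0 [simp]: "0 \<in> (cycint :: 'c set)" and cycint_1 [simp]: "1 \<in> (cycint :: 'c set)"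
  using cycint_of_int[of 0] cycint_of_int[of 1] by simp_all

lemma cycint_uminus: "a \<in> cycint \<Longrightarrow> - a \<in> (cycint :: 'c set)"
  using cycint_mult[OF cycint_of_int[of "-1"]] by force

lemma cycint_diff: "a \<in> cycint \<Longrightarrow> b \<in> cycint \<Longrightarrow> a - b \<in> (cycint :: 'c set)"
  using cycint_add[OF _ cycint_uminus, of a b] by simp

lemma cycint_power: "a \<in> cycint \<Longrightarrow> a ^ n \<in> (cycint :: 'c set)"
  by (induction n) (auto intro: cycint_mult)

lemma cycint_sum: "(\<And>i. i \<in> I \<Longrightarrow> f i \<in> cycint) \<Longrightarrow> sum f I \<in> (cycint :: 'c set)"
  by (induction I rule: infinite_finite_induct) (auto intro: cycint_add)

lemma cycint_prod: "(\<And>i. i \<in> I \<Longrightarrow> f i \<in> cycint) \<Longrightarrow> prod f I \<in> (cycint :: 'c set)"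
  by (induction I rule: infinite_finite_induct) (auto intro: cycint_mult)

lemma cycint_ipoly: "a \<in> cycint \<Longrightarrow> ipoly f a \<in> (cycint :: 'c set)"
  by (induction f) (auto intro: cycint_add cycint_mult)

lemma cycint_root: "z ^ n = 1 \<Longrightarrow> n > 0 \<Longrightarrow> z \<in> (cycint :: 'c set)"
  using cycintI[of n z "monom 1 1"] by simp

lemmas cycint_intros = cycint_add cycint_mult cycint_uminus cycint_diff cycint_power cycint_sum
  cycint_prod cycint_ipoly

text \<open>Multiplication by an element acts on the powers of a root of unity through an integral
  matrix, whose characteristic polynomial annihilates the element.\<close>

lemma cycint_monic_poly:
  assumes "(x::'c) \<in> cycint"
  obtains h where "lead_coeff h = 1" "ipoly h x = 0"
proof -
  obtain f c n where x: "x = ipoly f c" "n > 0" "c ^ n = 1" using assms by (auto simp: cycint_def)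
  let ?m = "monom 1 n - 1 :: int poly"
  have "Polynomial.degree ?m = n"
    using x(2) by (intro antisym degree_diff_le le_degree) (auto simp: degree_monom_eq)
  hence m: "lead_coeff ?m = 1" "Polynomial.degree ?m = n" using x(2) by auto
  have "\<exists>r. (\<forall>j\<ge>n. poly.coeff r j = 0) \<and> ipoly g c = ipoly r c" for g
  proof -
    obtain q r where qr: "g = ?m * q + r" "r = 0 \<or> Polynomial.degree r < n"
      using monic_division[OF m(1)] m(2) by metis
    have "ipoly ?m c = 0" using x by simp
    hence "ipoly g c = ipoly r c" unfolding qr by simp
    moreover have "\<forall>j\<ge>n. poly.coeff r j = 0" using qr(2) by (auto simp: coeff_eq_0)
    ultimately show ?thesis by blast
  qed
  then obtain R where R: "\<And>g. \<forall>j\<ge>n. poly.coeff (R g) j = 0" "\<And>g. ipoly g c = ipoly (R g) c"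
    by metis
  define M :: "int mat" where "M = mat n n (\<lambda>(i, j). poly.coeff (R (f * monom 1 i)) j)"
  have M: "M \<in> carrier_mat n n" by (simp add: M_def)
  let ?M = "map_mat of_int M :: 'c mat"
  have cM: "?M \<in> carrier_mat n n" using M by simp
  define v where "v = vec n (\<lambda>i. c ^ i)"
  have v: "v \<in> carrier_vec n" by (simp add: v_def)
  have "?M *\<^sub>v v = x \<cdot>\<^sub>v v"
  proof (rule eq_vecI)
    show "dim_vec (?M *\<^sub>v v) = dim_vec (x \<cdot>\<^sub>v v)" using M by (simp add: v_def)
    fix i assume "i < dim_vec (x \<cdot>\<^sub>v v)"
    hence i: "i < n" by (simp add: v_def)
    have "(?M *\<^sub>v v) $ i = (\<Sum>j<n. of_int (poly.coeff (R (f * monom 1 i)) j) * c ^ j)"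
      using i by (simp add: M_def v_def scalar_prod_def atLeast0LessThan)
    also have "\<dots> = ipoly (R (f * monom 1 i)) c" by (rule ipoly_altdef[OF R(1), symmetric])
    also have "\<dots> = x * c ^ i" unfolding R(2)[symmetric] using x by simp
    also have "\<dots> = (x \<cdot>\<^sub>v v) $ i" using i by (simp add: v_def)
    finally show "(?M *\<^sub>v v) $ i = (x \<cdot>\<^sub>v v) $ i" .
  qed
  moreover have "v $ 0 \<noteq> 0\<^sub>v n $ 0" using x(2) by (simp add: v_def)
  hence "v \<noteq> 0\<^sub>v n" by metis
  ultimately have "eigenvalue ?M x"
    unfolding eigenvalue_def eigenvector_def using v cM by auto
  hence "poly (char_poly ?M) x = 0" using eigenvalue_root_char_poly[OF cM] by simp
  moreover have "char_poly ?M = map_poly of_int (char_poly M)"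
    by (rule of_int_hom.char_poly_hom[OF M])
  ultimately have "ipoly (char_poly M) x = 0" by (simp add: ipoly_def)
  moreover have "lead_coeff (char_poly M) = 1" using degree_monic_char_poly[OF M] by simp
  ultimately show ?thesis by (rule that[rotated])
qed

text \<open>An algebraic integer that is rational is an integer. Divisibility of integers inside A
  thereby becomes divisibility in the integers.\<close>

lemma cycint_rational:
  assumes "(x::'c) \<in> cycint" "of_int b * x = of_int a" "b \<noteq> 0"
  shows "b dvd a"
proof -
  obtain h where h: "lead_coeff h = 1" "ipoly h x = 0" using cycint_monic_poly[OF assms(1)] .
  have "algebraic_int x" unfolding algebraic_int_altdef_ipoly
    using h by (intro exI[of _ h]) (auto simp: ipoly_def)
  moreover have "x = of_int a / of_int b" using assms by (simp add: field_simps)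
  hence "x \<in> \<rat>" by auto
  ultimately have "x \<in> \<int>" by (intro rational_algebraic_int_is_int)
  then obtain d where "x = of_int d" by (elim Ints_cases)
  hence "(of_int (b * d) :: 'c) = of_int a" using assms(2) by simp
  hence "b * d = a" by (simp only: of_int_eq_iff)
  thus ?thesis by auto
qed

text \<open>The constant term of an annihilating polynomial is a multiple of x. If it vanishes, a
  factor X is cancelled, which is legitimate as x is nonzero.\<close>

lemma cycint_dvd_int:
  assumes "(x::'c) \<in> cycint" "x \<noteq> 0"
  obtains y b where "y \<in> cycint" "b \<noteq> 0" "x * y = of_int b"
proof -
  have "\<exists>g b. b \<noteq> 0 \<and> x * ipoly g x = of_int b" if "ipoly h x = 0" "h \<noteq> 0" for h
    using that
  proof (induction h)
    case (pCons a h)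
    show ?case
    proof (cases "a = 0")
      case True
      thus ?thesis using pCons assms(2) by auto
    next
      case False
      have "x * ipoly (- h) x = of_int a" using pCons.prems by (simp add: minus_equation_iff[of _ "of_int a"] add_eq_0_iff2)
      with False show ?thesis by blast
    qed
  qed simp
  moreover obtain h where "lead_coeff h = 1" "ipoly h x = 0" using cycint_monic_poly[OF assms(1)] .
  ultimately obtain g b where "b \<noteq> 0" "x * ipoly g x = of_int b"
    by (metis leading_coeff_0_iff zero_neq_one)
  thus ?thesis using that cycint_ipoly[OF assms(1)] by blast
qed

end

section \<open>Conjugates of roots of unity\<close>

text \<open>With t the product of the primes up to B that do not divide k, take m = k + n t: a small
  prime dividing k divides neither n nor t, and a small prime not dividing k divides t. Powers of an
  n-th root of unity do not see the change from k to m.\<close>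

lemma coprime_lift:
  fixes k n B :: nat
  assumes co: "coprime k n" and n: "n > 0"
  obtains m where "m > 0" "[m = k] (mod n)" "\<And>q. prime q \<Longrightarrow> q \<le> B \<Longrightarrow> \<not> q dvd m"
proof -
  define t where "t = (\<Prod>q | prime q \<and> q \<le> B \<and> \<not> q dvd k. q)"
  have fin: "finite {q. prime q \<and> q \<le> B \<and> \<not> q dvd k}" by (rule finite_subset[of _ "{..B}"]) auto
  have t0: "t > 0" unfolding t_def by (intro prod_pos) (auto simp: prime_gt_0_nat)
  let ?m = "k + n * t"
  have "\<not> q dvd ?m" if q: "prime q" "q \<le> B" for q
  proof (cases "q dvd k")
    case True
    have "\<not> q dvd n" using co True q by (metis coprime_common_divisor not_prime_unit)
    moreover have "\<not> q dvd t"
      unfolding t_def using q True fin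
      by (auto simp: prime_dvd_prod_iff dest: primes_dvd_imp_eq)
    ultimately show ?thesis using True q by (simp add: prime_dvd_mult_iff dvd_add_right_iff)
  next
    case False
    hence "q dvd t" unfolding t_def using q fin by (intro dvd_prodI) auto
    thus ?thesis using False by (simp add: dvd_add_left_iff)
  qed
  moreover have "[?m = k] (mod n)" by (simp add: cong_def)
  ultimately show ?thesis using that[of ?m] n t0 by simp
qed

text \<open>Landau's argument: \<open>f(z\<^sup>q)\<close> is divisible by \<open>q\<close> when \<open>f(z) = 0\<close>, and only finitely many
  primes divide one of the finitely many nonzero conjugate values.\<close>

lemma conjugate_root:
  fixes c :: "'c::{alg_closed_field,field_char_0}"
  assumes c: "primroot n c" and n: "n > 0" and k: "coprime k n" and f: "ipoly f c = 0"
  shows "ipoly f (c ^ k) = 0"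
proof -
  have "\<exists>b. b \<noteq> 0 \<and> (x \<noteq> 0 \<longrightarrow> (\<exists>y\<in>cycint. x * y = of_int b))" if "x \<in> cycint" for x :: 'c
    using cycint_dvd_int[OF that] by (metis zero_neq_one)
  then obtain b where b: "\<And>x::'c. x \<in> cycint \<Longrightarrow> b x \<noteq> 0"
    "\<And>x::'c. x \<in> cycint \<Longrightarrow> x \<noteq> 0 \<Longrightarrow> \<exists>y\<in>cycint. x * y = of_int (b x)" by metis
  have inA: "ipoly f (c ^ j) \<in> cycint" for j
    by (rule cycintI[OF n]) (use c in \<open>simp add: primrootD flip: power_mult\<close>)
  \<comment> \<open>B bounds the integers b attached to all n conjugate values, so a prime q > B
    divides none of them; a conjugate value divisible by q must then be 0.\<close>
  define B where "B = (\<Sum>j<n. nat \<bar>b (ipoly f (c ^ j))\<bar>)"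
  have cmod: "c ^ (j mod n) = c ^ j" for j
  proof -
    have "c ^ j = c ^ (n * (j div n)) * c ^ (j mod n)" by (simp flip: power_add)
    thus ?thesis using c by (simp add: primrootD)
  qed
  have B: "nat \<bar>b (ipoly f (c ^ j))\<bar> \<le> B" for j
  proof -
    have "nat \<bar>b (ipoly f (c ^ (j mod n)))\<bar> \<le> B"
      unfolding B_def using n by (intro member_le_sum) auto
    thus ?thesis by (simp only: cmod)
  qed
  have step: "ipoly f (c ^ (j * q)) = 0" if q: "prime q" "q > B" and j: "ipoly f (c ^ j) = 0" for j q
  proof (rule ccontr)
    let ?x = "ipoly f (c ^ (j * q))"
    assume x: "?x \<noteq> 0"
    obtain g where g: "f ^ q = pcompose f (monom 1 q) + smult (int q) g"
      using poly_power_prime[OF q(1)] by blast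
    have "ipoly (f ^ q) (c ^ j) = ?x + of_nat q * ipoly g (c ^ j)"
      unfolding g by (simp flip: power_mult)
    moreover have "ipoly (f ^ q) (c ^ j) = 0"
      using j prime_gt_0_nat[OF q(1)] by simp
    ultimately have gx: "?x = of_nat q * (- ipoly g (c ^ j))" by (simp add: eq_neg_iff_add_eq_0)
    obtain y where y: "y \<in> cycint" "?x * y = of_int (b ?x)" using b(2)[OF inA x] by blast
    have "- ipoly g (c ^ j) * y \<in> cycint"
      using y(1) by (intro cycint_intros cycintI[OF n])
        (use c in \<open>simp add: primrootD flip: power_mult\<close>)+
    moreover have "of_int (int q) * (- ipoly g (c ^ j) * y) = of_int (b ?x)"
      unfolding y(2)[symmetric] by (simp add: gx[THEN arg_cong, of "\<lambda>u. u * y"])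
    ultimately have "int q dvd b ?x"
      using prime_gt_0_nat[OF q(1)] by (intro cycint_rational) auto
    hence "\<bar>int q\<bar> \<le> \<bar>b ?x\<bar>" by (rule dvd_imp_le_int[OF b(1)[OF inA]])
    thus False using B[of "j * q"] q(2) by linarith
  qed
  \<comment> \<open>Modulo n the exponent k may be replaced by one whose prime factors all exceed B;
    these are then handled one after the other by \<open>step\<close>.\<close>
  obtain m where m: "m > 0" "[m = k] (mod n)" "\<And>q. prime q \<Longrightarrow> q \<le> B \<Longrightarrow> \<not> q dvd m"
    using coprime_lift[OF k n] by metis
  have "ipoly f (c ^ m) = 0" using m(1,3)
  proof (induction m rule: prime_divisors_induct)
    case zero then show ?case by simp
  next
    case (unit x) then show ?case using f by simp
  next
    case (factor q x)
    have "ipoly f (c ^ (x * q)) = 0"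
    proof (rule step)
      show "B < q" using factor by (metis dvd_triv_left not_le)
      show "ipoly f (c ^ x) = 0" using factor by (intro factor.IH) (auto dest: dvd_mult)
    qed (rule factor)
    thus ?case by (simp add: mult.commute)
  qed
  moreover have "c ^ m = c ^ k" using m(2) cmod[of m] cmod[of k] by (simp add: cong_def)
  ultimately show ?thesis by simp
qed

section \<open>Roots of unity of order prime to \<open>p\<close>\<close>

lemma muI: "n > 0 \<Longrightarrow> coprime n p \<Longrightarrow> z ^ n = 1 \<Longrightarrow> z \<in> mu p"
  by (auto simp: mu_def)

lemma muE:
  assumes "z \<in> mu p"
  obtains n where "n > 0" "coprime n p" "z ^ n = 1"
  using assms by (auto simp: mu_def)

lemma mu_1 [simp]: "1 \<in> mu p"
  by (rule muI[of 1]) auto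

lemma mu_nonzero: "z \<in> mu p \<Longrightarrow> z \<noteq> 0"
  by (auto simp: mu_def power_0_left)

lemma mu_0 [simp]: "0 \<notin> mu p"
  using mu_nonzero by blast

lemma mu_mult: "x \<in> mu p \<Longrightarrow> y \<in> mu p \<Longrightarrow> x * y \<in> mu p"
proof (elim muE)
  fix m n assume "m > 0" "coprime m p" "x ^ m = 1" "n > 0" "coprime n p" "y ^ n = 1"
  moreover have "(x * y) ^ (m * n) = (x ^ m) ^ n * (y ^ n) ^ m"
    by (simp add: power_mult_distrib mult.commute flip: power_mult)
  ultimately show ?thesis by (intro muI[of "m * n"]) auto
qed

lemma mu_inverse: "x \<in> mu p \<Longrightarrow> inverse x \<in> mu p"
  by (auto simp: mu_def power_inverse)

lemma mu_divide: "x \<in> mu p \<Longrightarrow> y \<in> mu p \<Longrightarrow> x / y \<in> mu p"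
  by (simp add: divide_inverse mu_mult mu_inverse)

lemma mu_power: "x \<in> mu p \<Longrightarrow> x ^ n \<in> mu p"
  by (induction n) (auto intro: mu_mult)

lemma mu_eq_1:
  assumes "z \<in> mu p" "z ^ (p ^ k) = 1"
  shows "z = 1"
proof -
  obtain n where n: "n > 0" "coprime n p" "z ^ n = 1" using assms(1) by (rule muE)
  have "coprime n (p ^ k)" using n by simp
  then obtain u v where uv: "n * u = p ^ k * v + 1"
    using bezout_nat[of n "p ^ k"] n(1) by auto
  have "z ^ (n * u) = 1" using n by (simp add: power_mult)
  moreover have "z ^ (p ^ k * v + 1) = z" using assms(2) by (simp add: power_mult)
  ultimately show ?thesis using uv by simp
qed

lemma mu_power_inj:
  assumes "x \<in> mu p" "y \<in> mu p" "x ^ (p ^ k) = y ^ (p ^ k)"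
  shows "x = y"
  using mu_eq_1[OF mu_divide[OF assms(1,2)], of k] assms mu_nonzero
  by (force simp: power_divide)

lemma exists_frobenius_fixing:
  fixes n p :: nat
  assumes "n > 0" "coprime n p"
  obtains K where "K > 0" "[p ^ K = 1] (mod n)"
  using euler_theorem[of p n] assms that[of "totient n"] by (simp add: coprime_commute)

lemma frobenius_fixes:
  fixes x :: "'a::monoid_mult"
  assumes "[p ^ K = 1] (mod n)" "p > 0" "x ^ n = 1"
  shows "x ^ (p ^ K) = x"
proof -
  have "p ^ K \<ge> 1" using assms(2) by simp
  then obtain m where "p ^ K = 1 + n * m"
    using assms(1) by (metis cong_to_1_nat dvdE le_add_diff_inverse)
  thus ?thesis using assms(3) by (simp add: power_add power_mult)
qed

lemma mu_cycint: "x \<in> mu p \<Longrightarrow> (x::'c::{alg_closed_field,field_char_0}) \<in> cycint"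
  by (elim muE) (rule cycint_root)

lemma MpI [intro]: "x \<in> mu p \<Longrightarrow> x \<in> Mp p"
  by (simp add: Mp_def)

lemma Mp_0 [simp]: "0 \<in> Mp p" and Mp_1 [simp]: "1 \<in> Mp p"
  by (auto simp: Mp_def)

lemma Mp_mu: "x \<in> Mp p \<Longrightarrow> x \<noteq> 0 \<Longrightarrow> x \<in> mu p"
  by (simp add: Mp_def)

lemma Mp_mult: "x \<in> Mp p \<Longrightarrow> y \<in> Mp p \<Longrightarrow> x * y \<in> Mp p"
  by (auto simp: Mp_def mu_mult)

lemma Mp_divide: "x \<in> Mp p \<Longrightarrow> y \<in> Mp p \<Longrightarrow> x / y \<in> Mp p"
  by (auto simp: Mp_def mu_divide)

lemma Mp_power: "x \<in> Mp p \<Longrightarrow> x ^ n \<in> Mp p"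
  by (induction n) (auto intro: Mp_mult)

lemma Mp_cycint: "x \<in> Mp p \<Longrightarrow> (x::'c::{alg_closed_field,field_char_0}) \<in> cycint"
  by (auto simp: Mp_def mu_cycint)

section \<open>Elementary description of the successor maps\<close>

lemma carrier_BijGroup: "carrier (BijGroup S) = Bij S"
  and one_BijGroup: "\<one>\<^bsub>BijGroup S\<^esub> = (\<lambda>x\<in>S. x)"
  by (simp_all add: BijGroup_def)

lemma BijGroup_mult:
  "f \<in> Bij S \<Longrightarrow> g \<in> Bij S \<Longrightarrow> f \<otimes>\<^bsub>BijGroup S\<^esub> g = (\<lambda>x\<in>S. f (g x))"
  by (simp add: BijGroup_def compose_def)

lemma BijGroup_pow:
  assumes "f \<in> Bij S"
  shows "f [^]\<^bsub>BijGroup S\<^esub> (n::nat) = (\<lambda>x\<in>S. (f ^^ n) x)"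
proof (induction n)
  case 0
  then show ?case by (simp add: one_BijGroup)
next
  case (Suc n)
  interpret group "BijGroup S" by (rule group_BijGroup)
  have "f [^]\<^bsub>BijGroup S\<^esub> n \<in> Bij S"
    using nat_pow_closed[of f n] assms unfolding carrier_BijGroup by blast
  hence "f [^]\<^bsub>BijGroup S\<^esub> Suc n = (\<lambda>x\<in>S. (f [^]\<^bsub>BijGroup S\<^esub> n) (f x))"
    unfolding nat_pow_Suc using assms by (rule BijGroup_mult)
  also have "\<dots> = (\<lambda>x\<in>S. (f ^^ Suc n) x)"
  proof (rule restrict_ext)
    fix x assume "x \<in> S"
    hence "f x \<in> S" using Bij_imp_funcset[OF assms] by auto
    thus "(f [^]\<^bsub>BijGroup S\<^esub> n) (f x) = (f ^^ Suc n) x"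
      unfolding Suc funpow_Suc_right by simp
  qed
  finally show ?case .
qed

lemma mult_by_Bij: "a \<in> mu p \<Longrightarrow> mult_by p a \<in> Bij (Mp p)"
  unfolding Bij_def mult_by_def
  by (auto intro!: bij_betw_byWitness[where f' = "\<lambda>x. x / a"] Mp_mult Mp_divide dest: mu_nonzero)

lemma conjugate_eq:
  fixes a :: "'c::field_char_0"
  assumes a: "a \<in> mu p" and s: "s \<in> Bij (Mp p)"
  shows "Defs.conjugate p a s = (\<lambda>x\<in>Mp p. a * s (x / a))"
    and "Defs.conjugate p a s \<in> Bij (Mp p)"
proof -
  interpret group "BijGroup (Mp p :: 'c set)" by (rule group_BijGroup)
  let ?m = "mult_by p a"
  have m: "?m \<in> Bij (Mp p)" by (rule mult_by_Bij[OF a])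
  have c: "carrier (BijGroup (Mp p :: 'c set)) = Bij (Mp p)" by (simp add: BijGroup_def)
  have i: "inv\<^bsub>BijGroup (Mp p)\<^esub> ?m \<in> Bij (Mp p)" using inv_closed[of ?m] m c by simp
  have ii: "(inv\<^bsub>BijGroup (Mp p)\<^esub> ?m) x = x / a" if x: "x \<in> Mp p" for x :: 'c
  proof -
    have "inv_into (Mp p) ?m x = x / a"
    proof (rule inv_into_f_eq)
      show "inj_on ?m (Mp p)" using m by (simp add: Bij_def bij_betw_def)
      show "x / a \<in> Mp p" using x a by (auto intro: Mp_divide)
      thus "?m (x / a) = x" using mu_nonzero[OF a] by (simp add: mult_by_def)
    qed
    thus ?thesis using inv_BijGroup[OF m] x by simp
  qed
  have ms: "?m \<otimes>\<^bsub>BijGroup (Mp p)\<^esub> s \<in> Bij (Mp p)" using m_closed[of ?m s] m s c by simp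
  have "Defs.conjugate p a s = (\<lambda>x\<in>Mp p. (?m \<otimes>\<^bsub>BijGroup (Mp p)\<^esub> s) ((inv\<^bsub>BijGroup (Mp p)\<^esub> ?m) x))"
    unfolding Defs.conjugate_def by (rule BijGroup_mult[OF ms i])
  also have "\<dots> = (\<lambda>x\<in>Mp p. a * s (x / a))"
  proof (rule restrict_ext)
    fix x :: 'c assume x: "x \<in> Mp p"
    have xa: "x / a \<in> Mp p" using x a by (auto intro: Mp_divide)
    have "s (x / a) \<in> Mp p" using Bij_imp_funcset[OF s] xa by auto
    thus "(?m \<otimes>\<^bsub>BijGroup (Mp p)\<^esub> s) ((inv\<^bsub>BijGroup (Mp p)\<^esub> ?m) x) = a * s (x / a)"
      using xa by (simp add: ii[OF x] BijGroup_mult[OF m s]) (simp add: mult_by_def)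
  qed
  finally show "Defs.conjugate p a s = (\<lambda>x\<in>Mp p. a * s (x / a))" .
  show "Defs.conjugate p a s \<in> Bij (Mp p)"
    unfolding Defs.conjugate_def using m_closed[of "?m \<otimes>\<^bsub>BijGroup (Mp p)\<^esub> s"] ms i c by simp
qed

lemma restrict_eq_iff: "(\<lambda>x\<in>S. f x) = (\<lambda>x\<in>S. g x) \<longleftrightarrow> (\<forall>x\<in>S. f x = g x)"
  by (metis restrict_apply' restrict_ext)

text \<open>On the right, bijectivity is recovered from \<open>s ^^ (p - 1)\<close>, which inverts s
  because \<open>s ^^ p\<close> is the identity. The commutation condition becomes pointwise once
  the inverse of \<open>mult_by p a\<close> is computed as division by a.\<close>

lemma Sigma_set_iff:
  fixes s :: "'c::field_char_0 \<Rightarrow> 'c"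
  assumes p: "p > 0"
  shows "s \<in> Sigma_set p \<longleftrightarrow> s \<in> extensional (Mp p) \<and> s \<in> Mp p \<rightarrow> Mp p \<and> s 0 = 1 \<and>
    (\<forall>a\<in>mu p. \<forall>x\<in>Mp p. s (a * s (x / a)) = a * s (s x / a)) \<and> (\<forall>x\<in>Mp p. (s ^^ p) x = x)"
    (is "_ \<longleftrightarrow> ?R")
proof -
  have Bij: "s \<in> Bij (Mp p)" if s: "s \<in> extensional (Mp p)" "s \<in> Mp p \<rightarrow> Mp p"
    "\<forall>x\<in>Mp p. (s ^^ p) x = x"
  proof -
    have it: "(s ^^ n) x \<in> Mp p" if "x \<in> Mp p" for n x
      using that s(2) by (induction n) auto
    obtain m where m: "p = Suc m" using p by (cases p) auto
    have "bij_betw s (Mp p) (Mp p)"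
    proof (rule bij_betw_byWitness[where f' = "s ^^ m"])
      show "\<forall>x\<in>Mp p. (s ^^ m) (s x) = x" using s(3) m by (simp add: funpow_swap1)
      show "\<forall>x\<in>Mp p. s ((s ^^ m) x) = x" using s(3) m by simp
    qed (use s it in auto)
    thus ?thesis using s by (simp add: Bij_def)
  qed
  have *: "s \<in> Sigma_set p \<longleftrightarrow> ?R" if s: "s \<in> Bij (Mp p)"
  proof -
    have f: "s \<in> Mp p \<rightarrow> Mp p" by (rule Bij_imp_funcset[OF s])
    have A: "(s \<otimes>\<^bsub>BijGroup (Mp p)\<^esub> Defs.conjugate p a s = Defs.conjugate p a s \<otimes>\<^bsub>BijGroup (Mp p)\<^esub> s)
        \<longleftrightarrow> (\<forall>x\<in>Mp p. s (a * s (x / a)) = a * s (s x / a))" if a: "a \<in> mu p" for a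
    proof -
      have xa: "x / a \<in> Mp p" if "x \<in> Mp p" for x using that a by (auto intro: Mp_divide)
      have sx: "s x \<in> Mp p" if "x \<in> Mp p" for x using that f by auto
      have "s \<otimes>\<^bsub>BijGroup (Mp p)\<^esub> Defs.conjugate p a s = (\<lambda>x\<in>Mp p. s (a * s (x / a)))"
        unfolding BijGroup_mult[OF s conjugate_eq(2)[OF a s]]
        by (rule restrict_ext) (simp add: conjugate_eq(1)[OF a s])
      moreover have "Defs.conjugate p a s \<otimes>\<^bsub>BijGroup (Mp p)\<^esub> s = (\<lambda>x\<in>Mp p. a * s (s x / a))"
        unfolding BijGroup_mult[OF conjugate_eq(2)[OF a s] s]
        by (rule restrict_ext) (simp add: conjugate_eq(1)[OF a s] sx)
      ultimately show ?thesis by (simp only: restrict_eq_iff)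
    qed
    have "\<one>\<^bsub>BijGroup (Mp p :: 'c set)\<^esub> = (\<lambda>x\<in>Mp p. x)" by (simp add: BijGroup_def)
    hence B: "(s [^]\<^bsub>BijGroup (Mp p)\<^esub> p = \<one>\<^bsub>BijGroup (Mp p)\<^esub>) \<longleftrightarrow> (\<forall>x\<in>Mp p. (s ^^ p) x = x)"
      by (simp only: BijGroup_pow[OF s] restrict_eq_iff)
    have "s \<in> carrier (BijGroup (Mp p))" using s by (simp add: BijGroup_def)
    thus ?thesis
      using f Bij_imp_extensional[OF s] unfolding Sigma_set_def mem_Collect_eq B
      by (simp only: A cong: ball_cong) blast
  qed
  show ?thesis
  proof
    assume "s \<in> Sigma_set p"
    moreover from this have "s \<in> Bij (Mp p)" by (simp add: Sigma_set_def BijGroup_def)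
    ultimately show ?R using * by blast
  next
    assume R: ?R
    hence "s \<in> Bij (Mp p)" using Bij by blast
    thus "s \<in> Sigma_set p" using R * by blast
  qed
qed

section \<open>Prime ideals above \<open>p\<close>\<close>

text \<open>Closure conditions on a subset of the field \<open>'c\<close>, instead of an ideal in a
  ring record, allow congruences modulo P to be computed with the field operations.\<close>

locale prime_over =
  fixes p :: nat and P :: "'c::{alg_closed_field,field_char_0} set"
  assumes prime_p: "prime p"
    and P_sub: "P \<subseteq> cycint"
    and P_add: "\<lbrakk>a \<in> P; b \<in> P\<rbrakk> \<Longrightarrow> a + b \<in> P"
    and P_mult: "\<lbrakk>a \<in> P; b \<in> cycint\<rbrakk> \<Longrightarrow> a * b \<in> P"
    and P_prime: "\<lbrakk>a \<in> cycint; b \<in> cycint; a * b \<in> P\<rbrakk> \<Longrightarrow> a \<in> P \<or> b \<in> P"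
    and P_p: "of_nat p \<in> P"
    and P_1: "1 \<notin> P"
begin

lemma p_pos: "p > 0"
  using prime_p prime_gt_0_nat by blast

lemma P_0 [simp]: "0 \<in> P"
  using P_mult[OF P_p, of 0] by simp

lemma P_uminus: "a \<in> P \<Longrightarrow> - a \<in> P"
  using P_mult[of a "-1"] cycint_of_int[of "-1"] by simp

lemma P_diff: "a \<in> P \<Longrightarrow> b \<in> P \<Longrightarrow> a - b \<in> P"
  using P_add[of a "- b"] P_uminus by simp

lemma P_mult_left: "a \<in> P \<Longrightarrow> b \<in> cycint \<Longrightarrow> b * a \<in> P"
  using P_mult by (simp add: mult.commute)

lemma P_cycint: "a \<in> P \<Longrightarrow> a \<in> cycint"
  using P_sub by blast

lemma P_power: "a \<in> cycint \<Longrightarrow> a ^ n \<in> P \<Longrightarrow> a \<in> P"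
proof (induction n)
  case (Suc n)
  then show ?case using P_prime[OF Suc.prems(1) cycint_power[OF Suc.prems(1)], of n] by auto
qed (use P_1 in simp)

lemma P_power_pos: "a \<in> P \<Longrightarrow> n > 0 \<Longrightarrow> a ^ n \<in> P"
  using P_mult[OF _ cycint_power[OF P_cycint], of a a "n - 1"] by (cases n) auto

lemma P_prod: "finite I \<Longrightarrow> (\<And>i. i \<in> I \<Longrightarrow> f i \<in> cycint) \<Longrightarrow> prod f I \<in> P \<Longrightarrow> \<exists>i\<in>I. f i \<in> P"
proof (induction I rule: finite_induct)
  case empty
  then show ?case using P_1 by simp
next
  case (insert x F)
  then show ?case using P_prime[of "f x" "prod f F"] by (auto intro: cycint_prod)
qed

lemma P_of_int: "of_int m \<in> P \<longleftrightarrow> int p dvd m"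
proof
  assume m: "of_int m \<in> P"
  show "int p dvd m"
  proof (rule ccontr)
    assume "\<not> int p dvd m"
    hence "coprime (int p) m" using prime_p by (intro prime_imp_coprime) auto
    then obtain u v where "u * int p + v * m = 1"
      using bezout_int[of "int p" m] by auto
    hence "(of_int (u * int p + v * m) :: 'c) = 1" by simp
    hence "(1::'c) = of_nat p * of_int u + of_int m * of_int v" by (simp add: mult.commute)
    also have "\<dots> \<in> P" by (intro P_add P_mult P_p m cycint_of_int)
    finally show False using P_1 by blast
  qed
next
  assume "int p dvd m"
  then obtain k where "m = int p * k" ..
  thus "of_int m \<in> P" using P_mult[OF P_p cycint_of_int, of k] by simp
qed

definition cg :: "'c \<Rightarrow> 'c \<Rightarrow> bool" where
  "cg a b \<longleftrightarrow> a - b \<in> P"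

lemma cg_refl [simp]: "cg a a"
  by (simp add: cg_def)

lemma cg_sym: "cg a b \<Longrightarrow> cg b a"
  unfolding cg_def using P_uminus by force

lemma cg_trans [trans]: "cg a b \<Longrightarrow> cg b c \<Longrightarrow> cg a c"
  unfolding cg_def using P_add by force

lemma cg_add: "cg a b \<Longrightarrow> cg c d \<Longrightarrow> cg (a + c) (b + d)"
  unfolding cg_def using P_add[of "a - b" "c - d"] by (simp add: algebra_simps)

lemma cg_diff: "cg a b \<Longrightarrow> cg c d \<Longrightarrow> cg (a - c) (b - d)"
  unfolding cg_def using P_diff[of "a - b" "c - d"] by (simp add: algebra_simps)

lemma cg_mult:
  assumes "cg a b" "cg c d" "a \<in> cycint" "d \<in> cycint"
  shows "cg (a * c) (b * d)"
proof -
  have "(a - b) * d + a * (c - d) \<in> P"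
    using assms unfolding cg_def by (intro P_add P_mult P_mult_left)
  thus ?thesis by (simp add: cg_def algebra_simps)
qed

lemma cg_power: "cg a b \<Longrightarrow> a \<in> cycint \<Longrightarrow> b \<in> cycint \<Longrightarrow> cg (a ^ n) (b ^ n)"
  by (induction n) (auto intro!: cg_mult cycint_power)

lemma cg_mem: "cg a b \<Longrightarrow> a \<in> P \<longleftrightarrow> b \<in> P"
  unfolding cg_def using P_add[of "a - b" b] P_diff[of a "a - b"] by auto

lemma cg_ipoly: "cg a b \<Longrightarrow> a \<in> cycint \<Longrightarrow> b \<in> cycint \<Longrightarrow> cg (ipoly f a) (ipoly f b)"
  by (induction f) (auto intro!: cg_add cg_mult cycint_ipoly)

lemma cg_freshman:
  assumes "a \<in> cycint" "b \<in> cycint"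
  shows "cg ((a + b) ^ (p ^ k)) (a ^ (p ^ k) + b ^ (p ^ k))"
proof (induction k)
  case (Suc k)
  let ?q = "p ^ k"
  have fr: "cg ((x + y) ^ p) (x ^ p + y ^ p)" if "x \<in> cycint" "y \<in> cycint" for x y
    unfolding cg_def freshman[OF prime_p] add_diff_cancel_left'
    using that by (intro P_mult P_p cycint_sum cycint_mult cycint_power cycint_of_nat)
  have "cg (((a + b) ^ ?q) ^ p) ((a ^ ?q + b ^ ?q) ^ p)"
    using assms Suc by (intro cg_power cycint_add cycint_power)
  also have "cg ((a ^ ?q + b ^ ?q) ^ p) ((a ^ ?q) ^ p + (b ^ ?q) ^ p)"
    using assms by (intro fr cycint_power)
  finally show ?case by (simp add: mult.commute flip: power_mult)
qed simp

lemma cg_frobenius: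
  assumes a: "a \<in> cycint"
  shows "cg (ipoly f a ^ (p ^ k)) (ipoly f (a ^ (p ^ k)))"
proof (induction k)
  case (Suc k)
  obtain g where g: "f ^ p = pcompose f (monom 1 p) + smult (int p) g"
    using poly_power_prime[OF prime_p] by blast
  let ?b = "a ^ (p ^ k)"
  have b: "?b \<in> cycint" by (rule cycint_power[OF a])
  have "ipoly (f ^ p) ?b = ipoly f (?b ^ p) + of_nat p * ipoly g ?b"
    unfolding g by simp
  hence *: "cg (ipoly f ?b ^ p) (ipoly f (?b ^ p))"
    unfolding cg_def using b by (simp add: P_mult P_p cycint_ipoly)
  have "cg ((ipoly f a ^ (p ^ k)) ^ p) (ipoly f ?b ^ p)"
    using Suc a b by (intro cg_power cycint_power cycint_ipoly)
  also note *
  finally show ?case by (simp add: mult.commute flip: power_mult)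
qed simp

text \<open>Frobenius is injective on A/P, since A/P is a domain of characteristic p. Writing a as
  (a - b) + b avoids the sign of (- b)^(p^k), which would single out p = 2.\<close>

lemma cg_power_p_cancel:
  assumes "a \<in> cycint" "b \<in> cycint" "cg (a ^ (p ^ k)) (b ^ (p ^ k))"
  shows "cg a b"
proof -
  have "cg ((a - b + b) ^ (p ^ k)) ((a - b) ^ (p ^ k) + b ^ (p ^ k))"
    using assms(1,2) by (intro cg_freshman cycint_diff)
  hence "cg ((a - b) ^ (p ^ k) + b ^ (p ^ k)) (a ^ (p ^ k))" by (simp add: cg_sym)
  hence "cg ((a - b) ^ (p ^ k) + b ^ (p ^ k)) (b ^ (p ^ k))" using assms(3) by (rule cg_trans)
  hence "(a - b) ^ (p ^ k) \<in> P" by (simp add: cg_def)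
  thus ?thesis unfolding cg_def by (rule P_power[OF cycint_diff[OF assms(1,2)]])
qed

lemma cg_p_power_root: "z ^ (p ^ k) = 1 \<Longrightarrow> cg z 1"
  using cg_power_p_cancel[of z 1 k] cycint_root[of z "p ^ k"] p_pos by simp

text \<open>If z = x / y is congruent to 1 but different from it, the vanishing sum 1 + z + ... +
  z^(n-1) is congruent to n, so p divides n, against the choice of n prime to p.\<close>

lemma cg_mu_eq:
  assumes x: "x \<in> mu p" and y: "y \<in> mu p" and xy: "cg x y"
  shows "x = y"
proof (rule ccontr)
  assume ne: "x \<noteq> y"
  define z where "z = x / y"
  have y0: "y \<noteq> 0" by (rule mu_nonzero[OF y])
  have z: "z \<in> mu p" "z \<noteq> 1" using x y ne y0 by (auto simp: z_def mu_divide)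
  obtain n where n: "n > 0" "coprime n p" "z ^ n = 1" using z(1) by (rule muE)
  have "cg (x * inverse y) (y * inverse y)"
    using xy x y by (intro cg_mult) (auto intro: mu_cycint mu_inverse)
  hence z1: "cg z 1" using y0 by (simp add: z_def divide_inverse)
  have zc: "z \<in> cycint" by (rule mu_cycint[OF z(1)])
  have "cg (\<Sum>i<m. z ^ i) (of_nat m)" for m
  proof (induction m)
    case (Suc m)
    have "cg (z ^ m) (1 ^ m)" using z1 zc by (intro cg_power) auto
    hence "cg ((\<Sum>i<m. z ^ i) + z ^ m) (of_nat m + 1)" using Suc by (intro cg_add) auto
    thus ?case by (simp add: add.commute)
  qed simp
  moreover have "(\<Sum>i<n. z ^ i) = 0" using power_diff_1_eq[of z n] n(3) z(2) by simp
  ultimately have "cg 0 (of_nat n)" by metis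
  hence "of_int (int n) \<in> P" using cg_mem[of 0 "of_nat n"] by simp
  hence "p dvd n" unfolding P_of_int by simp
  thus False using n(2) prime_p by (metis coprime_common_divisor dvd_refl not_prime_unit)
qed

lemma mu_notin_P: "x \<in> mu p \<Longrightarrow> x \<notin> P"
proof
  assume x: "x \<in> mu p" "x \<in> P"
  hence "x * inverse x \<in> P" by (intro P_mult mu_cycint[OF mu_inverse]) auto
  thus False using P_1 mu_nonzero[OF x(1)] by simp
qed

lemma cg_Mp_eq:
  assumes "x \<in> Mp p" "y \<in> Mp p" "cg x y"
  shows "x = y"
  using assms cg_mu_eq[of x y] mu_notin_P[of x] mu_notin_P[of y] cg_mem[of x y]
  by (auto simp: Mp_def)

text \<open>A power q of p is chosen that removes the p-part of the order of c and fixes the rest.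
  Then a^q is congruent to y = f(c^q), and y^q to y. Hence P contains the product of the differences
  y - t over the solutions t of t^q = t, so some t is congruent to y; and a is congruent to t after
  cancelling q in a^q and t^q = t.\<close>

lemma exists_representative:
  assumes a: "a \<in> cycint"
  shows "\<exists>t\<in>Mp p. cg a t"
proof -
  obtain N c f where N: "N > 0" "primroot N c" "a = ipoly f c"
    by (rule cycint_common_level[OF a a, of 1]) auto
  obtain n where n: "N = p ^ multiplicity p N * n" "\<not> p dvd n"
    using multiplicity_decompose'[of N p] N(1) prime_p by (metis not_prime_unit neq0_conv)
  have n0: "n > 0" using N(1) n by (cases n) auto
  have co: "coprime n p" using n(2) prime_p by (metis coprime_commute prime_imp_coprime)
  obtain K0 where K0: "K0 > 0" "[p ^ K0 = 1] (mod n)"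
    using exists_frobenius_fixing[OF n0 co] .
  \<comment> \<open>A positive multiple of K0, so that p^K is 1 modulo n, and at least the exponent
    of p in N, so that c^(p^K) has order dividing n.\<close>
  define K where "K = K0 * (multiplicity p N + 1)"
  define q where "q = p ^ K"
  have "[p ^ K = 1] (mod n)"
    using cong_pow[OF K0(2), of "multiplicity p N + 1"] unfolding K_def power_mult by simp
  hence fixq: "x ^ q = x" if "x ^ n = 1" for x :: 'c
    unfolding q_def using p_pos that by (rule frobenius_fixes)
  have "1 * multiplicity p N \<le> K" unfolding K_def using K0(1) by (intro mult_le_mono) auto
  hence "multiplicity p N \<le> K" by simp
  hence "p ^ multiplicity p N dvd q" unfolding q_def by (rule le_imp_power_dvd)
  hence "N dvd q * n" by (subst n(1)) (rule mult_dvd_mono, auto)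
  hence cqn: "(c ^ q) ^ n = 1" using N(2) by (simp add: primrootD flip: power_mult)
  have cc: "c \<in> cycint" using N(1,2) by (intro cycint_root[of c N]) (auto simp: primrootD)
  define y where "y = ipoly f (c ^ q)"
  have y: "y \<in> cycint" unfolding y_def by (intro cycint_ipoly cycint_power cc)
  have ay: "cg (a ^ q) y" unfolding y_def N(3) q_def by (rule cg_frobenius[OF cc])
  have yq: "cg (y ^ q) y"
    using cg_frobenius[of "c ^ q" f K] fixq[OF cqn] cc unfolding y_def q_def
    by (simp add: cycint_power)
  have K: "K > 0" unfolding K_def using K0(1) by simp
  have q2: "q > 1" unfolding q_def by (rule one_less_power[OF prime_gt_1_nat[OF prime_p] K])
  hence q1: "q - 1 > 0" by simp
  obtain d :: 'c where d: "primroot (q - 1) d" using primroot_exists[OF q1] by blast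
  have "y ^ q - y = y * (y ^ (q - 1) - 1)"
    using q2 by (simp add: power_eq_if[of y q] right_diff_distrib)
  also have "y ^ (q - 1) - 1 = (\<Prod>z | z ^ (q - 1) = 1. y - z)"
    using arg_cong[OF monom_minus_one_eq_prod[OF d q1], of "\<lambda>f. poly f y"]
    by (simp add: poly_monom poly_prod)
  finally have "y * (\<Prod>z | z ^ (q - 1) = 1. y - z) \<in> P" using yq by (simp add: cg_def)
  moreover have "z \<in> cycint" if "z ^ (q - 1) = 1" for z :: 'c using cycint_root[OF that q1] .
  ultimately have "y \<in> P \<or> (\<Prod>z | z ^ (q - 1) = 1. y - z) \<in> P"
    using y by (intro P_prime cycint_prod cycint_diff) auto
  hence "\<exists>t\<in>Mp p. t ^ q = t \<and> cg y t"
  proof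
    assume "y \<in> P"
    thus ?thesis using q2 by (intro bexI[of _ 0]) (auto simp: cg_def)
  next
    assume "(\<Prod>z | z ^ (q - 1) = 1. y - z) \<in> P"
    then obtain z where z: "z ^ (q - 1) = 1" "y - z \<in> P"
      using P_prod[OF roots_of_unity_eq(4)[OF d q1], of "\<lambda>z. y - z"]
        cycint_diff[OF y cycint_root[OF _ q1]] by blast
    have "coprime (q - 1) q" by (rule coprime_diff_one_left_nat) (use q2 in simp)
    moreover have "p dvd q" unfolding q_def using K by (simp add: dvd_power)
    ultimately have "coprime (q - 1) p" by (rule coprime_divisors[OF dvd_refl, rotated])
    hence "z \<in> mu p" using z(1) q1 by (intro muI)
    moreover have "z ^ q = z" using z(1) q2 by (simp add: power_eq_if[of z q])
    ultimately show ?thesis using z by (auto simp: cg_def)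
  qed
  then obtain t where t: "t \<in> Mp p" "t ^ q = t" "cg y t" by blast
  have "cg (a ^ q) (t ^ q)" using ay t cg_trans by simp
  hence "cg a t" unfolding q_def by (rule cg_power_p_cancel[OF a Mp_cycint[OF t(1)]])
  thus ?thesis using t(1) by blast
qed

definition rep :: "'c \<Rightarrow> 'c" where
  "rep a = (THE t. t \<in> Mp p \<and> cg a t)"

lemma rep:
  assumes "a \<in> cycint"
  shows "rep a \<in> Mp p" "cg a (rep a)"
proof -
  have "\<exists>!t. t \<in> Mp p \<and> cg a t"
    using exists_representative[OF assms] cg_Mp_eq cg_sym cg_trans by blast
  from theI'[OF this] show "rep a \<in> Mp p" "cg a (rep a)" by (auto simp: rep_def)
qed

definition successor :: "'c \<Rightarrow> 'c" where
  "successor = (\<lambda>x\<in>Mp p. rep (x + 1))"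

lemma successor:
  assumes "x \<in> Mp p"
  shows "successor x \<in> Mp p" "cg (successor x) (x + 1)"
proof -
  have "x + 1 \<in> cycint" using assms by (intro cycint_add Mp_cycint) auto
  from rep[OF this] show "successor x \<in> Mp p" "cg (successor x) (x + 1)"
    using assms by (auto simp: successor_def intro: cg_sym)
qed

lemma successor_eq: "x \<in> Mp p \<Longrightarrow> y \<in> Mp p \<Longrightarrow> cg (x + 1) y \<Longrightarrow> successor x = y"
  using successor cg_Mp_eq cg_trans by blast

text \<open>Conjugating translation by 1 under multiplication by a gives translation by a. The
  commutation condition of \<open>Sigma_set\<close> is therefore the commutativity of
  translations.\<close>

lemma successor_mult:
  assumes "x \<in> Mp p" "a \<in> mu p"
  shows "cg (a * successor (x / a)) (x + a)"
proof -
  have xa: "x / a \<in> Mp p" using assms by (auto intro: Mp_divide)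
  have "cg (a * successor (x / a)) (a * (x / a + 1))"
    using assms successor[OF xa] xa by (intro cg_mult) (auto intro: mu_cycint Mp_cycint cycint_add)
  thus ?thesis using mu_nonzero[OF assms(2)] by (simp add: algebra_simps)
qed

lemma successor_in_Sigma: "successor \<in> Sigma_set p"
  unfolding Sigma_set_iff[OF p_pos]
proof (intro conjI ballI)
  show "successor \<in> extensional (Mp p)" by (simp add: successor_def)
  show "successor \<in> Mp p \<rightarrow> Mp p" using successor by auto
  show "successor 0 = 1" by (rule successor_eq) auto
next
  fix a x :: 'c assume a: "a \<in> mu p" and x: "x \<in> Mp p"
  have xa: "x / a \<in> Mp p" "successor x / a \<in> Mp p" using a x successor by (auto intro: Mp_divide)
  let ?l = "a * successor (x / a)"
  have l: "?l \<in> Mp p" using a successor[OF xa(1)] by (auto intro: Mp_mult)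
  have "cg (successor ?l) (?l + 1)" by (rule successor[OF l])
  also have "cg (?l + 1) (x + a + 1)" by (intro cg_add successor_mult x a cg_refl)
  finally have 1: "cg (successor ?l) (x + a + 1)" .
  have "cg (a * successor (successor x / a)) (successor x + a)"
    by (intro successor_mult successor x a)
  also have "cg (successor x + a) (x + 1 + a)" by (intro cg_add successor x cg_refl)
  finally have 2: "cg (a * successor (successor x / a)) (x + a + 1)" by (simp add: add_ac)
  show "successor ?l = a * successor (successor x / a)"
    by (rule cg_Mp_eq[OF successor(1)[OF l] Mp_mult[OF MpI[OF a] successor(1)[OF xa(2)]]
          cg_trans[OF 1 cg_sym[OF 2]]])
next
  fix x :: 'c assume x: "x \<in> Mp p"
  have *: "(successor ^^ n) x \<in> Mp p \<and> cg ((successor ^^ n) x) (x + of_nat n)" for n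
  proof (induction n)
    case (Suc n)
    let ?y = "(successor ^^ n) x"
    have "cg (successor ?y) (?y + 1)" using Suc by (intro successor) auto
    also have "cg (?y + 1) (x + of_nat n + 1)" using Suc by (intro cg_add) auto
    finally show ?case using Suc successor(1)[of ?y] by (simp add: add_ac)
  qed (use x in simp)
  have "cg (x + of_nat p) x" using P_p by (simp add: cg_def)
  thus "(successor ^^ p) x = x"
    using *[of p] x cg_Mp_eq cg_trans by blast
qed

end

section \<open>Evaluation of integral polynomials in a ring\<close>

context cring
begin

definition kint :: "int \<Rightarrow> 'a" where
  "kint a = [a] \<cdot> \<one>"

lemma kint_closed [simp]: "kint a \<in> carrier R"
  by (simp add: kint_def)

lemma kint_0 [simp]: "kint 0 = \<zero>" and kint_1 [simp]: "kint 1 = \<one>"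
  by (simp_all add: kint_def add_pow_int_ge)

lemma kint_add: "kint (a + b) = kint a \<oplus> kint b"
  by (simp add: kint_def add.int_pow_mult)

lemma kint_mult: "kint (a * b) = kint a \<otimes> kint b"
  by (simp add: kint_def add_pow_ldistr_int add.int_pow_pow mult.commute)

text \<open>Counterpart of \<open>ipoly\<close> for a ring given by a record. It serves two fields:
  the one on \<open>Mp p\<close> attached to a successor map, and the algebraic closure F.\<close>

definition iev :: "int poly \<Rightarrow> 'a \<Rightarrow> 'a" where
  "iev f x = foldr (\<lambda>a r. kint a \<oplus> x \<otimes> r) (coeffs f) \<zero>"

lemma iev_0 [simp]: "iev 0 x = \<zero>"
  by (simp add: iev_def)

lemma iev_pCons [simp]: "x \<in> carrier R \<Longrightarrow> iev (pCons a f) x = kint a \<oplus> x \<otimes> iev f x"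
  by (cases "f = 0"; cases "a = 0") (simp_all add: iev_def cCons_def)

lemma iev_closed [simp]: "x \<in> carrier R \<Longrightarrow> iev f x \<in> carrier R"
  by (induction f) auto

lemma iev_1 [simp]: "x \<in> carrier R \<Longrightarrow> iev 1 x = \<one>"
  by (simp add: one_pCons)

lemma iev_add: "x \<in> carrier R \<Longrightarrow> iev (f + g) x = iev f x \<oplus> iev g x"
  by (induction f g rule: poly_induct2) (simp_all add: kint_add r_distr a_ac)

lemma iev_uminus: "x \<in> carrier R \<Longrightarrow> iev (- f) x = \<ominus> iev f x"
  using iev_add[of x "- f" f] minus_equality[of "iev (- f) x" "iev f x"] by simp

lemma iev_diff: "x \<in> carrier R \<Longrightarrow> iev (f - g) x = iev f x \<ominus> iev g x"
  using iev_add[of x f "- g"] by (simp add: iev_uminus a_minus_def)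

lemma iev_smult: "x \<in> carrier R \<Longrightarrow> iev (smult a f) x = kint a \<otimes> iev f x"
  by (induction f) (simp_all add: kint_mult r_distr m_ac)

lemma iev_mult: "x \<in> carrier R \<Longrightarrow> iev (f * g) x = iev f x \<otimes> iev g x"
proof (induction f)
  case (pCons a f)
  have "iev (pCons a f * g) x = kint a \<otimes> iev g x \<oplus> x \<otimes> (iev f x \<otimes> iev g x)"
    using pCons by (simp add: iev_add iev_smult)
  also have "\<dots> = (kint a \<oplus> x \<otimes> iev f x) \<otimes> iev g x"
    using pCons.prems by (simp add: l_distr m_assoc)
  finally show ?case using pCons.prems by simp
qed simp

lemma iev_monom: "x \<in> carrier R \<Longrightarrow> iev (Polynomial.monom 1 n) x = x [^] n"
  by (induction n) (simp_all add: monom_0 monom_Suc m_comm)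

lemma iev_power: "x \<in> carrier R \<Longrightarrow> iev (f ^ n) x = iev f x [^] n"
  by (induction n) (simp_all add: iev_mult m_comm)

lemma iev_pcompose_monom:
  "x \<in> carrier R \<Longrightarrow> iev (pcompose f (Polynomial.monom 1 n)) x = iev f (x [^] n)"
  by (induction f) (simp_all add: pcompose_pCons iev_add iev_mult iev_monom)

lemma iev_geometric:
  assumes "y \<in> carrier R" "y [^] m = \<one>"
  shows "iev (\<Sum>i<k. Polynomial.monom 1 (m * i)) y = kint (int k)"
proof (induction k)
  case (Suc k)
  have "y [^] (m * k) = \<one>" using assms by (simp flip: nat_pow_pow)
  then show ?case using Suc assms(1)
    by (simp add: iev_add iev_monom kint_add add.commute a_comm)
qed simp

end

lemma (in domain) iev_prod_nonzero:
  "\<lbrakk>x \<in> carrier R; finite A; \<And>i. i \<in> A \<Longrightarrow> iev (f i) x \<noteq> \<zero>\<rbrakk> \<Longrightarrow> iev (prod f A) x \<noteq> \<zero>"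
proof (induction A rule: infinite_finite_induct)
  case (insert i A)
  then show ?case by (simp add: iev_mult integral_iff)
qed auto

text \<open>The remainder on division by X^N - 1 has degree below N and vanishes at all N roots of
  unity of exponent N, hence is 0. As the divisor is monic, the quotient stays integral.\<close>

lemma monom_dvd_imp_vanishing:
  fixes F :: "int poly" and w :: "'c::field_char_0"
  assumes w: "primroot N w" "N > 0" and F: "\<And>i. ipoly F (w ^ i) = 0"
  shows "(monom 1 N - 1) dvd F"
proof -
  let ?m = "monom 1 N - 1 :: int poly"
  have "Polynomial.degree ?m = N"
    using w(2) by (intro antisym degree_diff_le le_degree) (auto simp: degree_monom_eq)
  hence m: "lead_coeff ?m = 1" "Polynomial.degree ?m = N" using w(2) by auto
  obtain q r where qr: "F = ?m * q + r" "r = 0 \<or> Polynomial.degree r < N"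
    using monic_division[OF m(1)] m(2) by metis
  let ?r = "map_poly of_int r :: 'c poly"
  have "r = 0"
  proof (rule ccontr)
    assume "r \<noteq> 0"
    hence d: "Polynomial.degree ?r < N" "?r \<noteq> 0" using qr(2) by auto
    have "{z. z ^ N = 1} \<subseteq> {z. poly ?r z = 0}"
    proof
      fix z :: 'c assume "z \<in> {z. z ^ N = 1}"
      hence z: "z ^ N = 1" by simp
      obtain i where "z = w ^ i" using primroot_generates[OF w z] by metis
      hence "ipoly F z = 0" using F by simp
      hence "ipoly r z = 0" using z unfolding qr(1) by simp
      thus "z \<in> {z. poly ?r z = 0}" by (simp add: ipoly_def)
    qed
    hence "card {z::'c. z ^ N = 1} \<le> card {z. poly ?r z = 0}"
      by (rule card_mono[OF poly_roots_finite[OF d(2)]])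
    also have "\<dots> \<le> Polynomial.degree ?r" by (rule card_poly_roots_bound[OF d(2)])
    finally show False using d(1) roots_of_unity_eq(3)[OF w] by simp
  qed
  thus ?thesis using qr(1) by simp
qed

text \<open>The polynomial \<open>h\<close> times suitable factors \<open>X\<^sup>d - 1\<close> vanishes at all \<open>N\<close>-th roots of unity, and
  hence is divisible by \<open>X\<^sup>N - 1\<close>; this transports the vanishing of \<open>h\<close> to the ring without using
  cyclotomic polynomials.\<close>

lemma (in domain) iev_vanishing:
  fixes w :: "'c::{alg_closed_field,field_char_0}" and p :: nat
  assumes p: "prime p" and n: "n > 0" "coprime n p" and N: "N = n * p ^ Suc k"
    and w: "primroot N w" and h: "ipoly h w = 0"
    and char: "kint (int p) = \<zero>"
    and y: "y \<in> carrier R" "\<And>i::nat. y [^] i = \<one> \<longleftrightarrow> n dvd i"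
  shows "iev h y = \<zero>"
proof -
  \<comment> \<open>M is N / p; the exponent \<open>Suc k\<close> in N guarantees that this is an
    integer. S below is the quotient of X^N - 1 by X^M - 1.\<close>
  define M where "M = n * p ^ k"
  define H where "H = (\<Prod>d\<in>{1..<n}. Polynomial.monom 1 (d * p ^ Suc k) - 1 :: int poly)"
  define S where "S = (\<Sum>i<p. Polynomial.monom 1 (M * i) :: int poly)"
  have p0: "p > 0" using p prime_gt_0_nat by blast
  have NM: "N = M * p" by (simp add: N M_def)
  have N0: "N > 0" and M0: "M > 0" using n p0 by (simp_all add: N M_def)
  \<comment> \<open>For i prime to N the factor h vanishes, by conjugacy. Otherwise a prime l
    divides both i and N: if l = p, then X^M - 1 vanishes; if not, l divides n and the factor of H
    with d = n / l vanishes.\<close>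
  have "ipoly (h * H * (Polynomial.monom 1 M - 1)) (w ^ i) = 0" for i
  proof (cases "coprime i N")
    case True
    thus ?thesis using conjugate_root[OF w N0 True h] by simp
  next
    case False
    hence "gcd i N \<noteq> 1" unfolding coprime_iff_gcd_eq_1 .
    then obtain l where "prime l" "l dvd gcd i N" using prime_factor_nat by blast
    hence l: "prime l" "l dvd i" "l dvd N" by auto
    then obtain j where j: "i = l * j" by (elim dvdE)
    show ?thesis
    proof (cases "l = p")
      case True
      hence "N dvd i * M" unfolding NM j by simp
      hence "(w ^ i) ^ M = 1" using w by (simp add: primrootD flip: power_mult)
      thus ?thesis by simp
    next
      case lp: False
      have "l dvd n"
        using l(1,3) lp p unfolding N by (auto simp: prime_dvd_mult_iff dest: prime_dvd_power primes_dvd_imp_eq)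
      then obtain d where d: "n = l * d" by (elim dvdE)
      have "d \<ge> 1" "d < n" using n(1) d prime_gt_1_nat[OF l(1)] by auto
      moreover have "N dvd i * (d * p ^ Suc k)" unfolding N j d by (simp add: mult_ac)
      hence "(w ^ i) ^ (d * p ^ Suc k) = 1" using w by (simp only: primrootD flip: power_mult)
      ultimately have "ipoly H (w ^ i) = 0"
        unfolding H_def ipoly_prod by (intro prod_zero bexI[of _ d]) (simp_all del: power_Suc)
      thus ?thesis by simp
    qed
  qed
  hence "(Polynomial.monom 1 N - 1) dvd h * H * (Polynomial.monom 1 M - 1)"
    by (rule monom_dvd_imp_vanishing[OF w N0])
  then obtain G where G: "h * H * (Polynomial.monom 1 M - 1) = (Polynomial.monom 1 N - 1) * G" by (elim dvdE)
  have "(Polynomial.monom 1 M - 1) * S = Polynomial.monom 1 N - 1"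
    using power_diff_1_eq[of "Polynomial.monom 1 M :: int poly" p] by (simp add: S_def NM monom_power mult.commute)
  hence "(Polynomial.monom 1 M - 1) * (h * H) = (Polynomial.monom 1 M - 1) * (S * G)"
    using G by (metis mult.assoc mult.commute)
  moreover have "poly.coeff (Polynomial.monom 1 M - 1 :: int poly) M = 1" using M0 by simp
  hence "(Polynomial.monom 1 M - 1 :: int poly) \<noteq> 0" by force
  ultimately have "h * H = S * G" by simp
  hence "iev h y \<otimes> iev H y = iev S y \<otimes> iev G y" using y(1) by (simp flip: iev_mult)
  \<comment> \<open>As y^M = 1, each of the p terms of S equals 1 at y, and p is 0 in the ring. The
    factor H does not vanish at y, because n is prime to p and so divides no d p^(k+1) with 0 < d <
    n.\<close>
  also have "iev S y = \<zero>" unfolding S_def using y by (simp add: iev_geometric char M_def)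
  finally have "iev h y \<otimes> iev H y = \<zero>" using y(1) by simp
  moreover have "iev H y \<noteq> \<zero>" unfolding H_def
  proof (rule iev_prod_nonzero[OF y(1)])
    fix d assume d: "d \<in> {1..<n}"
    have "\<not> n dvd d * p ^ Suc k"
    proof
      assume "n dvd d * p ^ Suc k"
      moreover have "coprime n (p ^ Suc k)" using n(2) by simp
      ultimately have "n dvd d" by (simp only: coprime_dvd_mult_left_iff)
      thus False using d by (auto dest: dvd_imp_le)
    qed
    hence "y [^] (d * p ^ Suc k) \<noteq> \<one>" using y(2) by blast
    thus "iev (Polynomial.monom 1 (d * p ^ Suc k) - 1) y \<noteq> \<zero>"
      using y(1) by (simp add: iev_diff iev_monom del: power_Suc)
  qed simp
  ultimately show ?thesis using y(1) by (auto simp: integral_iff)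
qed

section \<open>The part of a root of unity of order prime to \<open>p\<close>\<close>

text \<open>The component of z of order prime to p. Comparing p-power powers avoids choosing an
  order of z, and it is also the reason why z and its prime part agree modulo every prime above
  p.\<close>

definition prime_part :: "nat \<Rightarrow> 'c::field_char_0 \<Rightarrow> 'c" where
  "prime_part p z = (THE y. y \<in> mu p \<and> (\<exists>k. z ^ (p ^ k) = y ^ (p ^ k)))"

context
  fixes p :: nat
  assumes p: "prime p"
begin

lemma prime_part_unique:
  assumes "x \<in> mu p" "y \<in> mu p" "z ^ (p ^ k) = x ^ (p ^ k)" "z ^ (p ^ l) = y ^ (p ^ l)"
  shows "x = y"
proof (rule mu_power_inj[OF assms(1,2)])
  have "x ^ (p ^ (k + l)) = (x ^ (p ^ k)) ^ (p ^ l)" by (simp add: power_add flip: power_mult)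
  also have "\<dots> = (z ^ (p ^ k)) ^ (p ^ l)" by (simp only: assms)
  also have "\<dots> = (z ^ (p ^ l)) ^ (p ^ k)" by (simp add: mult.commute flip: power_mult)
  also have "\<dots> = y ^ (p ^ (k + l))" by (simp add: assms power_add mult.commute flip: power_mult)
  finally show "x ^ (p ^ (k + l)) = y ^ (p ^ (k + l))" .
qed

lemma prime_part_eqI: "y \<in> mu p \<Longrightarrow> z ^ (p ^ k) = y ^ (p ^ k) \<Longrightarrow> prime_part p z = y"
  unfolding prime_part_def using prime_part_unique by (intro the_equality) blast+

lemma prime_decompose:
  assumes "N > 0"
  obtains n k where "N = n * p ^ k" "n > 0" "coprime n p"
proof -
  obtain n where n: "N = p ^ multiplicity p N * n" "\<not> p dvd n"
    using multiplicity_decompose'[of N p] assms p by (metis not_prime_unit neq0_conv)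
  have "n > 0" using assms n by (cases n) auto
  moreover have "coprime n p" using n(2) p by (metis coprime_commute prime_imp_coprime)
  ultimately show ?thesis using that[of n "multiplicity p N"] n(1) by (simp add: mult.commute)
qed

text \<open>The prime part is z^(p^L), where L is a multiple of K, so that roots of order dividing n
  are fixed, and is at least k, so that the p-part is killed.\<close>

lemma prime_part:
  assumes "z ^ N = 1" "N > 0"
  shows "prime_part p z \<in> mu p" "\<exists>k. z ^ (p ^ k) = prime_part p z ^ (p ^ k)"
proof -
  have p0: "p > 0" using p prime_gt_0_nat by blast
  obtain n k where n: "N = n * p ^ k" "n > 0" "coprime n p" using prime_decompose[OF assms(2)] .
  obtain K where K: "K > 0" "[p ^ K = 1] (mod n)" using exists_frobenius_fixing[OF n(2,3)] .
  define L where "L = K * (k + 1)"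
  have L: "[p ^ L = 1] (mod n)" using cong_pow[OF K(2), of "k + 1"] unfolding L_def power_mult by simp
  have "1 * k \<le> L" unfolding L_def using K(1) by (intro mult_le_mono) auto
  hence "p ^ k dvd p ^ L" by (simp add: le_imp_power_dvd)
  hence "N dvd p ^ L * n" unfolding n(1) by (simp add: mult.commute mult_dvd_mono)
  hence "(z ^ (p ^ L)) ^ n = 1" using assms(1) by (auto elim!: dvdE simp: power_mult simp flip: power_mult)
      (metis power_mult power_one)
  hence y: "z ^ (p ^ L) \<in> mu p" using n by (intro muI)
  have "(z ^ (p ^ k)) ^ n = 1" using assms(1) n(1) by (simp add: mult.commute flip: power_mult)
  hence "(z ^ (p ^ k)) ^ (p ^ L) = z ^ (p ^ k)" by (rule frobenius_fixes[OF L p0])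
  hence e: "z ^ (p ^ k) = (z ^ (p ^ L)) ^ (p ^ k)" by (simp add: mult.commute flip: power_mult)
  have "prime_part p z = z ^ (p ^ L)" by (rule prime_part_eqI[OF y e])
  thus "prime_part p z \<in> mu p" "\<exists>k. z ^ (p ^ k) = prime_part p z ^ (p ^ k)" using y e by auto
qed

lemma prime_part_mu: "z \<in> mu p \<Longrightarrow> prime_part p z = z"
  by (rule prime_part_eqI[of _ _ 0]) auto

lemma prime_part_power:
  assumes "z ^ N = 1" "N > 0"
  shows "prime_part p (z ^ i) = prime_part p z ^ i"
proof -
  obtain k where k: "z ^ (p ^ k) = prime_part p z ^ (p ^ k)" using prime_part(2)[OF assms] by blast
  have "(z ^ i) ^ (p ^ k) = (z ^ (p ^ k)) ^ i" by (simp add: mult.commute flip: power_mult)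
  also have "\<dots> = (prime_part p z ^ i) ^ (p ^ k)" unfolding k by (simp add: mult.commute flip: power_mult)
  finally show ?thesis by (rule prime_part_eqI[OF mu_power[OF prime_part(1)[OF assms]]])
qed

lemma prime_part_order:
  assumes w: "primroot (n * p ^ m) w" and n: "n > 0" "coprime n p"
  shows "prime_part p w ^ i = 1 \<longleftrightarrow> n dvd i"
proof -
  have p0: "p > 0" using p prime_gt_0_nat by blast
  have wN: "w ^ (n * p ^ m) = 1" "n * p ^ m > 0" using w n p0 by (auto simp: primrootD)
  let ?y = "prime_part p w"
  have y: "?y \<in> mu p" using prime_part(1)[OF wN] .
  obtain k where k: "w ^ (p ^ k) = ?y ^ (p ^ k)" using prime_part(2)[OF wN] by blast
  have e: "(?y ^ i) ^ (p ^ k) = w ^ (i * p ^ k)" for i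
  proof -
    have "(?y ^ i) ^ (p ^ k) = (?y ^ (p ^ k)) ^ i" by (simp add: mult.commute flip: power_mult)
    also have "\<dots> = w ^ (i * p ^ k)" unfolding k[symmetric] by (simp add: mult.commute flip: power_mult)
    finally show ?thesis .
  qed
  show ?thesis
  proof
    assume "?y ^ i = 1"
    hence "w ^ (i * p ^ k) = 1" using e[of i] by simp
    hence "n * p ^ m dvd i * p ^ k" using w by (simp add: primrootD)
    hence "n dvd i * p ^ k" by (rule dvd_mult_left)
    moreover have "coprime n (p ^ k)" using n(2) by simp
    ultimately show "n dvd i" by (simp only: coprime_dvd_mult_left_iff)
  next
    assume "n dvd i"
    hence "n * p ^ m dvd (i * p ^ k) * p ^ m" by (intro mult_dvd_mono) auto
    hence "w ^ (i * p ^ k * p ^ m) = 1" using w by (simp add: primrootD)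
    hence "(?y ^ i) ^ (p ^ (k + m)) = 1"
      using e[of i] by (simp only: power_add power_mult)
    thus "?y ^ i = 1" using mu_eq_1[OF mu_power[OF y]] by blast
  qed
qed

end

section \<open>The field attached to a successor map\<close>

definition succ_ring :: "nat \<Rightarrow> ('c::field_char_0 \<Rightarrow> 'c) \<Rightarrow> 'c ring" where
  "succ_ring p s = \<lparr>carrier = Mp p, monoid.mult = (*), one = 1, zero = 0,
     add = (\<lambda>x y. if y = 0 then x else y * s (x / y))\<rparr>"

locale successor_map =
  fixes p :: nat and s :: "'c::{alg_closed_field,field_char_0} \<Rightarrow> 'c"
  assumes prime_p: "prime p" and s_Sigma: "s \<in> Sigma_set p"
begin

lemma p_pos: "p > 0"
  using prime_p prime_gt_0_nat by blast

lemma s_Mp: "x \<in> Mp p \<Longrightarrow> s x \<in> Mp p" and s_0 [simp]: "s 0 = 1"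
  and s_comm: "\<lbrakk>a \<in> mu p; x \<in> Mp p\<rbrakk> \<Longrightarrow> s (a * s (x / a)) = a * s (s x / a)"
  and s_iter: "x \<in> Mp p \<Longrightarrow> (s ^^ p) x = x" and s_ext: "s \<in> extensional (Mp p)"
  using s_Sigma unfolding Sigma_set_iff[OF p_pos] by auto

abbreviation K where "K \<equiv> succ_ring p s"

lemma K_simps [simp]: "carrier K = Mp p" "x \<otimes>\<^bsub>K\<^esub> y = x * y" "\<one>\<^bsub>K\<^esub> = 1" "\<zero>\<^bsub>K\<^esub> = 0"
  by (simp_all add: succ_ring_def)

lemma K_add: "x \<oplus>\<^bsub>K\<^esub> y = (if y = 0 then x else y * s (x / y))"
  by (simp add: succ_ring_def)

lemma K_add_0 [simp]: "0 \<oplus>\<^bsub>K\<^esub> y = y" "x \<oplus>\<^bsub>K\<^esub> 0 = x"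
  by (simp_all add: K_add)

lemma K_add_1: "x \<oplus>\<^bsub>K\<^esub> 1 = s x"
  by (simp add: K_add)

lemma K_add_closed: "x \<in> Mp p \<Longrightarrow> y \<in> Mp p \<Longrightarrow> x \<oplus>\<^bsub>K\<^esub> y \<in> Mp p"
  by (auto simp: K_add intro!: Mp_mult s_Mp Mp_divide)

lemma K_distr: "a * (x \<oplus>\<^bsub>K\<^esub> y) = (a * x) \<oplus>\<^bsub>K\<^esub> (a * y)"
  by (auto simp: K_add)

text \<open>The axiom compares s with its conjugate by one element, that is, translation by 1 with
  another translation. Taking a / b as that element and scaling by b yields two arbitrary
  translations.\<close>

lemma translations_commute:
  assumes a: "a \<in> mu p" and b: "b \<in> mu p" and x: "x \<in> Mp p"
  shows "(x \<oplus>\<^bsub>K\<^esub> a) \<oplus>\<^bsub>K\<^esub> b = (x \<oplus>\<^bsub>K\<^esub> b) \<oplus>\<^bsub>K\<^esub> a"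
proof -
  have nz: "a \<noteq> 0" "b \<noteq> 0" using a b by auto
  have xb: "x / b \<in> Mp p" using x b by (auto intro: Mp_divide)
  have "s (a / b * s (x / b / (a / b))) = a / b * s (s (x / b) / (a / b))"
    by (rule s_comm[OF mu_divide[OF a b] xb])
  hence "b * s (a * s (x / a) / b) = a * s (b * s (x / b) / a)"
    using nz by (simp add: field_simps)
  thus ?thesis using nz by (simp add: K_add)
qed

text \<open>Both laws of addition come from commuting translations: commutativity by applying them
  to 0, associativity below by exchanging the translations by x and by z.\<close>

lemma K_add_comm:
  assumes "x \<in> Mp p" "y \<in> Mp p"
  shows "x \<oplus>\<^bsub>K\<^esub> y = y \<oplus>\<^bsub>K\<^esub> x"
proof (cases "x = 0 \<or> y = 0")
  case False
  hence "x \<in> mu p" "y \<in> mu p" using assms Mp_mu by auto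
  from translations_commute[OF this, of 0] show ?thesis by simp
qed auto

lemma K_add_assoc:
  assumes "x \<in> Mp p" "y \<in> Mp p" "z \<in> Mp p"
  shows "(x \<oplus>\<^bsub>K\<^esub> y) \<oplus>\<^bsub>K\<^esub> z = x \<oplus>\<^bsub>K\<^esub> (y \<oplus>\<^bsub>K\<^esub> z)"
proof (cases "x = 0 \<or> z = 0")
  case False
  hence xz: "x \<in> mu p" "z \<in> mu p" using assms Mp_mu by auto
  have "(x \<oplus>\<^bsub>K\<^esub> y) \<oplus>\<^bsub>K\<^esub> z = (y \<oplus>\<^bsub>K\<^esub> x) \<oplus>\<^bsub>K\<^esub> z" using K_add_comm assms by simp
  also have "\<dots> = (y \<oplus>\<^bsub>K\<^esub> z) \<oplus>\<^bsub>K\<^esub> x" by (rule translations_commute[OF xz assms(2)])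
  also have "\<dots> = x \<oplus>\<^bsub>K\<^esub> (y \<oplus>\<^bsub>K\<^esub> z)" using K_add_comm K_add_closed assms by simp
  finally show ?thesis .
qed auto

lemma K_pow: "x [^]\<^bsub>K\<^esub> (n::nat) = x ^ n"
  by (induction n) (simp_all add: nat_pow_def power_commutes)

lemma s_iter_Mp: "x \<in> Mp p \<Longrightarrow> (s ^^ n) x \<in> Mp p"
  by (induction n) (auto intro: s_Mp)

sublocale K: domain K
proof -
  have ab: "abelian_group K"
  proof (rule abelian_groupI)
    fix x assume "x \<in> carrier K"
    hence x: "x \<in> Mp p" by simp
    \<comment> \<open>This is -1 in the new field: one more application of s closes the cycle of
      length p at 0. Multiplying by x gives the negative of x.\<close>
    let ?m = "(s ^^ (p - 1)) 0"
    have "s ?m = (s ^^ p) 0" using p_pos by (cases p) auto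
    hence "?m \<oplus>\<^bsub>K\<^esub> 1 = 0" using s_iter[of 0] by (simp add: K_add_1)
    hence "(x * ?m) \<oplus>\<^bsub>K\<^esub> x = 0" using K_distr[of x ?m 1] by simp
    thus "\<exists>y\<in>carrier K. y \<oplus>\<^bsub>K\<^esub> x = \<zero>\<^bsub>K\<^esub>" using x by (auto intro!: Mp_mult s_iter_Mp)
  next
    fix x y assume "x \<in> carrier K" "y \<in> carrier K"
    thus "x \<oplus>\<^bsub>K\<^esub> y = y \<oplus>\<^bsub>K\<^esub> x" by (simp only: K_simps K_add_comm)
  qed (simp_all add: K_add_closed K_add_assoc)
  have "comm_monoid K"
    by (rule comm_monoidI) (auto intro: Mp_mult)
  with ab have "cring K"
  proof (rule cringI)
    fix x y z
    show "(x \<oplus>\<^bsub>K\<^esub> y) \<otimes>\<^bsub>K\<^esub> z = x \<otimes>\<^bsub>K\<^esub> z \<oplus>\<^bsub>K\<^esub> y \<otimes>\<^bsub>K\<^esub> z"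
      using K_distr[of z x y] by (simp only: K_simps mult.commute[of _ z])
  qed
  then interpret K: cring K .
  show "domain K" by (rule domain.intro) (use K.cring_axioms in \<open>auto simp: domain_axioms_def\<close>)
qed

lemma kint_nat: "K.kint (int n) = (s ^^ n) 0"
proof (induction n)
  case (Suc n)
  have "K.kint (int (Suc n)) = K.kint (int n) \<oplus>\<^bsub>K\<^esub> 1"
    using K.kint_add[of "int n" 1] by (simp add: add.commute)
  thus ?case using Suc by (simp add: K_add_1)
qed simp

lemma kint_p: "K.kint (int p) = \<zero>\<^bsub>K\<^esub>"
  using s_iter[of 0] by (simp add: kint_nat)

lemma iev_Mp: "x \<in> Mp p \<Longrightarrow> K.iev f x \<in> Mp p"
  using K.iev_closed by simp

lemma K_minus_eq_0: "x \<in> Mp p \<Longrightarrow> y \<in> Mp p \<Longrightarrow> x \<ominus>\<^bsub>K\<^esub> y = 0 \<longleftrightarrow> x = y"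
  using K.r_right_minus_eq[of x y] by (simp del: K.r_right_minus_eq)

text \<open>Both z and z' are powers of one root w of order n p^(k+1), so the hypothesis is a single
  integral relation at w. \<open>K.iev_vanishing\<close> carries it to
  \<open>prime_part p w\<close>, an element of order n in the field. This is what makes reduction
  well defined on A.\<close>

lemma iev_wd:
  assumes z: "z ^ M = 1" "M > 0" and z': "z' ^ M' = 1" "M' > 0" and eq: "ipoly f z = ipoly g z'"
  shows "K.iev f (prime_part p z) = K.iev g (prime_part p z')"
proof -
  obtain n k where n: "M * M' = n * p ^ k" "n > 0" "coprime n p"
    using prime_decompose[OF prime_p, of "M * M'"] z(2) z'(2) by auto
  define N where "N = n * p ^ Suc k"
  have N0: "N > 0" using n p_pos by (simp add: N_def)
  obtain w :: 'c where w: "primroot N w" using primroot_exists[OF N0] by blast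
  have wN: "w ^ N = 1" using w by (simp add: primrootD)
  have NM: "N = M * (M' * p)" "N = M' * (M * p)" using n(1) by (simp_all add: N_def mult_ac)
  have "z ^ N = 1" "z' ^ N = 1"
    using z(1) z'(1) by (simp add: NM(1) power_mult, simp add: NM(2) power_mult)
  then obtain i j where ij: "z = w ^ i" "z' = w ^ j" using primroot_generates[OF w N0] by metis
  let ?h = "pcompose f (monom 1 i) - pcompose g (monom 1 j)"
  have y: "prime_part p w \<in> mu p" by (rule prime_part(1)[OF prime_p wN N0])
  have "K.iev ?h (prime_part p w) = \<zero>\<^bsub>K\<^esub>"
  proof (rule K.iev_vanishing[OF prime_p n(2,3) N_def w _ kint_p])
    show "ipoly ?h w = 0" using eq ij by simp
    show "prime_part p w \<in> carrier K" using y by auto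
    fix i :: nat show "prime_part p w [^]\<^bsub>K\<^esub> i = \<one>\<^bsub>K\<^esub> \<longleftrightarrow> n dvd i"
      using prime_part_order[OF prime_p w[unfolded N_def] n(2,3)] by (simp add: K_pow)
  qed
  hence "K.iev f (prime_part p w ^ i) \<ominus>\<^bsub>K\<^esub> K.iev g (prime_part p w ^ j) = \<zero>\<^bsub>K\<^esub>"
    using y by (simp add: K.iev_diff K.iev_pcompose_monom K_pow MpI)
  hence "K.iev f (prime_part p w ^ i) = K.iev g (prime_part p w ^ j)"
    using y by (simp add: K_minus_eq_0 iev_Mp mu_power MpI)
  thus ?thesis unfolding ij prime_part_power[OF prime_p wN N0] .
qed

text \<open>The homomorphism from A to the field on \<open>Mp p\<close> that replaces a root of
  unity by its prime part. A presentation of a is chosen here; \<open>iev_wd\<close> shows that the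
  value does not depend on it.\<close>

definition red :: "'c \<Rightarrow> 'c" where
  "red a = (SOME b. \<exists>f z n. a = ipoly f z \<and> z ^ n = 1 \<and> n > 0 \<and> b = K.iev f (prime_part p z))"

lemma red_ipoly:
  fixes n :: nat
  assumes "z ^ n = 1" "n > 0"
  shows "red (ipoly f z) = K.iev f (prime_part p z)"
proof -
  have "\<exists>b f' z' (n'::nat). ipoly f z = ipoly f' z' \<and> z' ^ n' = 1 \<and> n' > 0 \<and> b = K.iev f' (prime_part p z')"
    using assms by blast
  from someI_ex[OF this] show ?thesis
    unfolding red_def[symmetric] using iev_wd assms by metis
qed

lemma red_common:
  assumes "a \<in> cycint" "b \<in> cycint"
  obtains f g w where "a = ipoly f w" "b = ipoly g w" "prime_part p w \<in> carrier K"
    "\<And>h. red (ipoly h w) = K.iev h (prime_part p w)"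
proof (rule cycint_common_level[OF assms, of 1])
  fix n :: nat and w f g
  assume n: "n > 0" and w: "primroot n w" and ab: "a = ipoly f w" "b = ipoly g w"
  have "w ^ n = 1" using w by (simp add: primrootD)
  thus thesis using that[OF ab] red_ipoly[OF _ n] prime_part(1)[OF prime_p _ n] by auto
qed simp

lemma red_closed: "a \<in> cycint \<Longrightarrow> red a \<in> Mp p"
  by (rule red_common[of a a]) (auto intro: iev_Mp)

lemma red_add: "a \<in> cycint \<Longrightarrow> b \<in> cycint \<Longrightarrow> red (a + b) = red a \<oplus>\<^bsub>K\<^esub> red b"
  by (rule red_common[of a b]) (simp_all only: ipoly_add[symmetric] K.iev_add)

lemma red_diff: "a \<in> cycint \<Longrightarrow> b \<in> cycint \<Longrightarrow> red (a - b) = red a \<ominus>\<^bsub>K\<^esub> red b"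
  by (rule red_common[of a b]) (simp_all only: ipoly_diff[symmetric] K.iev_diff)

lemma red_mult: "a \<in> cycint \<Longrightarrow> b \<in> cycint \<Longrightarrow> red (a * b) = red a * red b"
  by (rule red_common[of a b]) (simp_all only: ipoly_mult[symmetric] K.iev_mult K_simps(2))

lemma red_of_int: "red (of_int a) = K.kint a"
  using red_ipoly[of 1 1 "[:a:]"] prime_part_mu[OF prime_p mu_1, where 'a = 'c] by simp

lemma red_Mp: "x \<in> Mp p \<Longrightarrow> red x = x"
proof (cases "x = 0")
  case True
  thus ?thesis using red_of_int[of 0] by simp
next
  case False
  assume "x \<in> Mp p"
  hence x: "x \<in> mu p" using False by (rule Mp_mu)
  then obtain n where n: "n > 0" "x ^ n = 1" by (elim muE)
  show ?thesis using red_ipoly[OF n(2,1), of "monom 1 1"] prime_part_mu[OF prime_p x] x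
    by (simp add: K.iev_monom K_pow MpI)
qed

definition ker :: "'c set" where
  "ker = {a \<in> cycint. red a = 0}"

sublocale ker: prime_over p ker
proof
  show "of_nat p \<in> ker" using red_of_int[of "int p"] kint_p by (simp add: ker_def)
  show "1 \<notin> ker" using red_of_int[of 1] by (simp add: ker_def)
  fix a b assume "a \<in> ker" "b \<in> ker" thus "a + b \<in> ker"
    by (auto simp: ker_def red_add cycint_add)
qed (auto simp: ker_def red_mult cycint_mult prime_p)

text \<open>Reduction is the identity on \<open>Mp p\<close> and turns x + 1 into s x, so s x is the
  representative of x + 1 modulo the kernel.\<close>

lemma ker_successor: "ker.successor = s"
proof
  fix x show "ker.successor x = s x"
  proof (cases "x \<in> Mp p")
    case x: True
    show ?thesis
    proof (rule ker.successor_eq[OF x s_Mp[OF x]])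
      have c: "x \<in> cycint" "x + 1 \<in> cycint" "s x \<in> cycint"
        using x s_Mp[OF x] by (auto intro: Mp_cycint cycint_add)
      have "red (x + 1 - s x) = (x \<oplus>\<^bsub>K\<^esub> 1) \<ominus>\<^bsub>K\<^esub> s x"
        using c x s_Mp[OF x] by (simp add: red_diff red_add red_Mp)
      also have "\<dots> = 0" using K.r_right_minus_eq[of "s x" "s x"] s_Mp[OF x]
        by (simp add: K_add_1 K_minus_eq_0 del: K.r_right_minus_eq)
      finally show "ker.cg (x + 1) (s x)" unfolding ker.cg_def using c by (simp add: ker_def cycint_diff)
    qed
  next
    case False
    thus ?thesis using s_ext by (simp add: ker.successor_def extensional_def)
  qed
qed

end

section \<open>Recovering a prime ideal from its successor map\<close>

context prime_over
begin

interpretation sm: successor_map p successor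
  by unfold_locales (rule prime_p, rule successor_in_Sigma)

lemma cg_K_add:
  assumes "x \<in> Mp p" "y \<in> Mp p"
  shows "cg (x \<oplus>\<^bsub>sm.K\<^esub> y) (x + y)"
  using successor_mult[OF assms(1), of y] assms(2) by (auto simp: sm.K_add Mp_mu)

lemma cg_kint: "cg (sm.K.kint a) (of_int a)"
proof (induction a rule: int_induct[where k = 0])
  case base
  then show ?case by simp
next
  case (step1 i)
  have m: "sm.K.kint i \<in> Mp p" using sm.K.kint_closed by simp
  have "cg (sm.K.kint i \<oplus>\<^bsub>sm.K\<^esub> 1) (sm.K.kint i + 1)" by (rule cg_K_add[OF m]) simp
  also have "cg (sm.K.kint i + 1) (of_int i + 1)" by (rule cg_add[OF step1.IH cg_refl])
  finally show ?case using sm.K.kint_add[of i 1] by simp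
next
  case (step2 i)
  have m: "sm.K.kint (i - 1) \<in> Mp p" using sm.K.kint_closed by simp
  have "cg (sm.K.kint (i - 1) \<oplus>\<^bsub>sm.K\<^esub> 1) (sm.K.kint (i - 1) + 1)" by (rule cg_K_add[OF m]) simp
  hence "cg (sm.K.kint i) (sm.K.kint (i - 1) + 1)" using sm.K.kint_add[of "i - 1" 1] by simp
  hence "cg (sm.K.kint (i - 1) + 1) (of_int i)" using step2.IH cg_sym cg_trans by blast
  from cg_diff[OF this cg_refl[of 1]] show ?case by simp
qed

lemma cg_iev:
  assumes "y \<in> mu p"
  shows "cg (sm.K.iev f y) (ipoly f y)"
proof (induction f)
  case (pCons a f)
  have y: "y \<in> carrier sm.K" using assms by auto
  have m: "sm.K.kint a \<in> Mp p" "y * sm.K.iev f y \<in> Mp p"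
    using sm.K.kint_closed sm.K.iev_closed[OF y] assms by (auto intro: Mp_mult)
  have "cg (sm.K.kint a \<oplus>\<^bsub>sm.K\<^esub> y * sm.K.iev f y) (sm.K.kint a + y * sm.K.iev f y)"
    by (rule cg_K_add[OF m])
  also have "cg (sm.K.kint a + y * sm.K.iev f y) (of_int a + y * ipoly f y)"
    using assms by (intro cg_add cg_kint cg_mult pCons cg_refl cycint_ipoly mu_cycint)
  finally show ?case using sm.K.iev_pCons[OF y] by simp
qed simp

lemma cg_prime_part:
  assumes "z ^ n = 1" "n > 0"
  shows "cg z (prime_part p z)"
proof -
  obtain k where k: "z ^ (p ^ k) = prime_part p z ^ (p ^ k)"
    using prime_part(2)[OF prime_p assms] by blast
  show ?thesis
    by (rule cg_power_p_cancel[OF cycint_root[OF assms] mu_cycint[OF prime_part(1)[OF prime_p assms]],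
          of k]) (simp add: k)
qed

lemma cg_red:
  assumes "a \<in> cycint"
  shows "cg a (sm.red a)"
proof -
  obtain f z n where a: "a = ipoly f z" "n > 0" "z ^ n = 1" using assms by (auto simp: cycint_def)
  have y: "prime_part p z \<in> mu p" by (rule prime_part(1)[OF prime_p a(3,2)])
  have "cg a (ipoly f (prime_part p z))" unfolding a(1)
    by (rule cg_ipoly[OF cg_prime_part[OF a(3,2)] cycint_root[OF a(3,2)] mu_cycint[OF y]])
  also have "cg (ipoly f (prime_part p z)) (sm.K.iev f (prime_part p z))"
    by (rule cg_sym[OF cg_iev[OF y]])
  finally show ?thesis by (simp only: sm.red_ipoly[OF a(3,2)] a(1))
qed

text \<open>Since z is congruent to its prime part, the reduction attached to the successor map
  sends a to its representative modulo P, and 0 is the only representative inside P. Hence the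
  successor map determines P.\<close>

lemma P_eq_ker: "P = sm.ker"
proof -
  have "a \<in> P \<longleftrightarrow> sm.red a = 0" if a: "a \<in> cycint" for a
  proof -
    have "a \<in> P \<longleftrightarrow> sm.red a \<in> P" by (rule cg_mem[OF cg_red[OF a]])
    also have "\<dots> \<longleftrightarrow> sm.red a = 0" using sm.red_closed[OF a] mu_notin_P Mp_mu by force
    finally show ?thesis .
  qed
  thus ?thesis using P_sub by (auto simp: sm.ker_def)
qed

end

section \<open>The cyclotomic field as a field of fractions\<close>

lemma type_algebra_simps:
  "carrier (ring_of_type_algebra :: 'a::field ring) = UNIV"
  "x \<oplus>\<^bsub>ring_of_type_algebra\<^esub> y = x + (y::'a::field)"
  "x \<otimes>\<^bsub>ring_of_type_algebra\<^esub> y = x * (y::'a::field)"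
  "\<one>\<^bsub>ring_of_type_algebra\<^esub> = (1::'a::field)" "\<zero>\<^bsub>ring_of_type_algebra\<^esub> = (0::'a::field)"
  by (simp_all add: ring_of_type_algebra_def)

lemma type_algebra_uminus: "\<ominus>\<^bsub>ring_of_type_algebra\<^esub> x = - (x::'a::field)"
proof -
  interpret field "ring_of_type_algebra :: 'a ring" by (rule field_from_type_algebra)
  show ?thesis by (rule minus_equality) (simp_all add: type_algebra_simps)
qed

lemma type_algebra_inverse: "x \<noteq> 0 \<Longrightarrow> inv\<^bsub>ring_of_type_algebra\<^esub> x = inverse (x::'a::field)"
proof -
  interpret field "ring_of_type_algebra :: 'a ring" by (rule field_from_type_algebra)
  assume "x \<noteq> 0"
  thus ?thesis by (intro comm_inv_char) (simp_all add: type_algebra_simps)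
qed

lemma carrier_Qcyc: "carrier Qcyc = generate_field ring_of_type_algebra {z. \<exists>n>0. z ^ n = 1}"
  by (simp add: Qcyc_def)

lemma Qcyc_ops:
  "x \<oplus>\<^bsub>Qcyc\<^esub> y = x + y" "x \<otimes>\<^bsub>Qcyc\<^esub> y = x * y" "\<one>\<^bsub>Qcyc\<^esub> = 1" "\<zero>\<^bsub>Qcyc\<^esub> = 0"
  by (simp_all add: Qcyc_def type_algebra_simps)

lemma generated_field_unary:
  fixes H :: "'c::field_char_0 set"
  assumes "x \<in> generate_field ring_of_type_algebra H"
  shows "- x \<in> generate_field ring_of_type_algebra H"
    and "inverse x \<in> generate_field ring_of_type_algebra H"
proof -
  have z: "0 \<in> generate_field ring_of_type_algebra H"
    using field.zero_in_generate[OF field_from_type_algebra, of H] by (simp add: type_algebra_simps)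
  show "- x \<in> generate_field ring_of_type_algebra H"
    using generate_field.a_inv[OF assms] by (simp add: type_algebra_uminus)
  show "inverse x \<in> generate_field ring_of_type_algebra H"
    using generate_field.m_inv[OF assms] z
    by (cases "x = 0") (simp_all add: type_algebra_simps type_algebra_inverse)
qed

lemma generated_field_closed:
  fixes H :: "'c::field_char_0 set"
  assumes "x \<in> generate_field ring_of_type_algebra H" "y \<in> generate_field ring_of_type_algebra H"
  shows "x + y \<in> generate_field ring_of_type_algebra H"
    and "x * y \<in> generate_field ring_of_type_algebra H"
    and "x - y \<in> generate_field ring_of_type_algebra H"
  using generate_field.eng_add[OF assms] generate_field.eng_mult[OF assms]
    generate_field.eng_add[OF assms(1) generated_field_unary(1)[OF assms(2)]]
  by (simp_all add: type_algebra_simps)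

lemma generated_field_1: "1 \<in> generate_field ring_of_type_algebra (H :: 'c::field_char_0 set)"
  using generate_field.one[of "ring_of_type_algebra :: 'c ring" H] by (simp add: type_algebra_simps)

lemma generated_field_of_int: "of_int a \<in> generate_field ring_of_type_algebra (H :: 'c::field_char_0 set)"
proof (induction a rule: int_induct[where k = 0])
  case base
  then show ?case
    using field.zero_in_generate[OF field_from_type_algebra, of H] by (simp add: type_algebra_simps)
next
  case (step1 i)
  then show ?case using generated_field_closed(1)[OF _ generated_field_1] by simp
next
  case (step2 i)
  then show ?case using generated_field_closed(3)[OF _ generated_field_1] by simp
qed

lemma generated_field_ipoly:
  "x \<in> generate_field ring_of_type_algebra H \<Longrightarrow>
    ipoly f x \<in> generate_field ring_of_type_algebra (H :: 'c::field_char_0 set)"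
proof (induction f)
  case 0
  then show ?case using generated_field_of_int[of 0 H] by simp
next
  case (pCons a f)
  then show ?case using generated_field_closed(1,2) generated_field_of_int by (metis ipoly_pCons)
qed

lemma cycint_Qcyc: "a \<in> cycint \<Longrightarrow> a \<in> carrier Qcyc"
  unfolding carrier_Qcyc cycint_def
  by (auto intro!: generated_field_ipoly[OF generate_field.incl])

lemmas Qcyc_unary = generated_field_unary[where H = "{z. \<exists>n>0. z ^ n = 1}", folded carrier_Qcyc]
lemmas Qcyc_closed = generated_field_closed[where H = "{z. \<exists>n>0. z ^ n = 1}", folded carrier_Qcyc]

lemma Qcyc_fraction:
  fixes x :: "'c::{alg_closed_field,field_char_0}"
  assumes "x \<in> carrier Qcyc"
  obtains a b where "a \<in> cycint" "b \<in> cycint" "b \<noteq> 0" "x = a / b"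
proof -
  have "\<exists>a b. a \<in> cycint \<and> b \<in> cycint \<and> b \<noteq> 0 \<and> x = a / b"
    using assms unfolding carrier_Qcyc
  proof (induction rule: generate_field.induct)
    case one
    then show ?case by (intro exI[of _ 1]) (simp add: type_algebra_simps)
  next
    case (incl h)
    then show ?case by (intro exI[of _ h] exI[of _ 1]) (auto intro: cycint_root)
  next
    case (a_inv h)
    then obtain a b where "a \<in> cycint" "b \<in> cycint" "b \<noteq> 0" "h = a / b" by blast
    then show ?case
      by (intro exI[of _ "- a"] exI[of _ b]) (simp add: type_algebra_uminus cycint_uminus)
  next
    case (m_inv h)
    then obtain a b where "a \<in> cycint" "b \<in> cycint" "b \<noteq> 0" "h = a / b" by blast
    with m_inv.hyps show ?case
      by (intro exI[of _ b] exI[of _ a]) (auto simp: type_algebra_inverse type_algebra_simps)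
  next
    case (eng_add h h')
    then obtain a b c d where "a \<in> cycint" "b \<in> cycint" "b \<noteq> 0" "h = a / b"
      "c \<in> cycint" "d \<in> cycint" "d \<noteq> 0" "h' = c / d" by blast
    then show ?case
      by (intro exI[of _ "a * d + c * b"] exI[of _ "b * d"])
        (auto simp: type_algebra_simps field_simps intro!: cycint_add cycint_mult)
  next
    case (eng_mult h h')
    then obtain a b c d where "a \<in> cycint" "b \<in> cycint" "b \<noteq> 0" "h = a / b"
      "c \<in> cycint" "d \<in> cycint" "d \<noteq> 0" "h' = c / d" by blast
    then show ?case
      by (intro exI[of _ "a * c"] exI[of _ "b * d"])
        (auto simp: type_algebra_simps intro!: cycint_mult)
  qed
  thus ?thesis using that by blast
qed

section \<open>Uniformizers\<close>

lemma poly_power_prime_power: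
  fixes f :: "int poly"
  assumes p: "prime p"
  shows "\<exists>g. f ^ (p ^ k) = pcompose f (monom 1 (p ^ k)) + smult (int p) g"
proof (induction k)
  case 0
  have "monom 1 1 = [:0, 1:: int:]" by (simp add: monom_Suc monom_0)
  then show ?case by (intro exI[of _ 0]) (simp add: pcompose_idR)
next
  case (Suc k)
  then obtain g where g: "f ^ (p ^ k) = pcompose f (monom 1 (p ^ k)) + smult (int p) g" by blast
  obtain h where h: "(f ^ (p ^ k)) ^ p = pcompose (f ^ (p ^ k)) (monom 1 p) + smult (int p) h"
    using poly_power_prime[OF p] by blast
  have m: "pcompose (monom 1 (p ^ k)) (monom 1 p) = (monom 1 (p ^ Suc k) :: int poly)"
  proof -
    have "pcompose (monom 1 m) (monom 1 p) = (monom 1 (p * m) :: int poly)" for m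
      by (induction m) (simp_all add: monom_0 monom_Suc[of _ "_::nat"] pcompose_pCons mult_monom flip: monom_0)
    thus ?thesis by (simp add: mult.commute)
  qed
  have "f ^ (p ^ Suc k) = (f ^ (p ^ k)) ^ p" by (simp add: mult.commute flip: power_mult)
  also have "\<dots> = pcompose f (monom 1 (p ^ Suc k)) + smult (int p) (pcompose g (monom 1 p) + h)"
    unfolding h unfolding g
    by (simp add: pcompose_add pcompose_smult pcompose_assoc[symmetric] m smult_add_right)
  finally show ?case by blast
qed

text \<open>Both sides are the value at 1 of the quotient of X^(p^(k+1)) - 1 by X^(p^k) - 1, once as
  a product over its roots and once as a sum of p powers.\<close>

lemma prod_primitive_prime_power:
  assumes p: "prime p" and w: "primroot (p ^ Suc k) (w::'c::field_char_0)"
  shows "(\<Prod>z | z ^ (p ^ Suc k) = 1 \<and> z ^ (p ^ k) \<noteq> 1. 1 - z) = (of_nat p :: 'c)"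
proof -
  let ?q = "p ^ k"
  have p0: "p > 0" using p prime_gt_0_nat by blast
  have w': "primroot ?q (w ^ p)" using primroot_power[of p ?q w] w p0 by simp
  define A B :: "'c set" where "A = {z. z ^ ?q = 1}" and
    "B = {z. z ^ (p ^ Suc k) = 1 \<and> z ^ ?q \<noteq> 1}"
  have un: "{z. z ^ (p ^ Suc k) = 1} = A \<union> B"
    by (auto simp: A_def B_def power_mult mult.commute[of p])
  have fin: "finite (A \<union> B)" using roots_of_unity_eq(4)[OF w] p0 unfolding un by simp
  define S where "S = (\<Sum>i<p. monom 1 (?q * i) :: 'c poly)"
  have "(monom 1 ?q - 1) * S = monom 1 (p ^ Suc k) - 1"
    using power_diff_1_eq[of "monom 1 ?q :: 'c poly" p] by (simp add: S_def monom_power mult.commute)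
  also have "\<dots> = (\<Prod>z\<in>A \<union> B. [:- z, 1:])"
    using monom_minus_one_eq_prod[OF w] p0 unfolding un by simp
  also have "\<dots> = (\<Prod>z\<in>A. [:- z, 1:]) * (\<Prod>z\<in>B. [:- z, 1:])"
    using fin by (intro prod.union_disjoint) (auto simp: A_def B_def)
  also have "(\<Prod>z\<in>A. [:- z, 1:]) = monom 1 ?q - 1"
    using monom_minus_one_eq_prod[OF w'] p0 unfolding A_def by simp
  finally have eq: "(monom 1 ?q - 1) * S = (monom 1 ?q - 1) * (\<Prod>z\<in>B. [:- z, 1:])" .
  have "poly.coeff (monom 1 ?q - 1 :: 'c poly) ?q = 1" using p0 by simp
  hence "(monom 1 ?q - 1 :: 'c poly) \<noteq> 0" by force
  hence "S = (\<Prod>z\<in>B. [:- z, 1:])" using eq by simp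
  hence "poly S 1 = (\<Prod>z\<in>B. 1 - z)" by (simp add: poly_prod)
  moreover have "poly S 1 = of_nat p" by (simp add: S_def poly_sum poly_monom)
  ultimately show ?thesis by (simp add: B_def)
qed

context prime_over
begin

text \<open>The ring L generated by w behaves at P like a discrete valuation ring with uniformizer t
  = 1 - v, where v is a power of w of p-power order. The exponent of x is the largest j for which b
  x = t^j c holds in L with b outside P. Two elements are treated together so that numerator and
  denominator of a fraction share one t and one e.\<close>

lemma uniformizer:
  fixes x y :: 'c
  assumes a: "a \<in> cycint" and a': "a' \<in> cycint" and nz: "a \<noteq> 0" "a' \<noteq> 0"
  obtains t u and e :: nat and b c b' c' and j j' :: nat
  where "t \<in> P" "e > 0" "u \<in> cycint" "u \<notin> P" "of_nat p = t ^ e * u"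
    "b \<in> cycint" "b \<notin> P" "c \<in> cycint" "c \<notin> P" "b * a = t ^ j * c"
    "b' \<in> cycint" "b' \<notin> P" "c' \<in> cycint" "c' \<notin> P" "b' * a' = t ^ j' * c'"
proof -
  obtain N w f f' where N: "N > 0" "p dvd N" "primroot N w" "a = ipoly f w" "a' = ipoly f' w"
    by (rule cycint_common_level[OF a a' p_pos])
  obtain n k' where n: "N = n * p ^ k'" "n > 0" "coprime n p"
    using prime_decompose[OF prime_p N(1)] .
  \<comment> \<open>The level was forced to be a multiple of p, so v = w^n is a nontrivial root of
    unity and t is not 0.\<close>
  have "k' \<noteq> 0"
    using N(2) n prime_p by (metis coprime_common_divisor dvd_refl mult.right_neutral not_prime_unit power_0)
  then obtain k where k: "k' = Suc k" by (cases k') auto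
  define L where "L = range (\<lambda>f. ipoly f w)"
  have L_add: "x + y \<in> L" and L_mult: "x * y \<in> L" and L_diff: "x - y \<in> L" if "x \<in> L" "y \<in> L" for x y
    using that by (auto simp: L_def simp flip: ipoly_add ipoly_mult ipoly_diff)
  have L_ipoly: "ipoly f w \<in> L" for f by (simp add: L_def)
  have L_int: "of_int i \<in> L" for i using L_ipoly[of "[:i:]"] by simp
  have L_1: "1 \<in> L" using L_int[of 1] by simp
  have L_w: "w \<in> L" using L_ipoly[of "monom 1 1"] by simp
  have L_power: "x ^ m \<in> L" if "x \<in> L" for x m by (induction m) (auto intro: L_mult L_1 that)
  have L_sum: "sum g I \<in> L" if "\<And>i. i \<in> I \<Longrightarrow> g i \<in> L" for g :: "nat \<Rightarrow> 'c" and I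
    using that by (induction I rule: infinite_finite_induct) (use L_int[of 0] in \<open>auto intro: L_add\<close>)
  have L_prod: "prod g I \<in> L" if "\<And>i. i \<in> I \<Longrightarrow> g i \<in> L" for g :: "'c \<Rightarrow> 'c" and I
    using that by (induction I rule: infinite_finite_induct) (auto intro: L_mult L_1)
  have L_cycint: "x \<in> cycint" if "x \<in> L" for x
    using that cycint_primroot[OF N(1,3)] by (auto simp: L_def)
  define v where "v = w ^ n"
  have v: "primroot (p ^ Suc k) v"
    unfolding v_def by (rule primroot_power) (use N(3) n k in auto)
  have pk: "p ^ Suc k > 0" using p_pos by simp
  have vL: "v \<in> L" unfolding v_def by (intro L_power L_w)
  have "v ^ (p ^ Suc k) = 1" using v by (simp only: primrootD dvd_refl)
  hence v1: "cg v 1" by (rule cg_p_power_root)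
  define t where "t = 1 - v"
  have tP: "t \<in> P" using cg_sym[OF v1] by (simp add: t_def cg_def)
  have tL: "t \<in> L" unfolding t_def by (intro L_diff L_1 vL)
  have geo: "1 - v ^ i = t * (\<Sum>j<i. v ^ j)" for i
    using power_diff_1_eq[of v i] by (simp add: t_def algebra_simps)
  have geo_cg: "cg (\<Sum>j<i. v ^ j) (of_nat i)" for i
  proof (induction i)
    case (Suc i)
    have "cg (v ^ i) (1 ^ i)" by (rule cg_power[OF v1 L_cycint[OF vL]]) simp
    hence "cg ((\<Sum>j<i. v ^ j) + v ^ i) (of_nat i + 1)" using Suc by (intro cg_add) auto
    thus ?case by (simp add: add.commute)
  qed simp
  define Z where "Z = {z. z ^ (p ^ Suc k) = 1 \<and> z ^ (p ^ k) \<noteq> (1::'c)}"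
  have finZ: "finite Z" unfolding Z_def
    by (rule finite_subset[OF _ roots_of_unity_eq(4)[OF v pk]]) auto
  \<comment> \<open>Here z = v^i with i prime to p, so 1 - z is t times a sum of i powers of v. This
    sum is congruent to i and thus lies outside P; the product of these units is the cofactor of t^e
    in p.\<close>
  have "\<exists>u. u \<in> L \<and> u \<notin> P \<and> 1 - z = t * u" if "z \<in> Z" for z
  proof -
    have z: "z ^ (p ^ Suc k) = 1" "z ^ (p ^ k) \<noteq> 1" using that by (auto simp: Z_def)
    obtain i where i: "z = v ^ i" using primroot_generates[OF v pk z(1)] by metis
    have "\<not> p dvd i"
    proof
      assume "p dvd i"
      hence "p ^ Suc k dvd i * p ^ k" by (simp add: mult_dvd_mono)
      hence "z ^ (p ^ k) = 1" unfolding i using v by (simp only: primrootD flip: power_mult)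
      thus False using z(2) by simp
    qed
    hence "of_nat i \<notin> P" using P_of_int[of "int i"] by simp
    hence "(\<Sum>j<i. v ^ j) \<notin> P" using cg_mem[OF geo_cg] by blast
    moreover have "(\<Sum>j<i. v ^ j) \<in> L" by (intro L_sum L_power vL)
    ultimately show ?thesis using geo[of i] unfolding i by blast
  qed
  then obtain U where U: "\<And>z. z \<in> Z \<Longrightarrow> U z \<in> L" "\<And>z. z \<in> Z \<Longrightarrow> U z \<notin> P"
    "\<And>z. z \<in> Z \<Longrightarrow> 1 - z = t * U z" by metis
  define u where "u = prod U Z"
  define e where "e = card Z"
  have uL: "u \<in> L" unfolding u_def by (intro L_prod U)
  have uP: "u \<notin> P" using P_prod[OF finZ, of U] U L_cycint unfolding u_def by blast
  have "of_nat p = (\<Prod>z\<in>Z. 1 - z)" using prod_primitive_prime_power[OF prime_p v] by (simp add: Z_def)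
  also have "\<dots> = (\<Prod>z\<in>Z. t * U z)" using U(3) by (intro prod.cong) auto
  also have "\<dots> = t ^ e * u" by (simp add: prod.distrib e_def u_def)
  finally have pe: "of_nat p = t ^ e * u" .
  have "v \<in> Z" unfolding Z_def
  proof (intro CollectI conjI)
    have "\<not> p ^ Suc k dvd p ^ k" using prime_gt_1_nat[OF prime_p] by (auto dest: dvd_imp_le)
    thus "v ^ (p ^ k) \<noteq> 1" using v by (simp only: primrootD not_False_eq_True)
  qed fact
  hence e0: "e > 0" unfolding e_def using finZ by (auto simp: card_gt_0_iff)
  obtain K where K: "K > 0" "[p ^ K = 1] (mod n)" using exists_frobenius_fixing[OF n(2,3)] .
  define q where "q = p ^ K"
  have q1: "q > 1" unfolding q_def by (rule one_less_power[OF prime_gt_1_nat[OF prime_p] K(1)])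
  obtain l where l: "q = 1 + n * l"
    using K(2) q1 unfolding q_def by (metis cong_to_1_nat dvdE le_add_diff_inverse less_imp_le)
  \<comment> \<open>Modulo t the q-th power map is the identity on L. Indeed p is a multiple of t,
    and w^q - w is one as well, because q = 1 + n l gives w^q = w v^l.\<close>
  have frob: "\<exists>d\<in>L. x ^ q - x = t * d" if x: "x \<in> L" for x
  proof -
    obtain f where f: "x = ipoly f w" using x by (auto simp: L_def)
    obtain g where g: "f ^ q = pcompose f (monom 1 q) + smult (int p) g"
      using poly_power_prime_power[OF prime_p] unfolding q_def by blast
    obtain h where h: "pcompose f (monom 1 q) - f = h * (monom 1 q - monom 1 1)"
      using ipoly_power_diff_dvd by blast
    have 1: "x ^ q = ipoly f (w ^ q) + of_nat p * ipoly g w"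
      using arg_cong[OF g, of "\<lambda>f. ipoly f w"] by (simp add: f)
    have 2: "ipoly f (w ^ q) - x = ipoly h w * (w ^ q - w)"
      using arg_cong[OF h, of "\<lambda>f. ipoly f w"] by (simp add: f)
    have "w ^ q = w * v ^ l" unfolding l v_def by (simp add: power_mult)
    hence "w ^ q - w = - (w * (1 - v ^ l))" by (simp add: algebra_simps)
    hence 3: "w ^ q - w = t * (- (w * (\<Sum>j<l. v ^ j)))" unfolding geo by simp
    obtain e' where e': "e = Suc e'" using e0 by (cases e) auto
    have "x ^ q - x = (ipoly f (w ^ q) - x) + of_nat p * ipoly g w" using 1 by simp
    also have "\<dots> = t * (t ^ e' * u * ipoly g w - ipoly h w * (w * (\<Sum>j<l. v ^ j)))"
      unfolding 2 3 pe e' by (simp add: algebra_simps)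
    finally show ?thesis
      by (rule bexI) (intro L_diff L_mult L_power L_sum L_ipoly tL uL vL L_w)
  qed
  have main: "\<exists>b c j. b \<in> L \<and> b \<notin> P \<and> c \<in> L \<and> c \<notin> P \<and> b * x = t ^ j * c" if x: "x \<in> L" "x \<noteq> 0" for x
  proof -
    obtain z m where z: "z \<in> cycint" "m \<noteq> 0" "x * z = of_int m"
      using cycint_dvd_int[OF L_cycint[OF x(1)] x(2)] .
    define i where "i = multiplicity (int p) m"
    obtain m' where m: "m = int p ^ i * m'" "\<not> int p dvd m'"
      using multiplicity_decompose'[of m "int p"] z(2) prime_p unfolding i_def
      by (metis not_prime_unit prime_nat_int_transfer)
    have m'P: "of_int m' \<notin> P" using m(2) P_of_int by blast
    define J where "J = {j. \<exists>b\<in>L. \<exists>c\<in>L. b \<notin> P \<and> b * x = t ^ j * c}"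
    have "0 \<in> J" unfolding J_def using x L_1 P_1 by (auto intro!: bexI[of _ 1])
    \<comment> \<open>A multiple of x is the integer m, whose exponent of p is i. As p is t^e up to
      a unit at P, no exponent above e i can occur, so a maximal one exists.\<close>
    moreover have bound: "j \<le> e * i" if jJ: "j \<in> J" for j
    proof (rule ccontr)
      assume "\<not> j \<le> e * i"
      then obtain d where d: "j = e * i + Suc d" by (metis add_Suc_right less_imp_Suc_add not_le)
      obtain b c where bc: "b \<in> L" "c \<in> L" "b \<notin> P" "b * x = t ^ j * c" using jJ by (auto simp: J_def)
      have t0: "t \<noteq> 0" using pe e0 p_pos by (metis mult_zero_left neq0_conv of_nat_eq_0_iff power_0_left)
      have "t ^ j * c * z = b * of_int m" using bc(4) z(3) by (metis mult.assoc)
      also have "\<dots> = t ^ (e * i) * (b * u ^ i * of_int m')"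
        unfolding m(1) by (simp add: pe power_mult_distrib power_mult)
      finally have "t ^ (e * i) * (t * (t ^ d * c * z)) = t ^ (e * i) * (b * u ^ i * of_int m')"
        unfolding d by (simp add: power_add mult_ac)
      hence "t * (t ^ d * c * z) = b * u ^ i * of_int m'" using t0 by simp
      moreover have "t * (t ^ d * c * z) \<in> P"
        by (intro P_mult tP cycint_mult cycint_power L_cycint[OF tL] L_cycint[OF bc(2)] z(1))
      ultimately have "b * u ^ i * of_int m' \<in> P" by simp
      hence "b \<in> P \<or> u ^ i \<in> P \<or> of_int m' \<in> P"
        using P_prime L_cycint[OF bc(1)] L_cycint[OF uL] cycint_power cycint_mult cycint_of_int by metis
      thus False using bc(3) m'P uP P_power[OF L_cycint[OF uL]] by blast
    qed
    ultimately obtain j where j: "j \<in> J" "\<And>i. i \<in> J \<Longrightarrow> i \<le> j"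
      using Max_in[of J] Max_ge[of J] finite_subset[of J "{..e * i}"] by (metis atMost_iff empty_iff
          finite_atMost subsetI)
    then obtain b c where bc: "b \<in> L" "c \<in> L" "b \<notin> P" "b * x = t ^ j * c" by (auto simp: J_def)
    \<comment> \<open>If c were in P, then c^(q-1) - 1 would lie outside P, while its product with c
      is a multiple of t. Multiplying the relation by this unit at P would raise the maximal
      exponent by one.\<close>
    have "c \<notin> P"
    proof
      assume cP: "c \<in> P"
      obtain d where d: "d \<in> L" "c ^ q - c = t * d" using frob[OF bc(2)] by blast
      have cq: "c ^ (q - 1) \<in> P" using cP q1 by (intro P_power_pos) auto
      have nP: "c ^ (q - 1) - 1 \<notin> P"
        using P_diff[OF cq, of "c ^ (q - 1) - 1"] P_1 by auto
      have dL: "c ^ (q - 1) - 1 \<in> L" by (intro L_diff L_power L_1 bc)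
      have cd: "c * (c ^ (q - 1) - 1) = t * d"
        using d(2) q1 by (simp add: power_eq_if[of c q] right_diff_distrib)
      have "(b * (c ^ (q - 1) - 1)) * x = (b * x) * (c ^ (q - 1) - 1)" by (simp only: mult_ac)
      also have "\<dots> = t ^ j * (c * (c ^ (q - 1) - 1))" unfolding bc(4) by (simp only: mult_ac)
      also have "\<dots> = t ^ Suc j * d" unfolding cd by (simp only: power_Suc2 mult_ac)
      finally have "(b * (c ^ (q - 1) - 1)) * x = t ^ Suc j * d" .
      moreover have "b * (c ^ (q - 1) - 1) \<notin> P"
        using P_prime[OF L_cycint[OF bc(1)] L_cycint[OF dL]] bc(3) nP by blast
      ultimately have "Suc j \<in> J" unfolding J_def using d(1) L_mult[OF bc(1) dL] by blast
      thus False using j(2) by fastforce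
    qed
    with bc show ?thesis by blast
  qed
  have "a \<in> L" "a' \<in> L" using N by (auto simp: L_def)
  with main nz obtain b c j b' c' j' where
    "b \<in> L" "b \<notin> P" "c \<in> L" "c \<notin> P" "b * a = t ^ j * c"
    "b' \<in> L" "b' \<notin> P" "c' \<in> L" "c' \<notin> P" "b' * a' = t ^ j' * c'" by metis
  with that[OF tP e0 L_cycint[OF uL] uP pe] L_cycint show ?thesis by blast
qed

end

section \<open>The valuation of a prime ideal\<close>

context prime_over
begin

text \<open>The value is read off from a power of \<open>x\<close> which is a power of \<open>p\<close> up to units at \<open>P\<close>.\<close>

definition has_value :: "'c \<Rightarrow> real \<Rightarrow> bool" where
  "has_value x r \<longleftrightarrow> (\<exists>m i j b c. m > 0 \<and> b \<in> cycint \<and> b \<notin> P \<and> c \<in> cycint \<and> c \<notin> P \<and>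
     b * x ^ m * of_nat p ^ i = c * of_nat p ^ j \<and> r = (real j - real i) / real m)"

lemma has_valueI:
  "\<lbrakk>m > 0; b \<in> cycint; b \<notin> P; c \<in> cycint; c \<notin> P; b * x ^ m * of_nat p ^ i = c * of_nat p ^ j;
    r = (real j - real i) / real m\<rbrakk> \<Longrightarrow> has_value x r"
  unfolding has_value_def by blast

lemma notin_P_mult: "\<lbrakk>a \<in> cycint; a \<notin> P; b \<in> cycint; b \<notin> P\<rbrakk> \<Longrightarrow> a * b \<notin> P"
  using P_prime by blast

lemma notin_P_power: "\<lbrakk>a \<in> cycint; a \<notin> P\<rbrakk> \<Longrightarrow> a ^ n \<notin> P"
  using P_power by blast

lemmas unit_intros = notin_P_mult notin_P_power cycint_mult cycint_power

lemma p_nonzero: "(of_nat p :: 'c) \<noteq> 0"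
  using p_pos by simp

lemma p_exponent_unique:
  assumes "b \<in> cycint" "b \<notin> P" "c \<in> cycint" "c \<notin> P" "b * of_nat p ^ i = c * of_nat p ^ j"
  shows "i = j"
proof -
  have *: "\<not> i < j" if "b \<in> cycint" "b \<notin> P" "c \<in> cycint" "b * of_nat p ^ i = c * of_nat p ^ j"
    for b c :: 'c and i j
  proof
    assume "i < j"
    then obtain d where d: "j = i + Suc d" by (metis add_Suc_right less_imp_Suc_add)
    have "of_nat p ^ i * b = of_nat p ^ i * (of_nat p * (c * of_nat p ^ d))"
      using that(4) unfolding d by (simp add: power_add mult_ac)
    hence "b = of_nat p * (c * of_nat p ^ d)" using p_nonzero by simp
    also have "\<dots> \<in> P" using that(3) by (intro P_mult P_p cycint_mult cycint_power) auto
    finally show False using that(2) by blast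
  qed
  from *[of b c i j] *[of c b j i] assms show ?thesis by force
qed

lemma has_value_nonzero: "has_value x r \<Longrightarrow> x \<noteq> 0"
  unfolding has_value_def using p_nonzero P_0 by (auto simp: power_0_left)

text \<open>Raising the two relations to the powers m' and m gives x the same exponent in both;
  after cancelling it, the exponents of p can be compared.\<close>

lemma has_value_unique:
  assumes "has_value x r" "has_value x r'"
  shows "r = r'"
proof -
  obtain m i j b c where 1: "m > 0" "b \<in> cycint" "b \<notin> P" "c \<in> cycint" "c \<notin> P"
    "b * x ^ m * of_nat p ^ i = c * of_nat p ^ j" "r = (real j - real i) / real m"
    using assms(1) unfolding has_value_def by blast
  obtain m' i' j' b' c' where 2: "m' > 0" "b' \<in> cycint" "b' \<notin> P" "c' \<in> cycint" "c' \<notin> P"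
    "b' * x ^ m' * of_nat p ^ i' = c' * of_nat p ^ j'" "r' = (real j' - real i') / real m'"
    using assms(2) unfolding has_value_def by blast
  have "(b * x ^ m * of_nat p ^ i) ^ m' * (c' * of_nat p ^ j') ^ m
      = (c * of_nat p ^ j) ^ m' * (b' * x ^ m' * of_nat p ^ i') ^ m"
    by (simp only: 1(6) 2(6))
  hence "x ^ (m * m') * (b ^ m' * c' ^ m * of_nat p ^ (i * m' + j' * m))
      = x ^ (m * m') * (c ^ m' * b' ^ m * of_nat p ^ (j * m' + i' * m))"
    by (simp add: power_mult_distrib power_add mult_ac flip: power_mult)
  hence "b ^ m' * c' ^ m * of_nat p ^ (i * m' + j' * m)
      = c ^ m' * b' ^ m * of_nat p ^ (j * m' + i' * m)"
    using has_value_nonzero[OF assms(1)] by simp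
  hence "i * m' + j' * m = j * m' + i' * m"
    by (rule p_exponent_unique[rotated 4]) (intro unit_intros 1 2)+
  hence "real (i * m' + j' * m) = real (j * m' + i' * m)" by simp
  hence "(real j - real i) * real m' = (real j' - real i') * real m" by (simp add: algebra_simps)
  thus ?thesis unfolding 1(7) 2(7) using 1(1) 2(1) by (simp add: frac_eq_eq)
qed

lemma has_value_mult:
  assumes "has_value x r" "has_value y r'"
  shows "has_value (x * y) (r + r')"
proof -
  obtain m i j b c where 1: "m > 0" "b \<in> cycint" "b \<notin> P" "c \<in> cycint" "c \<notin> P"
    "b * x ^ m * of_nat p ^ i = c * of_nat p ^ j" "r = (real j - real i) / real m"
    using assms(1) unfolding has_value_def by blast
  obtain m' i' j' b' c' where 2: "m' > 0" "b' \<in> cycint" "b' \<notin> P" "c' \<in> cycint" "c' \<notin> P"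
    "b' * y ^ m' * of_nat p ^ i' = c' * of_nat p ^ j'" "r' = (real j' - real i') / real m'"
    using assms(2) unfolding has_value_def by blast
  show ?thesis
  proof (rule has_valueI)
    show "m * m' > 0" using 1 2 by simp
    have "(b * x ^ m * of_nat p ^ i) ^ m' * (b' * y ^ m' * of_nat p ^ i') ^ m
        = (c * of_nat p ^ j) ^ m' * (c' * of_nat p ^ j') ^ m"
      by (simp only: 1(6) 2(6))
    thus "(b ^ m' * b' ^ m) * (x * y) ^ (m * m') * of_nat p ^ (i * m' + i' * m)
        = (c ^ m' * c' ^ m) * of_nat p ^ (j * m' + j' * m)"
      by (simp add: power_mult_distrib power_add mult_ac flip: power_mult)
    show "r + r' = (real (j * m' + j' * m) - real (i * m' + i' * m)) / real (m * m')"
      unfolding 1(7) 2(7) using 1(1) 2(1) by (simp add: field_simps)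
  qed (intro unit_intros 1 2)+
qed

lemma has_value_inverse:
  assumes "has_value x r"
  shows "has_value (inverse x) (- r)"
proof -
  obtain m i j b c where 1: "m > 0" "b \<in> cycint" "b \<notin> P" "c \<in> cycint" "c \<notin> P"
    "b * x ^ m * of_nat p ^ i = c * of_nat p ^ j" "r = (real j - real i) / real m"
    using assms(1) unfolding has_value_def by blast
  show ?thesis
  proof (rule has_valueI[OF 1(1) 1(4,5,2,3)])
    show "c * inverse x ^ m * of_nat p ^ j = b * of_nat p ^ i"
      using has_value_nonzero[OF assms] 1(6) by (simp add: field_simps power_inverse)
    show "- r = (real i - real j) / real m" using 1(7) by (simp add: minus_divide_left)
  qed
qed

text \<open>The exponents of numerator and denominator are subtracted, and the two alternatives keep
  the difference a natural number. The value is j / e up to sign, because t^e is p up to a unit at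
  P.\<close>

lemma normal_form:
  assumes "x \<in> carrier Qcyc" "x \<noteq> 0"
  obtains t b c and e j :: nat where "t \<in> P" "e > 0" "b \<in> cycint" "b \<notin> P" "c \<in> cycint" "c \<notin> P"
    "(b * x = t ^ j * c \<and> has_value x (real j / real e)) \<or>
     (b * x * t ^ j = c \<and> has_value x (- (real j / real e)))"
proof -
  obtain a a' where a: "a \<in> cycint" "a' \<in> cycint" "a' \<noteq> 0" "x = a / a'"
    using Qcyc_fraction[OF assms(1)] by blast
  have "a \<noteq> 0" using a assms(2) by auto
  obtain t u and e :: nat and b c b' c' and j j' :: nat
  where t: "t \<in> P" "e > 0" "u \<in> cycint" "u \<notin> P" "of_nat p = t ^ e * u"
    and b: "b \<in> cycint" "b \<notin> P" "c \<in> cycint" "c \<notin> P" "b * a = t ^ j * c"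
    and b': "b' \<in> cycint" "b' \<notin> P" "c' \<in> cycint" "c' \<notin> P" "b' * a' = t ^ j' * c'"
    by (rule uniformizer[OF a(1,2) \<open>a \<noteq> 0\<close> a(3)])
  have t0: "t \<noteq> 0" using t(2,5) p_nonzero by (auto simp: power_0_left)
  have val: "has_value y (real k / real e)"
    if "B * y = t ^ k * C" "B \<in> cycint" "B \<notin> P" "C \<in> cycint" "C \<notin> P" for B C y k
  proof (rule has_valueI[OF t(2), where b = "B ^ e * u ^ k" and c = "C ^ e" and i = 0 and j = k])
    have "B ^ e * u ^ k * y ^ e = (B * y) ^ e * u ^ k" by (simp add: power_mult_distrib mult_ac)
    also have "\<dots> = C ^ e * (t ^ e * u) ^ k"
      unfolding that(1) by (simp add: power_mult_distrib mult_ac flip: power_mult)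
    finally show "B ^ e * u ^ k * y ^ e * of_nat p ^ 0 = C ^ e * of_nat p ^ k" by (simp add: t(5))
  qed (simp_all add: unit_intros that t)
  have BC: "b * c' \<in> cycint" "b * c' \<notin> P" "b' * c \<in> cycint" "b' * c \<notin> P"
    using b b' by (simp_all add: unit_intros)
  have "b * c' * x * t ^ j' = b * x * (b' * a')" unfolding b'(5) by (simp only: mult_ac)
  also have "\<dots> = b' * (b * a)" using a(3,4) by simp
  also have "\<dots> = b' * c * t ^ j" unfolding b(5) by (simp only: mult_ac)
  finally have eq: "b * c' * x * t ^ j' = b' * c * t ^ j" .
  show ?thesis
  proof (cases "j' \<le> j")
    case True
    then obtain k where k: "j = j' + k" using le_Suc_ex by blast
    have "t ^ j' * (b * c' * x) = t ^ j' * (t ^ k * (b' * c))"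
      using eq unfolding k power_add by (simp only: mult_ac)
    hence "b * c' * x = t ^ k * (b' * c)" using t0 by simp
    with val[OF this BC] that[OF t(1,2) BC] show ?thesis by blast
  next
    case False
    then obtain k where k: "j' = j + k" using le_Suc_ex nat_le_linear by metis
    have "t ^ j * (b * c' * x * t ^ k) = t ^ j * (b' * c)"
      using eq unfolding k power_add by (simp only: mult_ac)
    hence e1: "b * c' * x * t ^ k = b' * c" using t0 by simp
    hence "(b' * c) * inverse x = t ^ k * (b * c')" using assms(2) by (simp add: field_simps)
    from has_value_inverse[OF val[OF this BC(3,4,1,2)]]
    have "has_value x (- (real k / real e))" by simp
    with e1 that[OF t(1,2) BC] show ?thesis by blast
  qed
qed

lemma has_value_exists:
  assumes "x \<in> carrier Qcyc" "x \<noteq> 0"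
  obtains r where "has_value x r"
  using normal_form[OF assms] by metis

text \<open>The valuation ring is the localisation of A at P. For a negative exponent, a denominator
  outside P would force a product of two elements outside P into P.\<close>

lemma has_value_nonneg_iff:
  assumes "x \<in> carrier Qcyc" "has_value x r"
  shows "r \<ge> 0 \<longleftrightarrow> (\<exists>b\<in>cycint. b \<notin> P \<and> b * x \<in> cycint)"
proof -
  obtain t b c and e j :: nat where t: "t \<in> P" "e > 0" "b \<in> cycint" "b \<notin> P" "c \<in> cycint" "c \<notin> P"
    "(b * x = t ^ j * c \<and> has_value x (real j / real e)) \<or>
     (b * x * t ^ j = c \<and> has_value x (- (real j / real e)))"
    using normal_form[OF assms(1) has_value_nonzero[OF assms(2)]] by metis
  note tc = P_cycint[OF t(1)]
  from t(7) show ?thesis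
  proof
    assume h: "b * x = t ^ j * c \<and> has_value x (real j / real e)"
    hence "r = real j / real e" using has_value_unique assms(2) by blast
    moreover have "b * x \<in> cycint" using h tc t(5) by (simp add: cycint_mult cycint_power)
    ultimately show ?thesis using t by auto
  next
    assume h: "b * x * t ^ j = c \<and> has_value x (- (real j / real e))"
    hence r: "r = - (real j / real e)" using has_value_unique assms(2) by blast
    show ?thesis
    proof (cases "j = 0")
      case True
      hence "b * x \<in> cycint" using h t(5) by simp
      thus ?thesis using True r t by auto
    next
      case False
      have "\<not> (\<exists>b\<in>cycint. b \<notin> P \<and> b * x \<in> cycint)"
      proof
        assume "\<exists>b\<in>cycint. b \<notin> P \<and> b * x \<in> cycint"
        then obtain b' where b': "b' \<in> cycint" "b' \<notin> P" "b' * x \<in> cycint" by blast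
        have "t ^ j * (b * (b' * x)) \<in> P"
          using False by (intro P_mult P_power_pos t b' cycint_mult) auto
        moreover have "t ^ j * (b * (b' * x)) = b' * (b * x * t ^ j)" by (simp only: mult_ac)
        ultimately have "b' * c \<in> P" using h by simp
        thus False using notin_P_mult b' t by blast
      qed
      moreover have "r < 0" using r False t(2) by simp
      ultimately show ?thesis by auto
    qed
  qed
qed

lemma has_value_pos_iff:
  assumes "x \<in> cycint" "has_value x r"
  shows "r > 0 \<longleftrightarrow> x \<in> P"
proof -
  obtain t b c and e j :: nat where t: "t \<in> P" "e > 0" "b \<in> cycint" "b \<notin> P" "c \<in> cycint" "c \<notin> P"
    "(b * x = t ^ j * c \<and> has_value x (real j / real e)) \<or>
     (b * x * t ^ j = c \<and> has_value x (- (real j / real e)))"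
    using normal_form[OF cycint_Qcyc[OF assms(1)] has_value_nonzero[OF assms(2)]] by metis
  have bx: "b * x \<in> P \<longleftrightarrow> x \<in> P" using P_prime[OF t(3) assms(1)] t(4) P_mult_left[OF _ t(3)] by blast
  from t(7) show ?thesis
  proof
    assume h: "b * x = t ^ j * c \<and> has_value x (real j / real e)"
    hence r: "r = real j / real e" using has_value_unique assms(2) by blast
    show ?thesis
    proof (cases "j = 0")
      case True
      thus ?thesis using h bx t(6) r by simp
    next
      case False
      hence "b * x \<in> P" using h P_mult[OF P_power_pos[OF t(1)] t(5)] by simp
      thus ?thesis using bx r False t(2) by simp
    qed
  next
    assume h: "b * x * t ^ j = c \<and> has_value x (- (real j / real e))"
    hence r: "r = - (real j / real e)" using has_value_unique assms(2) by blast
    have "x \<notin> P"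
    proof
      assume "x \<in> P"
      hence "x * (b * t ^ j) \<in> P" by (intro P_mult cycint_mult cycint_power t P_cycint)
      thus False using h t(6) by (simp add: mult_ac)
    qed
    moreover have "real j / real e \<ge> 0" by simp
    hence "\<not> r > 0" using r by linarith
    ultimately show ?thesis by simp
  qed
qed

lemma has_value_of_int:
  assumes "a \<noteq> 0"
  shows "has_value (of_int a) (real (multiplicity (int p) a))"
proof -
  obtain a' where a: "a = int p ^ multiplicity (int p) a * a'" "\<not> int p dvd a'"
    using multiplicity_decompose'[of a "int p"] assms prime_p
    by (metis not_prime_unit prime_nat_int_transfer)
  show ?thesis
  proof (rule has_valueI[of 1 1 "of_int a'" _ 0 "multiplicity (int p) a"])
    have "(of_int a :: 'c) = of_nat p ^ multiplicity (int p) a * of_int a'"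
      by (subst a(1)) simp
    thus "1 * of_int a ^ 1 * of_nat p ^ 0 = of_int a' * (of_nat p :: 'c) ^ multiplicity (int p) a"
      by simp
  qed (use a P_of_int P_1 in auto)
qed

definition valuation :: "'c \<Rightarrow> ereal" where
  "valuation = (\<lambda>x\<in>carrier Qcyc. if x = 0 then \<infinity> else ereal (THE r. has_value x r))"

lemma valuation_eq: "x \<in> carrier Qcyc \<Longrightarrow> has_value x r \<Longrightarrow> valuation x = ereal r"
  using has_value_unique has_value_nonzero by (auto simp: valuation_def intro!: the_equality)

lemma Qcyc_0: "(0::'c) \<in> carrier Qcyc"
  by (rule cycint_Qcyc) simp

lemma valuation_0: "valuation 0 = \<infinity>"
  using Qcyc_0 by (simp add: valuation_def)

lemma valuation_in_Val: "valuation \<in> Val p"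
  unfolding Val_def
proof (intro CollectI conjI ballI allI)
  show "valuation \<in> extensional (carrier Qcyc)" by (simp add: valuation_def)
  fix x :: 'c assume x: "x \<in> carrier Qcyc"
  have vx: "\<exists>r. has_value x r \<and> valuation x = ereal r" if "x \<noteq> 0"
    using has_value_exists[OF x that] valuation_eq[OF x] by metis
  show "valuation x \<noteq> -\<infinity>" "valuation x = \<infinity> \<longleftrightarrow> x = 0"
    using vx valuation_0 by (cases "x = 0"; force)+
  fix y :: 'c assume y: "y \<in> carrier Qcyc"
  have vy: "\<exists>r. has_value y r \<and> valuation y = ereal r" if "y \<noteq> 0"
    using has_value_exists[OF y that] valuation_eq[OF y] by metis
  show "valuation (x * y) = valuation x + valuation y"
  proof (cases "x = 0 \<or> y = 0")
    case True
    thus ?thesis using vx vy valuation_0 by (cases "x = 0"; cases "y = 0") auto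
  next
    case False
    then obtain r r' where "has_value x r" "valuation x = ereal r" "has_value y r'"
      "valuation y = ereal r'" using vx vy by blast
    thus ?thesis using valuation_eq[OF Qcyc_closed(2)[OF x y] has_value_mult] by simp
  qed
  have *: "valuation x \<le> valuation (x + y)"
    if x: "x \<in> carrier Qcyc" and y: "y \<in> carrier Qcyc" and nz: "x \<noteq> 0" "y \<noteq> 0"
      and le: "valuation x \<le> valuation y" for x y
  proof (cases "x + y = 0")
    case True
    thus ?thesis using valuation_0 by simp
  next
    case False
    obtain r where r: "has_value x r" using has_value_exists[OF x nz(1)] .
    obtain r' where r': "has_value y r'" using has_value_exists[OF y nz(2)] .
    have rr: "r \<le> r'" using le valuation_eq[OF x r] valuation_eq[OF y r'] by simp
    \<comment> \<open>With x of smaller value, z has value at least 0, so some b outside P makes b z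
      lie in A. The same b works for 1 + z, hence 1 + z also has value at least 0, and x + y = x (1
      + z).\<close>
    define z where "z = y * inverse x"
    have z: "z \<in> carrier Qcyc" unfolding z_def by (rule Qcyc_closed(2)[OF y Qcyc_unary(2)[OF x]])
    have hz: "has_value z (r' + - r)" unfolding z_def by (intro has_value_mult has_value_inverse r r')
    then obtain b where b: "b \<in> cycint" "b \<notin> P" "b * z \<in> cycint"
      using has_value_nonneg_iff[OF z hz] rr by auto
    have z1: "1 + z \<in> carrier Qcyc" using z cycint_Qcyc[OF cycint_1] by (rule Qcyc_closed(1)[rotated])
    have e: "x + y = x * (1 + z)" unfolding z_def using nz by (simp add: field_simps)
    hence "1 + z \<noteq> 0" using False by auto
    then obtain s where s: "has_value (1 + z) s" using has_value_exists[OF z1] by blast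
    have "b * (1 + z) \<in> cycint" using cycint_add[OF b(1) b(3)] by (simp add: distrib_left)
    hence "s \<ge> 0" using has_value_nonneg_iff[OF z1 s] b by blast
    moreover have "valuation (x + y) = ereal (r + s)"
      unfolding e by (rule valuation_eq[OF Qcyc_closed(2)[OF x z1] has_value_mult[OF r s]])
    ultimately show ?thesis using valuation_eq[OF x r] by simp
  qed
  show "min (valuation x) (valuation y) \<le> valuation (x + y)"
  proof (cases "x = 0 \<or> y = 0")
    case True
    thus ?thesis by auto
  next
    case False
    thus ?thesis using *[OF x y] *[OF y x] by (cases "valuation x \<le> valuation y") (auto simp: add.commute)
  qed
next
  fix r :: rat
  show "valuation (of_rat r) = padic_valuation p r"
  proof (cases "r = 0")
    case True
    thus ?thesis using valuation_0 by (simp add: padic_valuation_def)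
  next
    case False
    obtain a b where ab: "quotient_of r = (a, b)" by (cases "quotient_of r")
    have b: "b > 0" by (rule quotient_of_denom_pos[OF ab])
    have r: "r = of_int a / of_int b" by (rule quotient_of_div[OF ab])
    have a: "a \<noteq> 0" using r False by auto
    have ofr: "(of_rat r :: 'c) = of_int a * inverse (of_int b)"
      unfolding r by (simp add: of_rat_divide) (simp add: divide_inverse)
    have "of_rat r \<in> carrier (Qcyc :: 'c ring)"
      unfolding ofr by (intro Qcyc_closed(2) Qcyc_unary(2) cycint_Qcyc cycint_of_int)
    moreover have "has_value (of_rat r) (real (multiplicity (int p) a) + - real (multiplicity (int p) b))"
      unfolding ofr using a b by (intro has_value_mult has_value_inverse has_value_of_int) auto
    ultimately show ?thesis
      using valuation_eq False by (simp add: padic_valuation_def ab)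
  qed
qed

lemma valuation_pos_iff:
  assumes "a \<in> cycint"
  shows "valuation a > 0 \<longleftrightarrow> a \<in> P"
proof (cases "a = 0")
  case True
  thus ?thesis using valuation_0 by simp
next
  case False
  obtain r where r: "has_value a r" using has_value_exists[OF cycint_Qcyc[OF assms] False] .
  thus ?thesis using valuation_eq[OF cycint_Qcyc[OF assms] r] has_value_pos_iff[OF assms r] by simp
qed

end

section \<open>Extensions of the \<open>p\<close>-adic valuation\<close>

locale padic_extension =
  fixes p :: nat and v :: "'c::{alg_closed_field,field_char_0} \<Rightarrow> ereal"
  assumes prime_p: "prime p" and v_Val: "v \<in> Val p"
begin

lemma v_ext: "v \<in> extensional (carrier Qcyc)"
  and v_MInf: "x \<in> carrier Qcyc \<Longrightarrow> v x \<noteq> -\<infinity>"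
  and v_Inf: "x \<in> carrier Qcyc \<Longrightarrow> v x = \<infinity> \<longleftrightarrow> x = 0"
  and v_mult: "\<lbrakk>x \<in> carrier Qcyc; y \<in> carrier Qcyc\<rbrakk> \<Longrightarrow> v (x * y) = v x + v y"
  and v_add: "\<lbrakk>x \<in> carrier Qcyc; y \<in> carrier Qcyc\<rbrakk> \<Longrightarrow> v (x + y) \<ge> min (v x) (v y)"
  and v_rat: "v (of_rat r) = padic_valuation p r"
  using v_Val unfolding Val_def by auto

lemma v_of_int: "v (of_int a) = (if a = 0 then \<infinity> else ereal (real (multiplicity (int p) a)))"
  using v_rat[of "of_int a"] by (simp add: padic_valuation_def)

lemma v_of_int_nonneg: "v (of_int a) \<ge> 0"
  by (simp add: v_of_int)

lemma v_1: "v 1 = 0"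
  using v_of_int[of 1] by simp

lemma v_0: "v 0 = \<infinity>"
  using v_of_int[of 0] by simp

lemma v_p: "v (of_nat p) = 1"
  using v_of_int[of "int p"] prime_p prime_gt_0_nat[OF prime_p] by (simp add: one_ereal_def)

lemma v_real:
  assumes "x \<in> carrier Qcyc" "x \<noteq> 0"
  obtains r where "v x = ereal r"
  using v_MInf[OF assms(1)] v_Inf[OF assms(1)] assms(2) by (cases "v x") auto

lemma Qcyc_power: "x \<in> carrier Qcyc \<Longrightarrow> x ^ n \<in> carrier (Qcyc :: 'c ring)"
  by (induction n) (auto intro: Qcyc_closed(2) cycint_Qcyc)

lemma v_power:
  assumes x: "x \<in> carrier Qcyc" and r: "v x = ereal r"
  shows "v (x ^ n) = ereal (real n * r)"
proof (induction n)
  case 0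
  then show ?case using v_1 by simp
next
  case (Suc n)
  then show ?case using v_mult[OF x Qcyc_power[OF x, of n]] r by (simp add: algebra_simps)
qed

lemma v_root:
  assumes "z ^ n = 1" "n > 0"
  shows "v z = 0"
proof -
  have z: "z \<in> carrier Qcyc" by (rule cycint_Qcyc[OF cycint_root[OF assms]])
  have "z \<noteq> 0" using assms by (auto simp: power_0_left)
  then obtain r where r: "v z = ereal r" using v_real[OF z] by blast
  have "ereal (real n * r) = 0" using v_power[OF z r, of n] assms(1) v_1 by simp
  hence "r = 0" using assms(2) by simp
  thus ?thesis using r by simp
qed

lemma v_cycint_nonneg:
  assumes "a \<in> cycint"
  shows "v a \<ge> 0"
proof -
  obtain f z n where a: "a = ipoly f z" "n > 0" "z ^ n = 1" using assms by (auto simp: cycint_def)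
  have z: "z \<in> cycint" by (rule cycint_root[OF a(3,2)])
  have "v (ipoly f z) \<ge> 0"
  proof (induction f)
    case 0
    then show ?case using v_0 by simp
  next
    case (pCons b f)
    have "v (z * ipoly f z) = v z + v (ipoly f z)"
      by (intro v_mult cycint_Qcyc cycint_ipoly z)
    hence "v (z * ipoly f z) \<ge> 0" using pCons v_root[OF a(3,2)] by simp
    moreover have "v (of_int b + z * ipoly f z) \<ge> min (v (of_int b)) (v (z * ipoly f z))"
      by (intro v_add cycint_Qcyc cycint_mult cycint_ipoly z) simp
    ultimately show ?case using v_of_int_nonneg[of b] by (simp add: min_def split: if_splits)
  qed
  thus ?thesis by (simp add: a(1))
qed

definition centre :: "'c set" where
  "centre = {a \<in> cycint. v a > 0}"

sublocale centre: prime_over p centre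
proof
  show "prime p" by (rule prime_p)
  show "centre \<subseteq> cycint" by (auto simp: centre_def)
  show "of_nat p \<in> centre" using v_p by (simp add: centre_def)
  show "1 \<notin> centre" using v_1 by (simp add: centre_def)
next
  fix a b :: 'c assume "a \<in> centre" "b \<in> centre"
  hence ab: "a \<in> cycint" "b \<in> cycint" "v a > 0" "v b > 0" by (auto simp: centre_def)
  have "v (a + b) \<ge> min (v a) (v b)" by (intro v_add cycint_Qcyc ab)
  thus "a + b \<in> centre" using ab by (auto simp: centre_def cycint_add min_def split: if_splits)
next
  fix a b :: 'c assume "a \<in> centre" and b: "b \<in> cycint"
  hence a: "a \<in> cycint" "v a > 0" by (auto simp: centre_def)
  have "v (a * b) = v a + v b" by (intro v_mult cycint_Qcyc a b)
  thus "a * b \<in> centre" using a b v_cycint_nonneg[OF b]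
    by (auto simp: centre_def cycint_mult intro: add_pos_nonneg)
next
  fix a b :: 'c assume ab: "a \<in> cycint" "b \<in> cycint" "a * b \<in> centre"
  have "v (a * b) = v a + v b" by (intro v_mult cycint_Qcyc ab)
  hence "v a > 0 \<or> v b > 0" using ab v_cycint_nonneg[OF ab(1)] v_cycint_nonneg[OF ab(2)]
    by (auto simp: centre_def not_less)
  thus "a \<in> centre \<or> b \<in> centre" using ab by (auto simp: centre_def)
qed

text \<open>Elements of A outside the centre have value 0 and p has value 1, so the relation behind
  \<open>has_value\<close> forces the value of x. An extension of the p-adic valuation is thus
  determined by its centre.\<close>

lemma v_has_value:
  assumes x: "x \<in> carrier Qcyc" and r: "centre.has_value x r"
  shows "v x = ereal r"
proof -
  obtain m i j b c where h: "m > 0" "b \<in> cycint" "b \<notin> centre" "c \<in> cycint" "c \<notin> centre"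
    "b * x ^ m * of_nat p ^ i = c * of_nat p ^ j" "r = (real j - real i) / real m"
    using r unfolding centre.has_value_def by blast
  have 0: "v b = 0" "v c = 0" using h v_cycint_nonneg[of b] v_cycint_nonneg[of c]
    by (auto simp: centre_def not_less intro: antisym)
  obtain y where y: "v x = ereal y" using v_real[OF x centre.has_value_nonzero[OF r]] .
  have p1: "v (of_nat p) = ereal 1" using v_p by (simp add: one_ereal_def)
  have pQ: "(of_nat p :: 'c) \<in> carrier Qcyc" by (rule cycint_Qcyc) simp
  have bQ: "b \<in> carrier Qcyc" "c \<in> carrier Qcyc" using h by (auto intro: cycint_Qcyc)
  have "v (b * x ^ m * of_nat p ^ i) = ereal (real m * y + real i)"
    using v_mult[OF Qcyc_closed(2)[OF bQ(1) Qcyc_power[OF x, of m]] Qcyc_power[OF pQ, of i]]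
      v_mult[OF bQ(1) Qcyc_power[OF x, of m]] v_power[OF x y, of m] v_power[OF pQ p1, of i] 0 by simp
  moreover have "v (c * of_nat p ^ j) = ereal (real j)"
    using v_mult[OF bQ(2) Qcyc_power[OF pQ, of j]] v_power[OF pQ p1, of j] 0 by simp
  ultimately have "real m * y + real i = real j" using h(6) by simp
  hence "y = r" unfolding h(7) using h(1) by (simp add: field_simps)
  thus ?thesis using y by simp
qed

lemma v_eq_valuation: "v = centre.valuation"
proof
  fix x show "v x = centre.valuation x"
  proof (cases "x \<in> carrier Qcyc")
    case x: True
    show ?thesis
    proof (cases "x = 0")
      case True
      thus ?thesis using v_0 centre.valuation_0 by simp
    next
      case False
      obtain r where r: "centre.has_value x r" using centre.has_value_exists[OF x False] .
      show ?thesis using v_has_value[OF x r] centre.valuation_eq[OF x r] by simp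
    qed
  next
    case False
    thus ?thesis using v_ext by (simp add: centre.valuation_def extensional_def)
  qed
qed

section \<open>The residue field on the roots of unity of order prime to p\<close>

lemma Mp_Q_mu: "x \<in> Mp p \<Longrightarrow> x \<in> (Q_mu p :: 'c set)"
  using generated_field_of_int[of 0 "mu p"]
  by (auto simp: Q_mu_def Mp_def intro: generate_field.incl)

lemma Q_mu_Qcyc: "Q_mu p \<subseteq> carrier (Qcyc :: 'c ring)"
  unfolding Q_mu_def carrier_Qcyc
  by (rule field.mono_generate_field[OF field_from_type_algebra])
    (auto simp: mu_def type_algebra_simps)

lemmas Q_mu_unary = generated_field_unary[where H = "mu p", folded Q_mu_def]
lemmas Q_mu_closed = generated_field_closed[where H = "mu p", folded Q_mu_def]

lemma val_ideal_closed:
  assumes "x \<in> val_ideal p v" "y \<in> val_ideal p v"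
  shows "x + y \<in> val_ideal p v" "- x \<in> val_ideal p v"
proof -
  have xy: "x \<in> Q_mu p" "y \<in> Q_mu p" "v x > 0" "v y > 0" using assms by (auto simp: val_ideal_def)
  have c: "x \<in> carrier Qcyc" "y \<in> carrier Qcyc" using xy Q_mu_Qcyc by auto
  have "v (x + y) \<ge> min (v x) (v y)" by (rule v_add[OF c])
  thus "x + y \<in> val_ideal p v"
    using xy by (auto simp: val_ideal_def Q_mu_closed(1) min_def split: if_splits)
  have "v (of_int (-1) * x) = v (of_int (- 1)) + v x"
    by (intro v_mult c cycint_Qcyc cycint_of_int)
  moreover have "v (of_int (- 1)) = 0" by (rule v_root[of _ 2]) auto
  ultimately show "- x \<in> val_ideal p v" using xy by (simp add: val_ideal_def Q_mu_unary(1))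
qed

lemma coset: "val_ideal p v +>\<^bsub>val_ring p v\<^esub> x = {i + x | i. i \<in> val_ideal p v}"
  by (auto simp: a_r_coset_def' val_ring_def Qcyc_ops)

lemma coset_eq_iff:
  "val_ideal p v +>\<^bsub>val_ring p v\<^esub> x = val_ideal p v +>\<^bsub>val_ring p v\<^esub> y \<longleftrightarrow> x - y \<in> val_ideal p v"
proof -
  have "0 \<in> Q_mu p" using generated_field_of_int[of 0 "mu p"] by (simp add: Q_mu_def)
  hence z: "0 \<in> val_ideal p v" using v_0 by (simp add: val_ideal_def)
  show ?thesis unfolding coset
  proof
    assume eq: "{i + x | i. i \<in> val_ideal p v} = {i + y | i. i \<in> val_ideal p v}"
    have "x \<in> {i + x | i. i \<in> val_ideal p v}" using z by (intro CollectI exI[of _ 0]) simp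
    then obtain i where "i \<in> val_ideal p v" "x = i + y" unfolding eq by blast
    thus "x - y \<in> val_ideal p v" by simp
  next
    assume d: "x - y \<in> val_ideal p v"
    have "\<exists>i'. i + x = i' + y \<and> i' \<in> val_ideal p v" if "i \<in> val_ideal p v" for i
      using val_ideal_closed(1)[OF that d] by (intro exI[of _ "i + (x - y)"]) simp
    moreover have "\<exists>i'. i + y = i' + x \<and> i' \<in> val_ideal p v" if "i \<in> val_ideal p v" for i
      using val_ideal_closed(1)[OF that val_ideal_closed(2)[OF d d]]
      by (intro exI[of _ "i + - (x - y)"]) simp
    ultimately show "{i + x | i. i \<in> val_ideal p v} = {i + y | i. i \<in> val_ideal p v}" by blast
  qed
qed

lemma coset_add:
  "(val_ideal p v +>\<^bsub>val_ring p v\<^esub> x) \<oplus>\<^bsub>residue_field p v\<^esub> (val_ideal p v +>\<^bsub>val_ring p v\<^esub> y)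
    = val_ideal p v +>\<^bsub>val_ring p v\<^esub> (x + y)"
proof -
  have "0 \<in> Q_mu p" using generated_field_of_int[of 0 "mu p"] by (simp add: Q_mu_def)
  hence z: "0 \<in> val_ideal p v" using v_0 by (simp add: val_ideal_def)
  have "(val_ideal p v +>\<^bsub>val_ring p v\<^esub> x) \<oplus>\<^bsub>residue_field p v\<^esub> (val_ideal p v +>\<^bsub>val_ring p v\<^esub> y)
    = {a + b | a b. a \<in> val_ideal p v +>\<^bsub>val_ring p v\<^esub> x \<and> b \<in> val_ideal p v +>\<^bsub>val_ring p v\<^esub> y}"
    by (auto simp: residue_field_def FactRing_def set_add_def' val_ring_def Qcyc_ops)
  also have "\<dots> = {i + (x + y) | i. i \<in> val_ideal p v}"
    unfolding coset
  proof (intro equalityI subsetI)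
    fix u assume "u \<in> {a + b | a b. a \<in> {i + x | i. i \<in> val_ideal p v} \<and> b \<in> {i + y | i. i \<in> val_ideal p v}}"
    then obtain i j where ij: "i \<in> val_ideal p v" "j \<in> val_ideal p v" "u = (i + x) + (j + y)" by blast
    thus "u \<in> {i + (x + y) | i. i \<in> val_ideal p v}"
      by (intro CollectI exI[of _ "i + j"]) (simp add: val_ideal_closed algebra_simps)
  next
    fix u assume "u \<in> {i + (x + y) | i. i \<in> val_ideal p v}"
    then obtain i where "i \<in> val_ideal p v" "u = i + (x + y)" by blast
    moreover from this have "u = (i + x) + (0 + y)" by simp
    ultimately show "u \<in> {a + b | a b. a \<in> {i + x | i. i \<in> val_ideal p v} \<and> b \<in> {i + y | i. i \<in> val_ideal p v}}"
      using z by blast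
  qed
  finally show ?thesis unfolding coset .
qed

lemma val_ideal_centre: "a \<in> cycint \<Longrightarrow> a \<in> Q_mu p \<Longrightarrow> a \<in> val_ideal p v \<longleftrightarrow> a \<in> centre"
  by (simp add: val_ideal_def centre_def)

lemma residue_map_inj: "inj_on (residue_map p v) (Mp p)"
proof (rule inj_onI)
  fix x y assume xy: "x \<in> Mp p" "y \<in> Mp p" "residue_map p v x = residue_map p v y"
  hence "x - y \<in> val_ideal p v" by (simp add: residue_map_def coset_eq_iff)
  hence "centre.cg x y"
    using xy val_ideal_centre[of "x - y"]
    by (simp add: centre.cg_def Mp_cycint cycint_diff Q_mu_closed(3) Mp_Q_mu)
  thus "x = y" by (rule centre.cg_Mp_eq[OF xy(1,2)])
qed

text \<open>Cosets are formed in the valuation ring of \<open>Q_mu p\<close>, congruences in A. They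
  are compared on the difference of x + 1 and its representative, which lies in both rings and where
  positive value means membership in the centre.\<close>

lemma s_of_val_eq_successor: "s_of_val p v = centre.successor"
proof
  fix x show "s_of_val p v x = centre.successor x"
  proof (cases "x \<in> Mp p")
    case x: True
    let ?y = "centre.successor x"
    have y: "?y \<in> Mp p" "centre.cg ?y (x + 1)" using centre.successor[OF x] by auto
    have c: "x + 1 - ?y \<in> cycint" "x + 1 - ?y \<in> Q_mu p"
      using Mp_cycint[OF x] Mp_cycint[OF y(1)] Mp_Q_mu[OF x] Mp_Q_mu[OF y(1)] Mp_Q_mu[OF Mp_1]
      by (simp_all add: cycint_diff cycint_add Q_mu_closed)
    have "x + 1 - ?y \<in> centre" using centre.cg_sym[OF y(2)] by (simp add: centre.cg_def)
    hence "val_ideal p v +>\<^bsub>val_ring p v\<^esub> (x + 1) = val_ideal p v +>\<^bsub>val_ring p v\<^esub> ?y"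
      using val_ideal_centre[OF c] by (simp add: coset_eq_iff)
    moreover have "\<one>\<^bsub>residue_field p v\<^esub> = val_ideal p v +>\<^bsub>val_ring p v\<^esub> 1"
      by (simp add: residue_field_def FactRing_def val_ring_def Qcyc_ops)
    ultimately have "residue_map p v x \<oplus>\<^bsub>residue_field p v\<^esub> \<one>\<^bsub>residue_field p v\<^esub> = residue_map p v ?y"
      using x y by (simp add: residue_map_def coset_add)
    thus ?thesis using x the_inv_into_f_f[OF residue_map_inj y(1)] by (simp add: s_of_val_def)
  next
    case False
    thus ?thesis by (simp add: s_of_val_def centre.successor_def)
  qed
qed

end

text \<open>Injective because the successor map determines the centre and the centre the valuation.
  Surjective because s comes from the valuation of the prime ideal \<open>s.ker\<close>, whose
  centre is this ideal again.\<close>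

theorem bij_betw_s_of_val:
  assumes p: "prime p"
  shows "bij_betw (s_of_val p) (Val p :: ('c::{alg_closed_field,field_char_0} \<Rightarrow> ereal) set) (Sigma_set p)"
  unfolding bij_betw_def
proof (intro conjI inj_onI equalityI subsetI)
  fix v w :: "'c \<Rightarrow> ereal"
  assume vw: "v \<in> Val p" "w \<in> Val p" "s_of_val p v = s_of_val p w"
  interpret v: padic_extension p v by unfold_locales fact+
  interpret w: padic_extension p w by unfold_locales fact+
  have "v.centre.successor = w.centre.successor"
    using vw(3) v.s_of_val_eq_successor w.s_of_val_eq_successor by simp
  hence "v.centre = w.centre" using v.centre.P_eq_ker w.centre.P_eq_ker by simp
  thus "v = w" using v.v_eq_valuation w.v_eq_valuation by simp
next
  fix s :: "'c \<Rightarrow> 'c" assume "s \<in> s_of_val p ` Val p"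
  then obtain v :: "'c \<Rightarrow> ereal" where v: "v \<in> Val p" "s = s_of_val p v" by blast
  interpret v: padic_extension p v by unfold_locales fact+
  show "s \<in> Sigma_set p" using v(2) v.s_of_val_eq_successor v.centre.successor_in_Sigma by simp
next
  fix s :: "'c \<Rightarrow> 'c" assume s: "s \<in> Sigma_set p"
  interpret s: successor_map p s by unfold_locales fact+
  have V: "s.ker.valuation \<in> Val p" by (rule s.ker.valuation_in_Val)
  interpret v: padic_extension p s.ker.valuation by unfold_locales (fact p, rule V)
  have "v.centre = s.ker"
    using s.ker.valuation_pos_iff s.ker.P_sub by (auto simp: v.centre_def)
  hence "s_of_val p s.ker.valuation = s"
    using v.s_of_val_eq_successor s.ker_successor by simp
  thus "s \<in> s_of_val p ` Val p" using V by (metis imageI)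
qed

section \<open>Towers of generators\<close>

text \<open>The order of the unit group of a field with p^(k!) elements. The factorial makes the
  levels divide one another, and by Euler's theorem every n prime to p divides some level. A
  sequence thus exhausts all orders prime to p.\<close>

definition level :: "nat \<Rightarrow> nat \<Rightarrow> nat" where
  "level p k = p ^ fact k - 1"

lemma level_pos: "p > 1 \<Longrightarrow> level p k > 0"
  using one_less_power[of p "fact k"] by (simp add: level_def)

lemma power_minus_one_dvd: "(a::nat) - 1 dvd a ^ n - 1"
proof (cases "a = 0")
  case False
  hence "[a = 1] (mod (a - 1))" by (simp add: cong_altdef_nat)
  hence "[a ^ n = 1 ^ n] (mod (a - 1))" by (rule cong_pow)
  thus ?thesis using False by (simp add: cong_altdef_nat)
qed (cases n; simp)

lemma level_dvd:
  assumes "k \<le> l"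
  shows "level p k dvd level p l"
proof -
  have "fact k dvd (fact l :: nat)" using assms by (rule fact_dvd)
  then obtain d where "(fact l :: nat) = fact k * d" by (elim dvdE)
  thus ?thesis unfolding level_def using power_minus_one_dvd[of "p ^ fact k" d]
    by (simp flip: power_mult)
qed

lemma level_coprime: "p > 1 \<Longrightarrow> coprime (level p k) p"
proof -
  assume p: "p > 1"
  have "coprime (p ^ fact k - 1) (p ^ fact k)"
    by (rule coprime_diff_one_left_nat) (use p in simp)
  moreover have "p dvd p ^ fact k" by (simp add: dvd_power)
  ultimately show ?thesis unfolding level_def by (rule coprime_divisors[OF dvd_refl, rotated])
qed

lemma dvd_level:
  assumes "coprime n p" "n > 0" "p > 0"
  obtains k where "n dvd level p k"
proof -
  have "[p ^ totient n = 1] (mod n)" using assms by (intro euler_theorem) (simp add: coprime_commute)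
  hence "n dvd p ^ totient n - 1" using assms(3) by (simp add: cong_altdef_nat)
  moreover have "totient n dvd fact (totient n)" using assms(2) totient_gt_0_iff[of n]
    by (intro dvd_fact) linarith+
  then obtain d where "(fact (totient n) :: nat) = totient n * d" by (elim dvdE)
  hence "p ^ totient n - 1 dvd level p (totient n)"
    unfolding level_def using power_minus_one_dvd[of "p ^ totient n" d] by (simp flip: power_mult)
  ultimately show ?thesis using that dvd_trans by blast
qed

definition (in monoid) has_order :: "'a \<Rightarrow> nat \<Rightarrow> bool" where
  "has_order x n \<longleftrightarrow> x \<in> carrier G \<and> (\<forall>i::nat. x [^] i = \<one> \<longleftrightarrow> n dvd i)"

context group
begin

lemma has_order_pow_eq:
  assumes x: "has_order x n"
  shows "x [^] (i::nat) = x [^] (j::nat) \<longleftrightarrow> [i = j] (mod n)"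
proof -
  have xc: "x \<in> carrier G" using x by (simp add: has_order_def)
  have *: "x [^] i = x [^] j \<longleftrightarrow> [j = i] (mod n)" if "i \<le> j" for i j :: nat
  proof -
    have "x [^] j = x [^] i \<otimes> x [^] (j - i)" using that xc by (simp add: nat_pow_mult)
    hence "x [^] i = x [^] j \<longleftrightarrow> x [^] i \<otimes> \<one> = x [^] i \<otimes> x [^] (j - i)" using xc by simp
    also have "\<dots> \<longleftrightarrow> x [^] (j - i) = \<one>" using xc by (subst l_cancel) auto
    also have "\<dots> \<longleftrightarrow> [j = i] (mod n)" using x that by (simp add: has_order_def cong_altdef_nat)
    finally show ?thesis .
  qed
  show ?thesis using *[of i j] *[of j i] by (cases "i \<le> j") (auto simp: cong_sym_eq)
qed

lemma has_order_power:
  assumes "has_order x (d * n)" "d > 0"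
  shows "has_order (x [^] d) n"
  using assms by (simp add: has_order_def nat_pow_pow)

lemma has_order_coprime_power:
  assumes "has_order x n" "coprime j n"
  shows "has_order (x [^] j) n"
  using assms by (simp add: has_order_def nat_pow_pow coprime_dvd_mult_right_iff coprime_commute)

text \<open>Compatible generators of the cyclic subgroups of order \<open>level p k\<close>. When
  these subgroups exhaust the group, the tower is a coordinate system on it.\<close>

definition tower :: "nat \<Rightarrow> (nat \<Rightarrow> 'a) \<Rightarrow> bool" where
  "tower p c \<longleftrightarrow> (\<forall>k. has_order (c k) (level p k) \<and>
     c (Suc k) [^] (level p (Suc k) div level p k) = c k)"

lemma tower_mem: "tower p c \<Longrightarrow> c k \<in> carrier G"
  by (simp add: tower_def has_order_def)

lemma tower_descend:
  assumes c: "tower p c" and p: "p > 1" and kl: "k \<le> l"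
  shows "c l [^] (level p l div level p k) = c k"
  using kl
proof (induction l rule: dec_induct)
  case base
  then show ?case using tower_mem[OF c] level_pos[OF p, of k] by simp
next
  case (step l)
  let ?a = "level p (Suc l) div level p l" and ?b = "level p l div level p k"
  have "level p (Suc l) div level p k = ?a * ?b"
    using level_dvd[of k l p] level_dvd[of l "Suc l" p] step(1) level_pos[OF p, of l]
    by (simp add: div_mult_div_if_dvd mult.commute)
  hence "c (Suc l) [^] (level p (Suc l) div level p k) = (c (Suc l) [^] ?a) [^] ?b"
    using tower_mem[OF c] by (simp add: nat_pow_pow)
  also have "c (Suc l) [^] ?a = c l" using c by (simp add: tower_def)
  finally show ?case using step.IH by simp
qed

end

context comm_group
begin

text \<open>Units modulo the lower level lift to units modulo the upper one. For any d of the upper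
  order, d^r generates the same subgroup as c, so c = (d^r)^j with j prime to the lower level;
  lifting j to m prime to the upper level gives d^m as the next generator.\<close>

lemma tower_step:
  assumes p: "p > 1" and c: "has_order c (level p k)"
    and gen: "\<And>x y n. \<lbrakk>n > 0; coprime n p; has_order y n; x \<in> carrier G; x [^] (n::nat) = \<one>\<rbrakk>
      \<Longrightarrow> \<exists>i::nat. x = y [^] i"
    and ex: "\<And>n. n > 0 \<Longrightarrow> coprime n p \<Longrightarrow> \<exists>x. has_order x n"
  shows "\<exists>d. has_order d (level p (Suc k)) \<and> d [^] (level p (Suc k) div level p k) = c"
proof -
  let ?n = "level p k" and ?N = "level p (Suc k)"
  have n: "?n > 0" and N: "?N > 0" using level_pos[OF p] by auto
  define r where "r = ?N div ?n"
  have rn: "?N = r * ?n" using level_dvd[of k "Suc k" p] by (simp add: r_def)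
  hence r0: "r > 0" using N by (cases r) auto
  obtain d where d: "has_order d ?N" using ex[OF N level_coprime[OF p]] by blast
  have dr: "has_order (d [^] r) ?n" using d r0 unfolding rn by (rule has_order_power)
  have cc: "c \<in> carrier G" and dc: "d \<in> carrier G" using c d by (simp_all add: has_order_def)
  have "c [^] ?n = \<one>" using c by (simp add: has_order_def)
  then obtain j :: nat where j: "c = (d [^] r) [^] j" using gen[OF n level_coprime[OF p] dr cc] by blast
  \<comment> \<open>A common prime factor l of j and the level would make c die already at the
    exponent level / l, although its order is the full level.\<close>
  have "coprime j ?n"
  proof (rule ccontr)
    assume "\<not> coprime j ?n"
    hence "gcd j ?n \<noteq> 1" unfolding coprime_iff_gcd_eq_1 .
    then obtain l where "prime l" "l dvd gcd j ?n" using prime_factor_nat by blast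
    then obtain a b where l: "prime l" "j = l * a" "?n = l * b" by (auto elim!: dvdE)
    have "?n dvd j * b" unfolding l(2) by (subst l(3)) simp
    hence "c [^] b = \<one>" unfolding j using dr by (simp add: has_order_def nat_pow_pow)
    hence "?n dvd b" using c by (simp add: has_order_def)
    moreover have "b > 0" using n l(3) by (cases b) auto
    ultimately have "?n \<le> b" by (rule dvd_imp_le)
    thus False using prime_gt_1_nat[OF l(1)] \<open>b > 0\<close> l(3) by (metis One_nat_def less_le_not_le n_less_m_mult_n)
  qed
  then obtain m where m: "m > 0" "[m = j] (mod ?n)" "\<And>q. prime q \<Longrightarrow> q \<le> ?N \<Longrightarrow> \<not> q dvd m"
    using coprime_lift[OF _ n] by metis
  have "coprime m ?N"
  proof (rule ccontr)
    assume "\<not> coprime m ?N"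
    hence "gcd m ?N \<noteq> 1" unfolding coprime_iff_gcd_eq_1 .
    then obtain l where "prime l" "l dvd gcd m ?N" using prime_factor_nat by blast
    hence l: "prime l" "l dvd m" "l dvd ?N" by auto
    thus False using m(3)[OF l(1) dvd_imp_le[OF l(3) N]] by blast
  qed
  hence "has_order (d [^] m) ?N" by (rule has_order_coprime_power[OF d])
  moreover have "(d [^] m) [^] r = (d [^] r) [^] m" using dc by (simp add: nat_pow_pow mult.commute)
  hence "(d [^] m) [^] r = c" unfolding j using has_order_pow_eq[OF dr, of m j] m(2) by simp
  ultimately show ?thesis unfolding r_def by blast
qed

lemma tower_exists:
  assumes p: "p > 1"
    and gen: "\<And>x y n. \<lbrakk>n > 0; coprime n p; has_order y n; x \<in> carrier G; x [^] (n::nat) = \<one>\<rbrakk>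
      \<Longrightarrow> \<exists>i::nat. x = y [^] i"
    and ex: "\<And>n. n > 0 \<Longrightarrow> coprime n p \<Longrightarrow> \<exists>x. has_order x n"
  shows "\<exists>c. tower p c"
proof -
  have "\<exists>c. \<forall>k. has_order (c k) (level p k) \<and>
      (c (Suc k) [^] (level p (Suc k) div level p k) = c k)"
    using tower_step[OF p _ gen ex] ex[OF level_pos[OF p] level_coprime[OF p]]
    by (intro dependent_nat_choice) blast+
  thus ?thesis by (simp add: tower_def)
qed

end

text \<open>After descent to a common level, whether two powers of tower elements agree is a
  congruence of exponents modulo that level, hence the same question in both groups. So c k ^ i
  \<mapsto> b k ^ i is well defined and injective; that it is onto is checked where the second tower
  exhausts its group.\<close>

lemma tower_isomorphism:
  assumes G: "comm_group G" and H: "comm_group H" and p: "p > 1"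
    and c: "group.tower G p c" and b: "group.tower H p b"
    and exG: "\<And>x. x \<in> carrier G \<Longrightarrow> \<exists>k i. x = c k [^]\<^bsub>G\<^esub> (i::nat)"
  obtains h where "h \<in> hom G H" "inj_on h (carrier G)" "h \<in> extensional (carrier G)"
    "\<forall>k i. h (c k [^]\<^bsub>G\<^esub> (i::nat)) = b k [^]\<^bsub>H\<^esub> i"
proof -
  interpret G: comm_group G by fact
  interpret H: comm_group H by fact
  have key: "c k [^]\<^bsub>G\<^esub> i = c l [^]\<^bsub>G\<^esub> j \<longleftrightarrow> b k [^]\<^bsub>H\<^esub> i = b l [^]\<^bsub>H\<^esub> j"
    if kl: "k \<le> l" for k l and i j :: nat
  proof -
    let ?r = "level p l div level p k"
    have "c k [^]\<^bsub>G\<^esub> i = c l [^]\<^bsub>G\<^esub> (?r * i)"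
      unfolding G.tower_descend[OF c p kl, symmetric] by (rule G.nat_pow_pow[OF G.tower_mem[OF c]])
    moreover have "b k [^]\<^bsub>H\<^esub> i = b l [^]\<^bsub>H\<^esub> (?r * i)"
      unfolding H.tower_descend[OF b p kl, symmetric] by (rule H.nat_pow_pow[OF H.tower_mem[OF b]])
    moreover have "G.has_order (c l) (level p l)" "H.has_order (b l) (level p l)"
      using b c by (simp_all add: G.tower_def H.tower_def)
    ultimately show ?thesis using G.has_order_pow_eq H.has_order_pow_eq by simp
  qed
  have key': "c k [^]\<^bsub>G\<^esub> i = c l [^]\<^bsub>G\<^esub> j \<longleftrightarrow> b k [^]\<^bsub>H\<^esub> i = b l [^]\<^bsub>H\<^esub> j" for k l and i j :: nat
    using key[of k l i j] key[of l k j i] by (cases "k \<le> l") auto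
  define ki where "ki x = (SOME ki. x = c (fst ki) [^]\<^bsub>G\<^esub> (snd ki :: nat))" for x
  define h where "h = (\<lambda>x\<in>carrier G. b (fst (ki x)) [^]\<^bsub>H\<^esub> snd (ki x))"
  have hc: "h (c k [^]\<^bsub>G\<^esub> i) = b k [^]\<^bsub>H\<^esub> i" for k and i :: nat
  proof -
    let ?x = "c k [^]\<^bsub>G\<^esub> i"
    have x: "?x \<in> carrier G" using G.tower_mem[OF c] by simp
    have "\<exists>ki. ?x = c (fst ki) [^]\<^bsub>G\<^esub> (snd ki :: nat)" by (intro exI[of _ "(k, i)"]) simp
    hence "?x = c (fst (ki ?x)) [^]\<^bsub>G\<^esub> snd (ki ?x)" unfolding ki_def by (rule someI_ex)
    thus ?thesis using key' x by (simp add: h_def)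
  qed
  have common: "\<exists>k i j. x = c k [^]\<^bsub>G\<^esub> (i::nat) \<and> y = c k [^]\<^bsub>G\<^esub> (j::nat)"
    if x: "x \<in> carrier G" and y: "y \<in> carrier G" for x y
  proof -
    obtain k i l j where kl: "x = c k [^]\<^bsub>G\<^esub> (i::nat)" "y = c l [^]\<^bsub>G\<^esub> (j::nat)"
      using exG[OF x] exG[OF y] by blast
    let ?m = "max k l"
    have "x = c ?m [^]\<^bsub>G\<^esub> (level p ?m div level p k * i)"
      unfolding kl(1) G.tower_descend[OF c p, of k ?m, OF max.cobounded1, symmetric]
      by (rule G.nat_pow_pow[OF G.tower_mem[OF c]])
    moreover have "y = c ?m [^]\<^bsub>G\<^esub> (level p ?m div level p l * j)"
      unfolding kl(2) G.tower_descend[OF c p, of l ?m, OF max.cobounded2, symmetric]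
      by (rule G.nat_pow_pow[OF G.tower_mem[OF c]])
    ultimately show ?thesis by blast
  qed
  have "h \<in> hom G H"
  proof (rule homI)
    fix x assume "x \<in> carrier G"
    then obtain k and i :: nat where "x = c k [^]\<^bsub>G\<^esub> i" using exG by blast
    thus "h x \<in> carrier H" using hc H.tower_mem[OF b] by simp
  next
    fix x y assume "x \<in> carrier G" "y \<in> carrier G"
    then obtain k and i j :: nat where xy: "x = c k [^]\<^bsub>G\<^esub> i" "y = c k [^]\<^bsub>G\<^esub> j" using common by metis
    have "x \<otimes>\<^bsub>G\<^esub> y = c k [^]\<^bsub>G\<^esub> (i + j)" unfolding xy using G.tower_mem[OF c] by (simp add: G.nat_pow_mult)
    thus "h (x \<otimes>\<^bsub>G\<^esub> y) = h x \<otimes>\<^bsub>H\<^esub> h y"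
      unfolding xy using hc H.tower_mem[OF b] by (simp add: H.nat_pow_mult)
  qed
  moreover have "inj_on h (carrier G)"
  proof (rule inj_onI)
    fix x y assume "x \<in> carrier G" "y \<in> carrier G" and e: "h x = h y"
    then obtain k and i j :: nat where xy: "x = c k [^]\<^bsub>G\<^esub> i" "y = c k [^]\<^bsub>G\<^esub> j" using common by metis
    show "x = y" using e key' unfolding xy hc by blast
  qed
  moreover have "h \<in> extensional (carrier G)" by (simp add: h_def)
  ultimately show ?thesis using hc that by blast
qed

section \<open>Comparing two prime ideals above \<open>p\<close>\<close>

text \<open>Equivalently, x \<mapsto> y induces a ring homomorphism from the image of Z[x] in A/P to
  A/Q. Stating it through integral polynomials avoids quotient rings.\<close>

definition specializes :: "'c::field_char_0 set \<Rightarrow> 'c set \<Rightarrow> 'c \<Rightarrow> 'c \<Rightarrow> bool" where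
  "specializes P Q x y \<longleftrightarrow> (\<forall>f. ipoly f x \<in> P \<longrightarrow> ipoly f y \<in> Q)"

lemma specializes_trans: "specializes P Q x y \<Longrightarrow> specializes Q R y z \<Longrightarrow> specializes P R x z"
  by (simp add: specializes_def)

lemma specializes_power: "specializes P Q x y \<Longrightarrow> specializes P Q (x ^ n) (y ^ n)"
  unfolding specializes_def using ipoly_pcompose[of _ "monom 1 n"] by (metis ipoly_monom mult_1 of_int_1)

context prime_over
begin

text \<open>The usual root count carried out modulo P: synthetic division keeps the coefficients in
  A, and distinct elements of \<open>Mp p\<close> stay incongruent, so the linear factor can be
  cancelled at the other roots.\<close>

lemma root_bound:
  fixes f :: "'c poly"
  assumes "\<And>i. poly.coeff f i \<in> cycint" "lead_coeff f = 1" "finite T" "T \<subseteq> mu p \<union> {0}"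
    "\<And>t. t \<in> T \<Longrightarrow> poly f t \<in> P"
  shows "card T \<le> Polynomial.degree f"
  using assms
proof (induction "Polynomial.degree f" arbitrary: f T)
  case 0
  then obtain a where "f = [:a:]" by (metis degree_eq_zeroE)
  hence "f = 1" using 0 by (simp add: one_pCons)
  hence "T = {}" using 0(6) P_1 by auto
  thus ?case by simp
next
  case (Suc d)
  show ?case
  proof (cases "T = {}")
    case False
    then obtain t where t: "t \<in> T" by blast
    define g where "g = synthetic_div f t"
    have f: "f = [:- t, 1:] * g + [:poly f t:]"
      using synthetic_div_correct'[of t f] by (simp add: g_def)
    have dg: "Polynomial.degree g = d" using Suc(2) by (simp add: g_def degree_synthetic_div)
    have tT: "x \<in> cycint" if "x \<in> T" for x using that Suc.prems(4) mu_cycint by force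
    have poly_c: "poly h t \<in> cycint" if "\<And>i. poly.coeff h i \<in> cycint" for h
      unfolding poly_altdef using that tT[OF t] by (intro cycint_intros) auto
    have coeff_c: "poly.coeff (synthetic_div h t) i \<in> cycint" if "\<And>i. poly.coeff h i \<in> cycint" for h i
      using that
    proof (induction h arbitrary: i)
      case (pCons a h)
      have h: "poly.coeff h i \<in> cycint" for i using pCons.prems[of "Suc i"] by simp
      show ?case using pCons.IH[OF h] poly_c[OF h] by (cases i) auto
    qed simp
    have lg: "lead_coeff g = 1"
    proof -
      have "poly.coeff f (Suc d) = poly.coeff g d"
        using dg by (subst f) (simp add: coeff_eq_0)
      thus ?thesis using Suc(2) Suc.prems(2) dg by simp
    qed
    have "card (T - {t}) \<le> Polynomial.degree g"
    proof (rule Suc(1)[OF dg[symmetric] _ lg])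
      show "poly.coeff g i \<in> cycint" for i unfolding g_def by (rule coeff_c[OF Suc.prems(1)])
      show "finite (T - {t})" "T - {t} \<subseteq> mu p \<union> {0}" using Suc.prems by auto
      fix x assume x: "x \<in> T - {t}"
      have "poly f x = (x - t) * poly g x + poly f t" by (subst f) (simp add: algebra_simps)
      hence "(x - t) * poly g x = poly f x - poly f t" by simp
      moreover have "poly f x - poly f t \<in> P" using x t Suc.prems(5) by (intro P_diff) auto
      ultimately have "(x - t) * poly g x \<in> P" by simp
      moreover have "poly g x \<in> cycint"
        unfolding poly_altdef using tT[of x] x coeff_c[OF Suc.prems(1)]
        by (intro cycint_intros) (auto simp: g_def)
      ultimately have "x - t \<in> P \<or> poly g x \<in> P"
        using tT x t by (intro P_prime cycint_diff) auto
      moreover have "x - t \<notin> P"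
      proof
        assume "x - t \<in> P"
        hence "x = t" using x t Suc.prems(4) by (intro cg_Mp_eq) (auto simp: Mp_def cg_def)
        thus False using x by simp
      qed
      ultimately show "poly g x \<in> P" by blast
    qed
    thus ?thesis using t Suc.prems(3) dg Suc(2) by simp
  qed simp
qed

lemma ipoly_root_bound:
  assumes "lead_coeff f = 1" "finite T" "T \<subseteq> mu p \<union> {0}" "\<And>t. t \<in> T \<Longrightarrow> ipoly f t \<in> P"
  shows "card T \<le> Polynomial.degree f"
  using root_bound[of "map_poly of_int f" T] assms by (simp add: ipoly_def)

text \<open>An integral lift m of the minimal polynomial of x modulo P over the prime field,
  obtained as a monic polynomial of least degree with value in P. A polynomial of smaller degree
  with value in P loses its leading term as long as p divides it; a leading coefficient prime to p
  would contradict minimality.\<close>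

lemma minimal_polynomial:
  assumes x: "x \<in> mu p"
  obtains m where "lead_coeff m = 1" "ipoly m x \<in> P" "Polynomial.degree m > 0"
    "\<forall>r. Polynomial.degree r < Polynomial.degree m \<longrightarrow> ipoly r x \<in> P \<longrightarrow> (\<exists>r'. r = smult (int p) r')"
proof -
  obtain n where n: "n > 0" "x ^ n = 1" using x by (elim muE)
  let ?f = "monom 1 n - 1 :: int poly"
  have "Polynomial.degree ?f = n"
    using n(1) by (intro antisym degree_diff_le le_degree) (auto simp: degree_monom_eq)
  hence "lead_coeff ?f = 1 \<and> ipoly ?f x \<in> P" using n by simp
  then obtain m where m: "lead_coeff m = 1" "ipoly m x \<in> P"
    "\<And>g. lead_coeff g = 1 \<Longrightarrow> ipoly g x \<in> P \<Longrightarrow> Polynomial.degree m \<le> Polynomial.degree g"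
    using ex_has_least_nat[of "\<lambda>m. lead_coeff m = 1 \<and> ipoly m x \<in> P" ?f Polynomial.degree] by blast
  have "Polynomial.degree m > 0"
  proof (rule ccontr)
    assume "\<not> Polynomial.degree m > 0"
    then obtain a where "m = [:a:]" by (metis degree_eq_zeroE not_gr0)
    hence "m = 1" using m(1) by (simp add: one_pCons)
    thus False using m(2) P_1 by simp
  qed
  moreover have xc: "x \<in> cycint" by (rule mu_cycint[OF x])
  have "\<exists>r'. r = smult (int p) r'"
    if "Polynomial.degree r < Polynomial.degree m" "ipoly r x \<in> P" for r
    using that
  \<comment> \<open>The shifted degree distinguishes 0 from nonzero constants, so that it also drops
    when removing the leading term leaves 0.\<close>
  proof (induction "if r = 0 then 0 else Suc (Polynomial.degree r)" arbitrary: r rule: less_induct)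
    case less
    show ?case
    proof (cases "r = 0")
      case True
      thus ?thesis by (intro exI[of _ 0]) simp
    next
      case False
      define d where "d = Polynomial.degree r"
      define a where "a = lead_coeff r"
      show ?thesis
      proof (cases "int p dvd a")
        case True
        then obtain a' where a': "a = int p * a'" by (elim dvdE)
        define r1 where "r1 = r - monom a d"
        have r1d: "r1 = 0 \<or> Polynomial.degree r1 < d"
        proof (cases "r1 = 0")
          case r10: False
          have le: "Polynomial.degree r1 \<le> d"
            unfolding r1_def by (intro degree_diff_le) (auto simp: d_def degree_monom_le)
          have "poly.coeff r1 d = 0" by (simp add: r1_def a_def d_def)
          hence "Polynomial.degree r1 \<noteq> d" using r10 by (metis leading_coeff_0_iff)
          thus ?thesis using le by simp
        qed simp
        have "ipoly r1 x = ipoly r x - of_nat p * (of_int a' * x ^ d)" by (simp add: r1_def a')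
        moreover have "of_nat p * (of_int a' * x ^ d) \<in> P" using xc by (intro P_mult P_p cycint_intros) auto
        ultimately have "ipoly r1 x \<in> P" using P_diff[OF less.prems(2)] by simp
        moreover have "Polynomial.degree r1 < Polynomial.degree m"
          using r1d less.prems(1) d_def by (cases "r1 = 0") auto
        moreover have "(if r1 = 0 then 0 else Suc (Polynomial.degree r1))
            < (if r = 0 then 0 else Suc (Polynomial.degree r))"
          using r1d False by (auto simp: d_def)
        ultimately obtain r' where r': "r1 = smult (int p) r'" using less.hyps by blast
        have "r = smult (int p) (r' + monom a' d)"
          using r' a' unfolding r1_def by (simp add: smult_add_right smult_monom algebra_simps)
        thus ?thesis by blast
      next
        case nd: False
        hence "coprime (int p) a" using prime_p by (intro prime_imp_coprime) auto
        then obtain u w where uw: "u * int p + w * a = 1" using bezout_int[of "int p" a] by auto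
        \<comment> \<open>By the Bezout relation this polynomial is monic of degree d, and its value
          still lies in P because the added term is a multiple of p.\<close>
        define r2 where "r2 = smult w r + monom (u * int p) d"
        have c2: "poly.coeff r2 d = 1" using uw by (simp add: r2_def d_def a_def add.commute)
        have "Polynomial.degree r2 \<le> d"
          unfolding r2_def by (intro degree_add_le) (auto simp: d_def degree_monom_le intro: degree_smult_le)
        hence d2: "Polynomial.degree r2 = d" using c2 le_degree[of r2 d] by simp
        have "ipoly r2 x = ipoly r x * of_int w + of_nat p * (of_int u * x ^ d)"
          by (simp add: r2_def algebra_simps)
        also have "\<dots> \<in> P" using xc less.prems(2) by (intro P_add P_mult P_p cycint_intros) auto
        finally have "Polynomial.degree m \<le> d" using m(3)[of r2] c2 d2 by simp
        thus ?thesis using less.prems(1) by (simp add: d_def)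
      qed
    qed
  qed
  ultimately show ?thesis using that m(1,2) by blast
qed

lemma frobenius_value:
  assumes x: "x \<in> mu p" "x ^ (p ^ K) = x"
  shows "cg (ipoly f x ^ (p ^ K)) (ipoly f x)"
  using cg_frobenius[OF mu_cycint[OF x(1)], of f K] x(2) by simp

lemma mu_frobenius_period:
  assumes "x \<in> mu p"
  obtains K where "K > 0" "x ^ (p ^ K) = x"
proof -
  obtain n where n: "n > 0" "coprime n p" "x ^ n = 1" using assms by (rule muE)
  obtain K where "K > 0" "[p ^ K = 1] (mod n)" using exists_frobenius_fixing[OF n(1,2)] .
  thus ?thesis using frobenius_fixes[OF _ p_pos n(3)] that by blast
qed

lemma frobenius_specializes: "x \<in> mu p \<Longrightarrow> specializes P P x (x ^ (p ^ i))"
  unfolding specializes_def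
  using cg_mem[OF cg_frobenius[OF mu_cycint]] P_power_pos p_pos by (meson zero_less_power)

text \<open>Let K be the length of the Frobenius orbit of x. The K conjugates in this orbit and y
  are all roots of m modulo P, so if y were outside the orbit, the degree of m would exceed K. But
  the degree is at most K, since the image of Z[x] in A/P has at most p^K elements.\<close>

lemma specializes_imp_frobenius:
  assumes x: "x \<in> mu p" and y: "y \<in> mu p" and xy: "specializes P P x y"
  shows "\<exists>i. y = x ^ (p ^ i)"
proof (rule ccontr)
  assume ne: "\<not> (\<exists>i. y = x ^ (p ^ i))"
  have p1: "p > 1" by (rule prime_gt_1_nat[OF prime_p])
  obtain m where m: "lead_coeff m = 1" "ipoly m x \<in> P" "Polynomial.degree m > 0"
    "\<forall>r. Polynomial.degree r < Polynomial.degree m \<longrightarrow> ipoly r x \<in> P \<longrightarrow> (\<exists>r'. r = smult (int p) r')"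
    using minimal_polynomial[OF x] .
  define d where "d = Polynomial.degree m"
  define K where "K = (LEAST K. K > 0 \<and> x ^ (p ^ K) = x)"
  have K: "K > 0" "x ^ (p ^ K) = x" and K_least: "\<And>L. L > 0 \<Longrightarrow> x ^ (p ^ L) = x \<Longrightarrow> K \<le> L"
  proof -
    have "\<exists>K. K > 0 \<and> x ^ (p ^ K) = x" using mu_frobenius_period[OF x] by metis
    from LeastI_ex[OF this] show "K > 0" "x ^ (p ^ K) = x" by (auto simp: K_def)
    show "\<And>L. L > 0 \<Longrightarrow> x ^ (p ^ L) = x \<Longrightarrow> K \<le> L" unfolding K_def by (intro Least_le) auto
  qed
  have distinct: "inj_on (\<lambda>i. x ^ (p ^ i)) {..<K}"
  proof (rule linorder_inj_onI')
    fix i j assume ij: "i \<in> {..<K}" "j \<in> {..<K}" "i < j"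
    show "x ^ (p ^ i) \<noteq> x ^ (p ^ j)"
    proof
      assume "x ^ (p ^ i) = x ^ (p ^ j)"
      also have "\<dots> = (x ^ (p ^ (j - i))) ^ (p ^ i)"
        using ij(3) by (simp flip: power_mult power_add)
      finally have "x = x ^ (p ^ (j - i))" by (rule mu_power_inj[OF x mu_power[OF x]])
      hence "K \<le> j - i" using ij(3) by (intro K_least) auto
      thus False using ij by auto
    qed
  qed
  define q where "q = p ^ K"
  have q1: "q > 1" unfolding q_def by (rule one_less_power[OF p1 K(1)])
  have "p ^ d \<le> q"
  proof -
    \<comment> \<open>The p^d coefficient lists with entries below p. Two lists with congruent
      values differ by a polynomial of degree below d that is divisible by p, so they coincide; and
      all representatives of values are among the q solutions of t^q = t.\<close>
    define S where "S = {xs. set xs \<subseteq> {..<p} \<and> length xs = d}"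
    define F where "F xs = rep (ipoly (Poly (map int xs)) x)" for xs
    have xc: "x \<in> cycint" by (rule mu_cycint[OF x])
    have "inj_on F S"
    proof (rule inj_onI)
      fix xs ys assume S: "xs \<in> S" "ys \<in> S" and e: "F xs = F ys"
      let ?r = "Poly (map int xs) - Poly (map int ys)"
      have c: "ipoly f x \<in> cycint" for f using xc by (rule cycint_ipoly)
      have "cg (ipoly (Poly (map int xs)) x) (ipoly (Poly (map int ys)) x)"
        using rep(2)[OF c] e cg_sym cg_trans unfolding F_def by metis
      hence rP: "ipoly ?r x \<in> P" by (simp add: cg_def)
      have "Polynomial.degree ?r < d"
      proof -
        have "poly.coeff ?r i = 0" if "i \<ge> d" for i
          using that S by (simp add: S_def coeff_Poly_eq nth_default_beyond)
        hence "Polynomial.degree ?r \<le> d - 1" using m(3)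
          by (intro degree_le) (auto simp: d_def)
        thus ?thesis using m(3) by (simp add: d_def)
      qed
      then obtain r' where r': "?r = smult (int p) r'" using m(4) rP by (auto simp: d_def)
      show "xs = ys"
      proof (rule nth_equalityI)
        show "length xs = length ys" using S by (simp add: S_def)
        fix i assume i: "i < length xs"
        have "xs ! i \<in> set xs" "ys ! i \<in> set ys" using i S by (simp_all add: S_def)
        hence "xs ! i < p" "ys ! i < p" using S by (auto simp: S_def)
        moreover have "int (xs ! i) - int (ys ! i) = int p * poly.coeff r' i"
          using arg_cong[OF r', of "\<lambda>f. poly.coeff f i"] i S
          by (simp add: coeff_Poly_eq nth_default_nth S_def)
        hence "int p dvd int (xs ! i) - int (ys ! i)" by simp
        ultimately show "xs ! i = ys ! i"
          by (metis cong_iff_dvd_diff cong_int_iff cong_less_modulus_unique_nat)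
      qed
    qed
    moreover have "F ` S \<subseteq> {0} \<union> {z. z ^ (q - 1) = 1}"
    proof
      fix t assume "t \<in> F ` S"
      then obtain f where t: "t = rep (ipoly f x)" by (auto simp: F_def)
      have c: "ipoly f x \<in> cycint" using xc by (rule cycint_ipoly)
      have t': "t \<in> Mp p" "cg (ipoly f x) t" unfolding t by (rule rep[OF c])+
      have "cg (t ^ q) (ipoly f x ^ q)" by (rule cg_power[OF cg_sym[OF t'(2)] Mp_cycint[OF t'(1)] c])
      also have "cg (ipoly f x ^ q) (ipoly f x)" unfolding q_def by (rule frobenius_value[OF x K(2)])
      also note t'(2)
      finally have "t ^ q = t" by (rule cg_Mp_eq[OF Mp_power[OF t'(1)] t'(1)])
      hence "t * t ^ (q - 1) = t * 1" using q1 by (simp add: power_eq_if[of t q])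
      thus "t \<in> {0} \<union> {z. z ^ (q - 1) = 1}" by auto
    qed
    moreover have q10: "q - 1 > 0" using q1 by simp
    obtain z :: 'c where z: "primroot (q - 1) z" using primroot_exists[OF q10] by blast
    note roots = roots_of_unity_eq(3,4)[OF z q10]
    ultimately have "card S \<le> card ({0} \<union> {z :: 'c. z ^ (q - 1) = 1})"
      by (intro card_inj_on_le[of F]) (use roots in auto)
    also have "\<dots> \<le> 1 + (q - 1)" using card_Un_le[of "{0::'c}" "{z. z ^ (q - 1) = 1}"] roots by simp
    finally show ?thesis using q1 by (simp add: S_def card_lists_length_eq)
  qed
  hence dK: "d \<le> K" unfolding q_def using p1 by (simp add: power_increasing_iff)
  let ?T = "insert y ((\<lambda>i. x ^ (p ^ i)) ` {..<K})"
  have "card ?T \<le> Polynomial.degree m"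
  proof (rule ipoly_root_bound[OF m(1)])
    show "?T \<subseteq> mu p \<union> {0}" using x y by (auto intro: mu_power)
    fix t assume "t \<in> ?T"
    then consider "t = y" | i where "t = x ^ (p ^ i)" by auto
    thus "ipoly m t \<in> P"
    proof cases
      case 1
      thus ?thesis using xy m(2) by (simp add: specializes_def)
    next
      case 2
      thus ?thesis using frobenius_specializes[OF x] m(2) by (simp add: specializes_def)
    qed
  qed simp
  moreover have "card ?T = Suc K"
    using ne distinct by (subst card_insert_disjoint) (auto simp: card_image)
  ultimately show False using dK by (simp add: d_def)
qed

end

locale two_primes = P: prime_over p P + Q: prime_over p Q
  for p and P Q :: "'c::{alg_closed_field,field_char_0} set"
begin

text \<open>Modulo p, m divides X^n - 1 with a monic cofactor g of degree below n. The n roots of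
  unity of exponent n cannot all be roots of g modulo Q, so one of them is a root of m modulo Q, and
  this suffices because m and p generate all relations of x modulo P.\<close>

lemma specializes_exists:
  assumes x: "x \<in> mu p"
  shows "\<exists>y\<in>mu p. specializes P Q x y"
proof -
  obtain n where n: "n > 0" "coprime n p" "x ^ n = 1" using x by (rule muE)
  obtain m where m: "lead_coeff m = 1" "ipoly m x \<in> P" "Polynomial.degree m > 0"
    "\<forall>r. Polynomial.degree r < Polynomial.degree m \<longrightarrow> ipoly r x \<in> P \<longrightarrow> (\<exists>r'. r = smult (int p) r')"
    using P.minimal_polynomial[OF x] .
  \<comment> \<open>Relations of x modulo P are the multiples of m up to p: the remainder on
    division by m also has its value in P, hence is divisible by p.\<close>
  have ker: "\<exists>g r. f = m * g + smult (int p) r \<and> Polynomial.degree (smult (int p) r) < Polynomial.degree m"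
    if "ipoly f x \<in> P" for f
  proof -
    obtain g r where gr: "f = m * g + r" "r = 0 \<or> Polynomial.degree r < Polynomial.degree m"
      using monic_division[OF m(1)] .
    have d: "Polynomial.degree r < Polynomial.degree m" using gr(2) m(3) by auto
    have "ipoly m x * ipoly g x \<in> P" by (rule P.P_mult[OF m(2) cycint_ipoly[OF mu_cycint[OF x]]])
    from P.P_diff[OF that this] have "ipoly r x \<in> P" by (simp add: gr(1))
    then obtain r' where "r = smult (int p) r'" using m(4) d by blast
    thus ?thesis using gr(1) d by blast
  qed
  let ?f = "monom 1 n - 1 :: int poly"
  have df: "Polynomial.degree ?f = n"
    using n(1) by (intro antisym degree_diff_le le_degree) (auto simp: degree_monom_eq)
  hence lf: "lead_coeff ?f = 1" using n(1) by simp
  have "ipoly ?f x \<in> P" using n(3) by simp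
  then obtain g r where gr: "?f = m * g + smult (int p) r"
    "Polynomial.degree (smult (int p) r) < Polynomial.degree m" using ker by blast
  have "g \<noteq> 0"
  proof
    assume "g = 0"
    hence "int p dvd lead_coeff ?f" unfolding gr(1) by simp
    thus False using lf prime_gt_1_nat[OF P.prime_p] by (simp add: zdvd1_eq)
  qed
  moreover have "m \<noteq> 0" using m(1) by auto
  ultimately have dmg: "Polynomial.degree (m * g) = Polynomial.degree m + Polynomial.degree g"
    by (rule degree_mult_eq[rotated])
  hence lt: "Polynomial.degree (smult (int p) r) < Polynomial.degree (m * g)" using gr(2) by linarith
  have "Polynomial.degree ?f = Polynomial.degree (m * g)" "lead_coeff ?f = lead_coeff (m * g)"
    unfolding gr(1) using degree_add_eq_left[OF lt] coeff_eq_0[OF lt] by simp_all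
  hence g: "Polynomial.degree g < n" "lead_coeff g = 1"
    using df dmg m(1,3) lf lead_coeff_mult[of m g] by simp_all
  obtain z :: 'c where z: "primroot n z" using primroot_exists[OF n(1)] by blast
  have T: "{t::'c. t ^ n = 1} \<subseteq> mu p" using n by (auto intro: muI)
  have "\<exists>t. t ^ n = 1 \<and> ipoly m t \<in> Q"
  proof (rule ccontr)
    assume no: "\<not> (\<exists>t. t ^ n = 1 \<and> ipoly m t \<in> Q)"
    have "card {t::'c. t ^ n = 1} \<le> Polynomial.degree g"
    proof (rule Q.ipoly_root_bound[OF g(2)])
      show "finite {t::'c. t ^ n = 1}" by (rule roots_of_unity_eq(4)[OF z n(1)])
      show "{t::'c. t ^ n = 1} \<subseteq> mu p \<union> {0}" using T by blast
      fix t :: 'c assume t: "t \<in> {t. t ^ n = 1}"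
      hence tc: "t \<in> cycint" using cycint_root n(1) by blast
      have "ipoly ?f t = 0" using t by simp
      hence "ipoly m t * ipoly g t = of_nat p * (- ipoly r t)"
        unfolding gr(1) by (simp add: eq_neg_iff_add_eq_0)
      also have "\<dots> \<in> Q" by (intro Q.P_mult Q.P_p cycint_intros tc)
      finally have "ipoly m t \<in> Q \<or> ipoly g t \<in> Q" by (intro Q.P_prime cycint_ipoly tc)
      thus "ipoly g t \<in> Q" using no t by blast
    qed
    thus False using g(1) roots_of_unity_eq(3)[OF z n(1)] by simp
  qed
  then obtain t where t: "t ^ n = 1" "ipoly m t \<in> Q" by blast
  hence tmu: "t \<in> mu p" using T by blast
  have "specializes P Q x t" unfolding specializes_def
  proof (intro allI impI)
    fix f assume "ipoly f x \<in> P"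
    then obtain g' r' where "f = m * g' + smult (int p) r'" using ker by blast
    hence "ipoly f t = ipoly m t * ipoly g' t + of_nat p * ipoly r' t" by simp
    also have "\<dots> \<in> Q" by (intro Q.P_add Q.P_mult t Q.P_p cycint_ipoly mu_cycint[OF tmu])
    finally show "ipoly f t \<in> Q" .
  qed
  thus ?thesis using tmu by blast
qed

text \<open>A value outside P is invertible in a finite field, so its (q - 1)-st power is congruent
  to 1 modulo P. This is itself a relation at x; it specializes and keeps the value at y outside
  Q.\<close>

lemma specializes_sym:
  assumes x: "x \<in> mu p" and y: "y \<in> mu p" and xy: "specializes P Q x y"
  shows "specializes Q P y x"
  unfolding specializes_def
proof (intro allI impI, rule ccontr)
  fix f assume fy: "ipoly f y \<in> Q" and fx: "ipoly f x \<notin> P"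
  obtain K where K: "K > 0" "x ^ (p ^ K) = x" using P.mu_frobenius_period[OF x] .
  define q where "q = p ^ K"
  have q1: "q > 1" unfolding q_def by (rule one_less_power[OF prime_gt_1_nat[OF P.prime_p] K(1)])
  have c: "ipoly f x \<in> cycint" by (rule cycint_ipoly[OF mu_cycint[OF x]])
  have "ipoly f x ^ q - ipoly f x \<in> P"
    using P.frobenius_value[OF x K(2), of f] by (simp add: P.cg_def q_def)
  hence "ipoly f x * (ipoly f x ^ (q - 1) - 1) \<in> P"
    using q1 by (simp add: power_eq_if[of _ q] right_diff_distrib)
  moreover have "ipoly f x ^ (q - 1) - 1 \<in> cycint" by (intro cycint_diff cycint_power c cycint_1)
  ultimately have "ipoly f x ^ (q - 1) - 1 \<in> P" using P.P_prime[OF c] fx by blast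
  hence "ipoly (f ^ (q - 1) - 1) x \<in> P" by simp
  hence "ipoly (f ^ (q - 1) - 1) y \<in> Q" using xy unfolding specializes_def by blast
  hence 1: "ipoly f y ^ (q - 1) - 1 \<in> Q" by simp
  have 2: "ipoly f y ^ (q - 1) \<in> Q" using fy q1 by (intro Q.P_power_pos) auto
  from Q.P_diff[OF 2 1] show False using Q.P_1 by simp
qed

lemma specializes_root_iff:
  assumes x: "x \<in> mu p" and y: "y \<in> mu p" and xy: "specializes P Q x y"
  shows "y ^ i = 1 \<longleftrightarrow> x ^ i = 1"
proof
  assume "x ^ i = 1"
  hence "ipoly (monom 1 i - 1) x \<in> P" by simp
  hence "ipoly (monom 1 i - 1) y \<in> Q" using xy unfolding specializes_def by blast
  hence "Q.cg (y ^ i) 1" by (simp add: Q.cg_def)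
  thus "y ^ i = 1" using Q.cg_mu_eq[OF mu_power[OF y] mu_1] by blast
next
  assume "y ^ i = 1"
  hence "ipoly (monom 1 i - 1) y \<in> Q" by simp
  hence "ipoly (monom 1 i - 1) x \<in> P" using specializes_sym[OF assms] unfolding specializes_def by blast
  hence "P.cg (x ^ i) 1" by (simp add: P.cg_def)
  thus "x ^ i = 1" using P.cg_mu_eq[OF mu_power[OF x] mu_1] by blast
qed

end

section \<open>The group of automorphisms\<close>

lemma mu_group_simps:
  "carrier (mu_group p) = mu p" "x \<otimes>\<^bsub>mu_group p\<^esub> y = x * y" "\<one>\<^bsub>mu_group p\<^esub> = 1"
  by (simp_all add: mu_group_def Ring_Divisibility.mult_of_def Qcyc_ops)

lemma mu_group_pow: "x [^]\<^bsub>mu_group p\<^esub> (n::nat) = x ^ n"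
  by (induction n) (simp_all add: mu_group_simps power_commutes)

lemma mu_left_inverse: "x \<in> mu p \<Longrightarrow> inverse x * x = 1"
  by (simp add: mu_nonzero)

interpretation mu_group: comm_group "mu_group p"
  by (rule comm_groupI)
    (auto simp: mu_group_simps mu_mult intro!: bexI[of _ "inverse _"] mu_inverse mu_left_inverse)

lemma mu_group_has_order: "mu_group.has_order p x n \<longleftrightarrow> x \<in> mu p \<and> primroot n x"
  by (simp add: mu_group.has_order_def mu_group_simps mu_group_pow primroot_def)

lemma mu_group_generates:
  "\<lbrakk>n > 0; mu_group.has_order p y n; x [^]\<^bsub>mu_group p\<^esub> (n::nat) = \<one>\<^bsub>mu_group p\<^esub>\<rbrakk>
    \<Longrightarrow> \<exists>i::nat. x = y [^]\<^bsub>mu_group p\<^esub> i"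
  unfolding mu_group_has_order mu_group_pow mu_group_simps by (metis primroot_generates)

lemma mu_group_exists_order:
  assumes "n > 0" "coprime n p"
  shows "\<exists>x::'c::{alg_closed_field,field_char_0}. mu_group.has_order p x n"
proof -
  obtain x :: 'c where x: "primroot n x" using primroot_exists[OF assms(1)] by blast
  moreover have "x \<in> mu p" using x assms by (intro muI[of n]) (simp_all add: primrootD)
  ultimately show ?thesis unfolding mu_group_has_order by blast
qed

lemma mu_tower_exists:
  "p > 1 \<Longrightarrow> \<exists>c :: nat \<Rightarrow> 'c::{alg_closed_field,field_char_0}. mu_group.tower p p c"
  by (rule mu_group.tower_exists) (use mu_group_generates mu_group_exists_order in blast)+

lemma mu_tower_exhausts:
  assumes p: "p > 1" and c: "mu_group.tower p p c" and x: "x \<in> mu p"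
  shows "\<exists>k i. x = c k ^ i"
proof -
  obtain n where n: "n > 0" "coprime n p" "x ^ n = 1" using x by (rule muE)
  obtain k where "n dvd level p k" using dvd_level[OF n(2,1)] p by auto
  hence "x ^ level p k = 1" using n(3) by (auto simp: power_mult elim!: dvdE)
  moreover have "primroot (level p k) (c k)"
    using c by (simp add: mu_group.tower_def mu_group_has_order)
  ultimately show ?thesis using primroot_generates level_pos[OF p] by metis
qed

lemma Gp_iff:
  "g \<in> carrier (Gp p) \<longleftrightarrow> g \<in> extensional (mu p) \<and> bij_betw g (mu p) (mu p) \<and>
    (\<forall>x\<in>mu p. \<forall>y\<in>mu p. g (x * y) = g x * g y)"
  by (auto simp: Gp_def AutoGroup_def auto_def hom_def Bij_def mu_group_simps dest: bij_betw_apply)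

lemma Gp_closed: "g \<in> carrier (Gp p) \<Longrightarrow> x \<in> mu p \<Longrightarrow> g x \<in> mu p"
  by (auto simp: Gp_iff dest: bij_betw_apply)

lemma Gp_mult_apply:
  "\<lbrakk>g \<in> carrier (Gp p); x \<in> mu p; y \<in> mu p\<rbrakk> \<Longrightarrow> g (x * y) = g x * g y"
  by (simp add: Gp_iff)

lemma Gp_one_apply: "g \<in> carrier (Gp p) \<Longrightarrow> g 1 = 1"
  using Gp_mult_apply[of g p 1 1] Gp_closed[of g p 1] mu_nonzero[of "g 1" p] by simp

lemma Gp_power_apply: "g \<in> carrier (Gp p) \<Longrightarrow> x \<in> mu p \<Longrightarrow> g (x ^ n) = g x ^ n"
  by (induction n) (simp_all add: Gp_one_apply Gp_mult_apply mu_power)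

lemma Gp_inj: "g \<in> carrier (Gp p) \<Longrightarrow> x \<in> mu p \<Longrightarrow> y \<in> mu p \<Longrightarrow> g x = g y \<longleftrightarrow> x = y"
  by (auto simp: Gp_iff bij_betw_def dest: inj_onD)

lemma Gp_inverse_apply: "g \<in> carrier (Gp p) \<Longrightarrow> x \<in> mu p \<Longrightarrow> g (inverse x) = inverse (g x)"
  using Gp_mult_apply[of g p x "inverse x"] Gp_one_apply[of g p] mu_nonzero[of x p]
    inverse_unique[of "g x" "g (inverse x)"] by (simp add: mu_inverse)

lemma Gp_divide_apply:
  "g \<in> carrier (Gp p) \<Longrightarrow> x \<in> mu p \<Longrightarrow> y \<in> mu p \<Longrightarrow> g (x / y) = g x / g y"
  by (simp add: divide_inverse Gp_mult_apply mu_inverse Gp_inverse_apply)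

lemma Gp_mult: "g \<in> carrier (Gp p) \<Longrightarrow> h \<in> carrier (Gp p) \<Longrightarrow> g \<otimes>\<^bsub>Gp p\<^esub> h = compose (mu p) g h"
  by (simp add: Gp_def AutoGroup_def auto_def BijGroup_def mu_group_simps)

lemma Gp_one: "\<one>\<^bsub>Gp p\<^esub> = (\<lambda>x\<in>mu p. x)"
  by (simp add: Gp_def AutoGroup_def BijGroup_def mu_group_simps)

lemma group_Gp: "group (Gp p)"
  unfolding Gp_def by (rule mu_group.AutoGroup)

definition ext0 :: "('c::zero \<Rightarrow> 'c) \<Rightarrow> 'c \<Rightarrow> 'c" where
  "ext0 g x = (if x = 0 then 0 else g x)"

lemma ext0_simps [simp]: "ext0 g 0 = 0" "x \<noteq> 0 \<Longrightarrow> ext0 g x = g x"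
  by (simp_all add: ext0_def)

lemma ext0_mu: "x \<in> mu p \<Longrightarrow> ext0 g x = g x"
  using mu_nonzero by (auto simp: ext0_def)

lemma ext0_closed: "g \<in> carrier (Gp p) \<Longrightarrow> x \<in> Mp p \<Longrightarrow> ext0 g x \<in> Mp p"
  by (auto simp: ext0_def Mp_def Gp_closed)

lemma ext0_inj: "g \<in> carrier (Gp p) \<Longrightarrow> x \<in> Mp p \<Longrightarrow> y \<in> Mp p \<Longrightarrow> ext0 g x = ext0 g y \<longleftrightarrow> x = y"
  using Gp_closed[of g p x] Gp_closed[of g p y] mu_nonzero Gp_inj[of g p x y]
  by (auto simp: ext0_def Mp_def)

lemma ext0_mult:
  "g \<in> carrier (Gp p) \<Longrightarrow> x \<in> Mp p \<Longrightarrow> y \<in> Mp p \<Longrightarrow> ext0 g (x * y) = ext0 g x * ext0 g y"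
  by (auto simp: ext0_def Mp_def Gp_mult_apply)

lemma ext0_divide:
  "g \<in> carrier (Gp p) \<Longrightarrow> x \<in> Mp p \<Longrightarrow> y \<in> Mp p \<Longrightarrow> ext0 g (x / y) = ext0 g x / ext0 g y"
  by (auto simp: ext0_def Mp_def Gp_divide_apply)

lemma ext0_eq_0: "g \<in> carrier (Gp p) \<Longrightarrow> x \<in> Mp p \<Longrightarrow> ext0 g x = 0 \<longleftrightarrow> x = 0"
  using ext0_inj[of g p x 0] by simp

section \<open>Conjugacy of the prime ideals above \<open>p\<close>\<close>

context two_primes
begin

text \<open>A tower c is specialized level by level to a tower b. A specialization chosen at the
  upper level may restrict wrongly, but its restriction and the given one differ by a power of
  Frobenius, which can be applied upstairs. The automorphism taking c to b then transports
  congruences modulo P to congruences modulo Q.\<close>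

lemma conjugating_automorphism:
  shows "\<exists>g\<in>carrier (Gp p). \<forall>x\<in>Mp p. Q.successor (ext0 g x) = ext0 g (P.successor x)"
proof -
  have p1: "p > 1" by (rule prime_gt_1_nat[OF P.prime_p])
  obtain c :: "nat \<Rightarrow> 'c" where c: "mu_group.tower p p c" using mu_tower_exists[OF p1] by blast
  let ?r = "\<lambda>k. level p (Suc k) div level p k"
  have c_order: "c k \<in> mu p" "primroot (level p k) (c k)" "c (Suc k) ^ ?r k = c k" for k
    using c by (simp_all add: mu_group.tower_def mu_group_has_order mu_group_pow)
  interpret QQ: two_primes p Q Q by unfold_locales
  have "\<exists>b. \<forall>k. (b k \<in> mu p \<and> specializes P Q (c k) (b k)) \<and> b (Suc k) ^ ?r k = b k"
  proof (rule dependent_nat_choice)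
    show "\<exists>y. y \<in> mu p \<and> specializes P Q (c 0) y" using specializes_exists[OF c_order(1)] by blast
    fix b k assume b: "b \<in> mu p \<and> specializes P Q (c k) b"
    obtain b' where b': "b' \<in> mu p" "specializes P Q (c (Suc k)) b'"
      using specializes_exists[OF c_order(1)] by blast
    have r: "b' ^ ?r k \<in> mu p" by (rule mu_power[OF b'(1)])
    have "specializes P Q (c k) (b' ^ ?r k)"
      using specializes_power[OF b'(2), of "?r k"] by (simp only: c_order(3))
    \<comment> \<open>Going back from Q to P and forth again compares the two candidates below
      modulo Q alone, where \<open>Q.specializes_imp_frobenius\<close> applies.\<close>
    hence "specializes Q P (b' ^ ?r k) (c k)" by (rule specializes_sym[OF c_order(1) r])
    hence "specializes Q Q (b' ^ ?r k) b" using b by (blast intro: specializes_trans)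
    then obtain i where i: "b = (b' ^ ?r k) ^ (p ^ i)"
      using Q.specializes_imp_frobenius[OF r] b by blast
    have "specializes P Q (c (Suc k)) (b' ^ (p ^ i))"
      by (rule specializes_trans[OF b'(2) Q.frobenius_specializes[OF b'(1)]])
    moreover have "(b' ^ (p ^ i)) ^ ?r k = b" unfolding i by (simp add: mult.commute flip: power_mult)
    ultimately show "\<exists>y. (y \<in> mu p \<and> specializes P Q (c (Suc k)) y) \<and> y ^ ?r k = b"
      using mu_power[OF b'(1)] by blast
  qed
  then obtain b where b: "\<And>k. b k \<in> mu p" "\<And>k. specializes P Q (c k) (b k)"
    "\<And>k. b (Suc k) ^ ?r k = b k" by blast
  have "primroot (level p k) (b k)" for k
    using specializes_root_iff[OF c_order(1) b(1) b(2)] c_order(2) by (simp add: primroot_def)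
  hence bt: "mu_group.tower p p b"
    using b by (simp add: mu_group.tower_def mu_group_has_order mu_group_pow)
  have exh: "\<exists>k i. x = c k [^]\<^bsub>mu_group p\<^esub> (i::nat)" if "x \<in> carrier (mu_group p)" for x :: 'c
    using mu_tower_exhausts[OF p1 c] that by (simp add: mu_group_simps mu_group_pow)
  obtain h where h: "h \<in> hom (mu_group p) (mu_group p)" "inj_on h (carrier (mu_group p))"
    "h \<in> extensional (carrier (mu_group p))"
    "\<forall>k i. h (c k [^]\<^bsub>mu_group p\<^esub> (i::nat)) = b k [^]\<^bsub>mu_group p\<^esub> i"
    by (rule tower_isomorphism[OF mu_group.comm_group_axioms mu_group.comm_group_axioms p1 c bt exh])
  note h' = h[unfolded mu_group_simps mu_group_pow]
  have "h ` mu p = mu p"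
  proof
    show "h ` mu p \<subseteq> mu p" using h(1) by (auto simp: hom_def mu_group_simps)
    show "mu p \<subseteq> h ` mu p"
    proof
      fix y :: 'c assume "y \<in> mu p"
      then obtain k i where "y = b k ^ i" using mu_tower_exhausts[OF p1 bt] by blast
      hence "y = h (c k ^ i)" using h'(4) by simp
      thus "y \<in> h ` mu p" using c_order(1) by (auto intro: mu_power)
    qed
  qed
  hence g: "h \<in> carrier (Gp p)" using h' unfolding Gp_iff
    by (auto simp: bij_betw_def hom_def mu_group_simps)
  moreover have "Q.successor (ext0 h x) = ext0 h (P.successor x)" if x: "x \<in> Mp p" for x
  proof -
    let ?y = "P.successor x"
    have y: "?y \<in> Mp p" "P.cg ?y (x + 1)" using P.successor[OF x] by auto
    have transfer: "ipoly f (h z) \<in> Q" if z: "z = c k" and f: "ipoly f z \<in> P" for f z k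
    proof -
      have "h z = b k" using h'(4)[rule_format, of k 1] z by simp
      thus ?thesis using b(2)[of k] f z by (simp add: specializes_def)
    qed
    \<comment> \<open>From some level on, z is a polynomial in the generator, and h acts by moving
      the generator. So x and its successor can be expressed at one common level, where the
      congruence between them is a single relation.\<close>
    have rep: "\<exists>k. \<forall>l\<ge>k. \<exists>f. z = ipoly f (c l) \<and> ext0 h z = ipoly f (h (c l))" if "z \<in> Mp p" for z
    proof (cases "z = 0")
      case True
      thus ?thesis by (intro exI[of _ 0] allI impI) simp
    next
      case False
      hence zm: "z \<in> mu p" by (rule Mp_mu[OF that])
      obtain k i where z: "z = c k ^ i" using mu_tower_exhausts[OF p1 c zm] by blast
      have "\<exists>f. z = ipoly f (c l) \<and> ext0 h z = ipoly f (h (c l))" if kl: "l \<ge> k" for l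
      proof -
        have "c l ^ (level p l div level p k) = c k"
          using mu_group.tower_descend[OF c p1 kl] by (simp add: mu_group_pow)
        hence "z = c l ^ (level p l div level p k * i)" unfolding z by (simp add: power_mult)
        thus ?thesis using Gp_power_apply[OF g c_order(1)] ext0_mu[OF zm]
          by (intro exI[of _ "monom 1 (level p l div level p k * i)"]) simp
      qed
      thus ?thesis by blast
    qed
    obtain k1 where k1: "\<And>l. l \<ge> k1 \<Longrightarrow> \<exists>f. x = ipoly f (c l) \<and> ext0 h x = ipoly f (h (c l))"
      using rep[OF x] by blast
    obtain k2 where k2: "\<And>l. l \<ge> k2 \<Longrightarrow> \<exists>f. ?y = ipoly f (c l) \<and> ext0 h ?y = ipoly f (h (c l))"
      using rep[OF y(1)] by blast
    let ?l = "max k1 k2"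
    obtain f1 where f1: "x = ipoly f1 (c ?l)" "ext0 h x = ipoly f1 (h (c ?l))"
      using k1[of ?l] by auto
    obtain f2 where f2: "?y = ipoly f2 (c ?l)" "ext0 h ?y = ipoly f2 (h (c ?l))"
      using k2[of ?l] by auto
    have "x + 1 - ?y \<in> P" using P.cg_sym[OF y(2)] by (simp add: P.cg_def)
    hence "ipoly (f1 + 1 - f2) (c ?l) \<in> P" by (simp only: ipoly_diff ipoly_add ipoly_1 f1(1)[symmetric] f2(1)[symmetric])
    hence "ipoly (f1 + 1 - f2) (h (c ?l)) \<in> Q" by (rule transfer[OF refl])
    hence "Q.cg (ext0 h x + 1) (ext0 h ?y)" by (simp add: f1(2) f2(2) Q.cg_def)
    thus ?thesis by (rule Q.successor_eq[OF ext0_closed[OF g x] ext0_closed[OF g y(1)]])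
  qed
  ultimately show ?thesis by blast
qed

end

section \<open>Automorphisms commuting with a successor map\<close>

context successor_map
begin

text \<open>As addition is expressed through s and multiplication, these are the automorphisms whose
  extension by 0 is a field automorphism of \<open>K\<close>.\<close>

definition centralizer :: "('c \<Rightarrow> 'c) set" where
  "centralizer = {g \<in> carrier (Gp p). \<forall>x\<in>Mp p. s (ext0 g x) = ext0 g (s x)}"

context
  fixes g assumes g: "g \<in> centralizer"
begin

lemma gG: "g \<in> carrier (Gp p)" and g_comm: "x \<in> Mp p \<Longrightarrow> s (ext0 g x) = ext0 g (s x)"
  using g by (auto simp: centralizer_def)

lemma ext0_K_add:
  assumes "x \<in> Mp p" "y \<in> Mp p"
  shows "ext0 g (x \<oplus>\<^bsub>K\<^esub> y) = ext0 g x \<oplus>\<^bsub>K\<^esub> ext0 g y"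
proof (cases "y = 0")
  case False
  have xy: "x / y \<in> Mp p" using assms by (rule Mp_divide)
  have "ext0 g (y * s (x / y)) = ext0 g y * s (ext0 g x / ext0 g y)"
    using ext0_mult[OF gG assms(2) s_Mp[OF xy]] g_comm[OF xy] ext0_divide[OF gG assms] by simp
  thus ?thesis using False ext0_eq_0[OF gG assms(2)] by (simp add: K_add)
qed simp

lemma s_inj: "x \<in> Mp p \<Longrightarrow> y \<in> Mp p \<Longrightarrow> s x = s y \<Longrightarrow> x = y"
proof -
  assume xy: "x \<in> Mp p" "y \<in> Mp p" "s x = s y"
  obtain n where n: "p = Suc n" using p_pos by (cases p) auto
  have "(s ^^ p) z = (s ^^ n) (s z)" for z by (simp add: n funpow_swap1)
  thus "x = y" using s_iter[OF xy(1)] s_iter[OF xy(2)] xy(3) by metis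
qed

lemma ext0_kint: "ext0 g (K.kint a) = K.kint a"
proof -
  have m: "K.kint a \<in> Mp p" for a using K.kint_closed[of a] by simp
  have suc: "K.kint (a + 1) = s (K.kint a)" for a using K.kint_add[of a 1] by (simp add: K_add_1)
  show ?thesis
  proof (induction a rule: int_induct[where k = 0])
    case base
    then show ?case using K.kint_0 by simp
  next
    case (step1 i)
    have "ext0 g (s (K.kint i)) = s (ext0 g (K.kint i))" by (rule g_comm[OF m, symmetric])
    then show ?case unfolding suc step1.IH .
  next
    case (step2 i)
    have "s (ext0 g (K.kint (i - 1))) = ext0 g (s (K.kint (i - 1)))" by (rule g_comm[OF m])
    also have "s (K.kint (i - 1)) = K.kint i" using suc[of "i - 1"] by simp
    also have "ext0 g (K.kint i) = s (K.kint (i - 1))" using suc[of "i - 1"] step2.IH by simp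
    finally show ?case by (rule s_inj[OF ext0_closed[OF gG m] m])
  qed
qed

lemma ext0_iev:
  assumes "x \<in> mu p"
  shows "ext0 g (K.iev f x) = K.iev f (g x)"
proof (induction f)
  case 0
  show ?case using K.iev_0[of x] K.iev_0[of "g x"] by simp
next
  case (pCons a f)
  have x: "x \<in> carrier K" "g x \<in> carrier K" using assms Gp_closed[OF gG] by auto
  have m: "K.kint a \<in> Mp p" "K.iev f x \<in> Mp p" using K.kint_closed[of a] iev_Mp x by simp_all
  have "ext0 g (K.kint a \<oplus>\<^bsub>K\<^esub> x * K.iev f x) = K.kint a \<oplus>\<^bsub>K\<^esub> g x * K.iev f (g x)"
    using ext0_K_add[OF m(1) Mp_mult[OF MpI[OF assms] m(2)]] ext0_mult[OF gG MpI[OF assms] m(2)]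
      ext0_kint ext0_mu[OF assms] pCons.IH by simp
  thus ?case using K.iev_pCons[OF x(1), of a f] K.iev_pCons[OF x(2), of a f] by simp
qed

end

end

context prime_over
begin

interpretation sm: successor_map p successor
  by unfold_locales (rule prime_p, rule successor_in_Sigma)

text \<open>By \<open>cg_iev\<close> a value lies in P exactly when the corresponding value in the
  field on \<open>Mp p\<close> is 0, and field automorphisms preserve the latter.\<close>

lemma centralizer_specializes:
  assumes g: "g \<in> sm.centralizer" and x: "x \<in> mu p"
  shows "specializes P P x (g x)"
proof -
  have gx: "g x \<in> mu p" by (rule Gp_closed[OF sm.gG[OF g] x])
  have iff: "ipoly f y \<in> P \<longleftrightarrow> sm.K.iev f y = 0" if y: "y \<in> mu p" for f y
  proof -
    have "ipoly f y \<in> P \<longleftrightarrow> sm.K.iev f y \<in> P" by (rule cg_mem[OF cg_sym[OF cg_iev[OF y]]])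
    also have "\<dots> \<longleftrightarrow> sm.K.iev f y = 0"
      using sm.iev_Mp[OF MpI[OF y], of f] mu_notin_P Mp_mu by force
    finally show ?thesis .
  qed
  show ?thesis unfolding specializes_def
    using sm.ext0_iev[OF g x] by (metis ext0_simps(1) iff[OF x] iff[OF gx])
qed

text \<open>Finitely many roots of unity are powers of a single c, and g moves c by a power of
  Frobenius. The exponent varies with T, so g is only a limit of powers of Frobenius.\<close>

lemma centralizer_frobenius:
  assumes g: "g \<in> sm.centralizer" and T: "finite T" "T \<subseteq> mu p"
  shows "\<exists>i. \<forall>x\<in>T. g x = x ^ (p ^ i)"
proof -
  have gG: "g \<in> carrier (Gp p)" by (rule sm.gG[OF g])
  have "\<exists>n. n > 0 \<and> coprime n p \<and> x ^ n = 1" if "x \<in> T" for x using that T(2) by (auto simp: mu_def)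
  then obtain n where n: "\<And>x. x \<in> T \<Longrightarrow> n x > 0 \<and> coprime (n x) p \<and> x ^ n x = 1" by metis
  define N where "N = prod n T"
  have N: "N > 0" "coprime N p" using n T(1) by (auto simp: N_def intro: prod_pos prod_coprime_left)
  obtain c :: 'c where c: "primroot N c" using primroot_exists[OF N(1)] by blast
  have cm: "c \<in> mu p" using c N by (intro muI[of N]) (simp_all add: primrootD)
  obtain i where i: "g c = c ^ (p ^ i)"
    using specializes_imp_frobenius[OF cm Gp_closed[OF gG cm] centralizer_specializes[OF g cm]] by blast
  have "g x = x ^ (p ^ i)" if "x \<in> T" for x
  proof -
    have "n x dvd N" unfolding N_def using that T(1) by (rule dvd_prodI[rotated])
    hence "x ^ N = 1" using n[OF that] by (auto simp: power_mult elim!: dvdE)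
    then obtain j where j: "x = c ^ j" using primroot_generates[OF c N(1)] by metis
    show ?thesis unfolding j Gp_power_apply[OF gG cm] i by (simp add: mult.commute flip: power_mult)
  qed
  thus ?thesis by blast
qed

end

lemma frob_in_Gp:
  assumes p: "prime p"
  shows "frob p \<in> carrier (Gp p :: ('c::{alg_closed_field,field_char_0} \<Rightarrow> 'c) monoid)"
  unfolding Gp_iff
proof (intro conjI ballI)
  show "frob p \<in> extensional (mu p :: 'c set)" by (simp add: frob_def)
  have p0: "p > 0" using p by (rule prime_gt_0_nat)
  have "inj_on (frob p) (mu p :: 'c set)"
    using mu_power_inj[of _ p _ 1] by (auto simp: frob_def intro!: inj_onI)
  moreover have "frob p ` mu p = (mu p :: 'c set)"
  proof
    show "frob p ` mu p \<subseteq> (mu p :: 'c set)" by (auto simp: frob_def mu_power)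
    show "(mu p :: 'c set) \<subseteq> frob p ` mu p"
    proof
      fix x :: 'c assume x: "x \<in> mu p"
      obtain n where n: "n > 0" "coprime n p" "x ^ n = 1" using x by (rule muE)
      obtain K where K: "K > 0" "[p ^ K = 1] (mod n)" using exists_frobenius_fixing[OF n(1,2)] .
      have "(x ^ (p ^ (K - 1))) ^ p = x ^ (p ^ K)"
        unfolding power_mult[symmetric] power_minus_mult[OF K(1)] ..
      also have "\<dots> = x" by (rule frobenius_fixes[OF K(2) p0 n(3)])
      finally have "x = (x ^ (p ^ (K - 1))) ^ p" ..
      thus "x \<in> frob p ` mu p" using mu_power[OF x] by (force simp: frob_def)
    qed
  qed
  ultimately show "bij_betw (frob p) (mu p) (mu p :: 'c set)" by (simp add: bij_betw_def)
qed (simp add: frob_def mu_mult power_mult_distrib)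

lemma frob_pow_apply:
  assumes p: "prime p" and x: "x \<in> mu p"
  shows "(frob p [^]\<^bsub>Gp p\<^esub> (i::nat)) x = (x::'c::{alg_closed_field,field_char_0}) ^ (p ^ i)"
proof (induction i)
  case 0
  then show ?case using x by (simp add: Gp_one)
next
  case (Suc i)
  interpret group "Gp p :: ('c \<Rightarrow> 'c) monoid" by (rule group_Gp)
  have f: "frob p \<in> carrier (Gp p :: ('c \<Rightarrow> 'c) monoid)" by (rule frob_in_Gp[OF p])
  have "(frob p [^]\<^bsub>Gp p\<^esub> Suc i) x = (frob p [^]\<^bsub>Gp p\<^esub> i) (frob p x)"
    using Gp_mult[OF nat_pow_closed[OF f, of i] f] x by (simp add: compose_def)
  also have "frob p x = x ^ p" using x by (simp add: frob_def)
  also have "(frob p [^]\<^bsub>Gp p\<^esub> i) (x ^ p) = (x ^ (p ^ i)) ^ p"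
    unfolding Gp_power_apply[OF nat_pow_closed[OF f] x] Suc ..
  finally show ?case by (simp add: mult.commute flip: power_mult)
qed

section \<open>The centralizer as the closed subgroup generated by Frobenius\<close>

context successor_map
begin

lemma Gp_topspace: "topspace (Gp_topology p :: ('c \<Rightarrow> 'c) topology) = carrier (Gp p)"
proof -
  have "carrier (Gp p :: ('c \<Rightarrow> 'c) monoid) \<subseteq> (\<Pi>\<^sub>E x\<in>mu p. mu p)"
  proof
    fix g :: "'c \<Rightarrow> 'c" assume g: "g \<in> carrier (Gp p)"
    hence "g \<in> extensional (mu p)" unfolding Gp_iff by blast
    thus "g \<in> (\<Pi>\<^sub>E x\<in>mu p. mu p)" unfolding PiE_iff using Gp_closed[OF g] by blast
  qed
  thus ?thesis
    unfolding Gp_topology_def topspace_subtopology topspace_product_topology topspace_discrete_topology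
    by (rule Int_absorb1)
qed

text \<open>The condition involves only the values of g at x and at s x, and evaluation at a point
  is continuous into a discrete space.\<close>

lemma closedin_agree:
  assumes x: "x \<in> Mp p"
  shows "closedin (Gp_topology p) {g \<in> carrier (Gp p). s (ext0 g x) = ext0 g (s x)}"
proof -
  have ev: "continuous_map (Gp_topology p) (discrete_topology (Mp p)) (\<lambda>g. ext0 g y)" if y: "y \<in> Mp p" for y
  proof (cases "y = 0")
    case False
    hence ym: "y \<in> mu p" by (rule Mp_mu[OF y])
    have "continuous_map (Gp_topology p) (discrete_topology (mu p)) (\<lambda>g. g y)"
      unfolding Gp_topology_def
      by (intro continuous_map_from_subtopology continuous_map_product_projection ym)
    moreover have "continuous_map (discrete_topology (mu p)) (discrete_topology (Mp p)) (\<lambda>z. z)"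
      by (auto simp: MpI)
    ultimately have "continuous_map (Gp_topology p) (discrete_topology (Mp p)) ((\<lambda>z. z) \<circ> (\<lambda>g. g y))"
      by (rule continuous_map_compose)
    thus ?thesis using False by (simp add: o_def)
  qed simp
  have sc: "continuous_map (Gp_topology p) (discrete_topology (Mp p)) (s \<circ> (\<lambda>g. ext0 g x))"
    by (rule continuous_map_compose[OF ev[OF x]]) (auto simp: s_Mp)
  have "closedin (Gp_topology p)
     {g \<in> topspace (Gp_topology p). (s \<circ> (\<lambda>g. ext0 g x)) g = ext0 g (s x)}"
    by (rule closedin_continuous_maps_eq[OF _ sc ev[OF s_Mp[OF x]]]) simp
  thus ?thesis by (simp add: Gp_topspace)
qed

lemma centralizer_subgroup: "subgroup centralizer (Gp p)"
proof -
  interpret group "Gp p :: ('c \<Rightarrow> 'c) monoid" by (rule group_Gp)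
  have ext0_mult': "ext0 (g \<otimes>\<^bsub>Gp p\<^esub> h) x = ext0 g (ext0 h x)"
    if "g \<in> carrier (Gp p)" "h \<in> carrier (Gp p)" "x \<in> Mp p" for g h and x :: 'c
    using that Gp_closed[OF that(2), of x] by (auto simp: Gp_mult ext0_def compose_def Mp_def)
  have ext0_one: "ext0 \<one>\<^bsub>Gp p\<^esub> x = x" if "x \<in> Mp p" for x :: 'c
    using that by (auto simp: Gp_one ext0_def Mp_def)
  show ?thesis
  proof (rule subgroupI)
    show "centralizer \<subseteq> carrier (Gp p)" by (auto simp: centralizer_def)
    have "\<one>\<^bsub>Gp p\<^esub> \<in> centralizer" by (simp add: centralizer_def ext0_one s_Mp)
    thus "centralizer \<noteq> {}" by blast
  next
    fix g assume g: "g \<in> centralizer"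
    have gG: "g \<in> carrier (Gp p)" "inv\<^bsub>Gp p\<^esub> g \<in> carrier (Gp p)" using gG[OF g] by auto
    let ?h = "inv\<^bsub>Gp p\<^esub> g"
    have "s (ext0 ?h x) = ext0 ?h (s x)" if x: "x \<in> Mp p" for x
    proof -
      have hx: "ext0 ?h x \<in> Mp p" by (rule ext0_closed[OF gG(2) x])
      have "ext0 g (s (ext0 ?h x)) = s (ext0 g (ext0 ?h x))" using g_comm[OF g hx] by simp
      also have "ext0 g (ext0 ?h x) = x" using ext0_mult'[OF gG x] ext0_one[OF x] gG by simp
      also have "s x = ext0 g (ext0 ?h (s x))"
        using ext0_mult'[OF gG s_Mp[OF x]] ext0_one[OF s_Mp[OF x]] gG by simp
      finally show ?thesis
        using ext0_inj[OF gG(1) s_Mp[OF hx] ext0_closed[OF gG(2) s_Mp[OF x]]] by blast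
    qed
    thus "?h \<in> centralizer" using gG by (simp add: centralizer_def)
  next
    fix g h assume gh: "g \<in> centralizer" "h \<in> centralizer"
    have G: "g \<in> carrier (Gp p)" "h \<in> carrier (Gp p)" using gh by (auto simp: centralizer_def)
    have "s (ext0 (g \<otimes>\<^bsub>Gp p\<^esub> h) x) = ext0 (g \<otimes>\<^bsub>Gp p\<^esub> h) (s x)" if x: "x \<in> Mp p" for x
      using g_comm[OF gh(1) ext0_closed[OF G(2) x]] g_comm[OF gh(2) x]
      by (simp add: ext0_mult'[OF G x] ext0_mult'[OF G s_Mp[OF x]])
    thus "g \<otimes>\<^bsub>Gp p\<^esub> h \<in> centralizer" using G by (simp add: centralizer_def)
  qed
qed

text \<open>Modulo the kernel, s is addition of 1, and the p-th power map is additive there and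
  fixes 1.\<close>

lemma frob_centralizer: "frob p \<in> centralizer"
proof -
  have "s (ext0 (frob p) x) = ext0 (frob p) (s x)" if x: "x \<in> Mp p" for x
  proof -
    have e: "ext0 (frob p) y = y ^ p" if "y \<in> Mp p" for y :: 'c
      using that p_pos by (auto simp: ext0_def frob_def Mp_def power_0_left)
    have "ker.cg (s x) (x + 1)" using ker.successor(2)[OF x] by (simp add: ker_successor)
    hence "ker.cg (s x ^ p) ((x + 1) ^ p)"
      using x s_Mp[OF x] by (intro ker.cg_power) (auto intro: Mp_cycint cycint_add)
    also have "ker.cg ((x + 1) ^ (p ^ 1)) (x ^ (p ^ 1) + 1 ^ (p ^ 1))"
      using x by (intro ker.cg_freshman) (auto intro: Mp_cycint)
    hence "ker.cg ((x + 1) ^ p) (x ^ p + 1)" by simp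
    finally have "ker.cg (x ^ p + 1) (s x ^ p)" by (rule ker.cg_sym)
    from ker.successor_eq[OF Mp_power[OF x] Mp_power[OF s_Mp[OF x]] this]
    show ?thesis using x s_Mp[OF x] by (simp add: e ker_successor)
  qed
  thus ?thesis by (simp add: centralizer_def frob_in_Gp[OF prime_p])
qed

text \<open>The centralizer is one of the closed subgroups containing Frobenius. Conversely, a basic
  neighbourhood of an element g of the centralizer restricts only finitely many values, on which g
  agrees with a power of Frobenius; so no closed subgroup containing Frobenius can omit g.\<close>

theorem frob_group_eq_centralizer: "carrier (frob_group p) = centralizer"
proof
  have ne: "(Mp p :: 'c set) \<noteq> {}" using Mp_1 by blast
  have "closedin (Gp_topology p) (\<Inter>x\<in>Mp p. {g \<in> carrier (Gp p). s (ext0 g x) = ext0 g (s x)})"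
    by (rule closedin_INT[OF ne closedin_agree])
  also have "(\<Inter>x\<in>Mp p. {g \<in> carrier (Gp p). s (ext0 g x) = ext0 g (s x)}) = centralizer"
    using ne by (auto simp: centralizer_def)
  finally show "carrier (frob_group p) \<subseteq> centralizer"
    using centralizer_subgroup frob_centralizer by (auto simp: frob_group_def)
  show "centralizer \<subseteq> carrier (frob_group p)"
  proof
    fix g assume g: "g \<in> centralizer"
    have gG: "g \<in> carrier (Gp p)" by (rule gG[OF g])
    have "g \<in> H" if H: "subgroup H (Gp p)" "closedin (Gp_topology p) H" "frob p \<in> H" for H
    proof (rule ccontr)
      assume "g \<notin> H"
      let ?X = "product_topology (\<lambda>_. discrete_topology (mu p)) (mu p) :: ('c \<Rightarrow> 'c) topology"
      have "openin (Gp_topology p) (topspace (Gp_topology p) - H)" using H(2) by blast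
      then obtain W where W: "openin ?X W" "topspace (Gp_topology p) - H = W \<inter> carrier (Gp p)"
        unfolding Gp_topology_def openin_subtopology by blast
      have "g \<in> W" using gG \<open>g \<notin> H\<close> W(2) by (auto simp: Gp_topspace)
      then obtain U where U: "finite {i \<in> mu p. U i \<noteq> mu p}" "g \<in> PiE (mu p) U" "PiE (mu p) U \<subseteq> W"
        using W(1) unfolding openin_product_topology_alt by auto
      have "\<exists>i. \<forall>x\<in>{i \<in> mu p. U i \<noteq> mu p}. g x = x ^ (p ^ i)"
        using ker.centralizer_frobenius[unfolded ker_successor, OF g U(1)] by auto
      then obtain i where i: "\<And>x. x \<in> mu p \<Longrightarrow> U x \<noteq> mu p \<Longrightarrow> g x = x ^ (p ^ i)" by auto
      let ?f = "frob p [^]\<^bsub>Gp p\<^esub> i :: 'c \<Rightarrow> 'c"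
      interpret H: subgroup H "Gp p" by (rule H(1))
      interpret group "Gp p :: ('c \<Rightarrow> 'c) monoid" by (rule group_Gp)
      have fH: "?f \<in> H"
      proof (induction i)
        case (Suc i)
        then show ?case using H.m_closed[OF Suc.IH H(3)] by simp
      qed simp
      hence fG: "?f \<in> carrier (Gp p)" by (rule H.mem_carrier)
      have "?f x \<in> U x" if x: "x \<in> mu p" for x
      proof (cases "U x = mu p")
        case True
        thus ?thesis using Gp_closed[OF fG x] by simp
      next
        case False
        hence "?f x = g x" using i[OF x] frob_pow_apply[OF prime_p x] by simp
        thus ?thesis using U(2) x by (auto simp: PiE_iff)
      qed
      hence "?f \<in> PiE (mu p) U" using fG by (auto simp: PiE_iff Gp_iff)
      hence "?f \<in> W" using U(3) by blast
      hence "?f \<notin> H" using W(2) fG by blast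
      thus False using fH by blast
    qed
    thus "g \<in> carrier (frob_group p)" by (auto simp: frob_group_def)
  qed
qed

end

section \<open>The multiplicative group of an algebraic closure of the prime field\<close>

context domain
begin

lemma nat_pow_eq_0: "x \<in> carrier R \<Longrightarrow> x [^] (n::nat) = \<zero> \<Longrightarrow> x = \<zero>"
  by (induction n) (auto simp: integral_iff)

text \<open>List polynomials carry the leading coefficient first, hence the reversal. The
  translation makes root counts and the splitting of polynomials over F available for
  \<open>iev\<close>.\<close>

lemma iev_eq_eval: "x \<in> carrier R \<Longrightarrow> eval (map kint (rev (coeffs f))) x = iev f x"
proof (induction f)
  case (pCons a f)
  have "set (map kint (rev (coeffs f))) \<subseteq> carrier R" by auto
  from eval_append_aux[OF this kint_closed pCons.prems, of a] show ?case
    using pCons by (simp add: cCons_def m_comm a_comm)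
qed simp

lemma monic_polynomial:
  assumes "Polynomial.lead_coeff f = 1"
  shows "map kint (rev (coeffs f)) \<in> carrier (poly_ring R)"
    and "length (map kint (rev (coeffs f))) = Suc (Polynomial.degree f)"
    and "map kint (rev (coeffs f)) \<noteq> []"
proof -
  have f: "f \<noteq> 0" using assms by auto
  show "length (map kint (rev (coeffs f))) = Suc (Polynomial.degree f)"
    using f by (simp add: length_coeffs_degree)
  show ne: "map kint (rev (coeffs f)) \<noteq> []" using f by simp
  have "hd (rev (coeffs f)) = 1" using f assms by (simp add: hd_rev last_coeffs_eq_coeff_degree)
  hence "hd (map kint (rev (coeffs f))) = \<one>" using f by (simp add: hd_map)
  thus "map kint (rev (coeffs f)) \<in> carrier (poly_ring R)"
    using ne by (auto simp: polynomial_def simp flip: univ_poly_carrier)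
qed

end

lemma card_set_mset_le_size: "card (set_mset A) \<le> size A"
  by (induction A) (auto intro: order.trans[OF card_insert_le_m1] simp: card_insert_if)

lemma (in field) iev_card_roots:
  assumes f: "Polynomial.lead_coeff f = 1" and S: "finite S" "\<And>x. x \<in> S \<Longrightarrow> x \<in> carrier R \<and> iev f x = \<zero>"
  shows "card S \<le> Polynomial.degree f"
proof -
  let ?P = "map kint (rev (coeffs f))"
  have "S \<subseteq> set_mset (roots ?P)"
    using S(2) roots_mem_iff_is_root[OF monic_polynomial(1)[OF f]] monic_polynomial(3)[OF f]
    by (auto simp: is_root_def iev_eq_eval)
  hence "card S \<le> card (set_mset (roots ?P))" by (intro card_mono) auto
  also have "\<dots> \<le> size (roots ?P)" by (rule card_set_mset_le_size)
  also have "\<dots> \<le> length ?P - 1" by (rule size_roots_le_degree[OF monic_polynomial(1)[OF f]])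
  finally show ?thesis using monic_polynomial(2)[OF f] by simp
qed

lemma (in algebraically_closed) iev_root_exists:
  assumes f: "Polynomial.lead_coeff f = 1" and d: "Polynomial.degree f > 0"
  shows "\<exists>x\<in>carrier L. iev f x = \<zero>"
proof -
  let ?P = "map kint (rev (coeffs f))"
  have "size (roots ?P) = length ?P - 1"
    using roots_over_carrier[OF monic_polynomial(1)[OF f]] by (simp add: splitted_def)
  hence "roots ?P \<noteq> {#}" using monic_polynomial(2)[OF f] d by auto
  then obtain x where "x \<in># roots ?P" by blast
  thus ?thesis using roots_mem_iff_is_root[OF monic_polynomial(1)[OF f]]
    by (auto simp: is_root_def iev_eq_eval)
qed

abbreviation units_monoid :: "('a, 'm) ring_scheme \<Rightarrow> 'a monoid" where
  "units_monoid F \<equiv> Ring_Divisibility.mult_of F"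

lemma units_monoid_pow: "x [^]\<^bsub>units_monoid F\<^esub> (n::nat) = x [^]\<^bsub>F\<^esub> n"
  by (simp add: nat_pow_def)

lemma (in field) comm_group_units_monoid: "comm_group (units_monoid R)"
proof -
  have "units_monoid R = Multiplicative_Group.mult_of R"
    by (simp add: Ring_Divisibility.mult_of_def Multiplicative_Group.mult_of_def)
  moreover have "comm_group (Multiplicative_Group.mult_of R)"
    using m_comm by (intro group.group_comm_groupI[OF field_mult_group]) auto
  ultimately show ?thesis by (simp only:)
qed

locale prime_field_closure = algebraic_closure F Fp
  for F :: "('a, 'm) ring_scheme" (structure) and Fp and p :: nat +
  assumes prime_p: "prime p" and card_Fp: "card Fp = p"
begin

abbreviation M where "M \<equiv> units_monoid F"

sublocale M: comm_group M
  by (rule comm_group_units_monoid)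

lemma p_gt_1: "p > 1"
  by (rule prime_gt_1_nat[OF prime_p])

lemma M_carrier: "x \<in> carrier M \<longleftrightarrow> x \<in> carrier F \<and> x \<noteq> \<zero>"
  by auto

text \<open>Lagrange's theorem in the additive group of the prime field, which has p
  elements.\<close>

lemma kint_p: "kint (int p) = \<zero>"
proof -
  have sub: "subring Fp F" by (rule subfieldE(1)[OF subfield_axioms])
  have "group ((add_monoid F)\<lparr>carrier := Fp\<rparr>)"
    by (rule subgroup.subgroup_is_group[OF subring.axioms(1)[OF sub] a_group])
  moreover have "\<one> \<in> carrier ((add_monoid F)\<lparr>carrier := Fp\<rparr>)" using subringE(3)[OF sub] by simp
  ultimately have "\<one> [^]\<^bsub>(add_monoid F)\<lparr>carrier := Fp\<rparr>\<^esub> Coset.order ((add_monoid F)\<lparr>carrier := Fp\<rparr>) = \<zero>"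
    using group.pow_order_eq_1 by fastforce
  hence "\<one> [^]\<^bsub>add_monoid F\<^esub> p = \<zero>"
    by (simp add: Coset.order_def card_Fp nat_pow_def)
  thus ?thesis by (simp add: kint_def add_pow_def int_pow_int)
qed

text \<open>Evaluating at y the integral identity that relates X^p to (X - 1)^p + 1 modulo p gives
  (y - 1)^p = 0.\<close>

lemma frobenius_inj:
  assumes y: "y \<in> carrier F" and e: "y [^] p = \<one>"
  shows "y = \<one>"
proof -
  let ?X = "Polynomial.monom 1 1 :: int poly"
  obtain S where S: "((?X - 1) + 1) ^ p = (?X - 1) ^ p + 1 ^ p + of_nat p * S"
    using freshman[OF prime_p] by blast
  have "of_nat p * S = Polynomial.smult (int p) S" by (simp add: of_nat_poly)
  hence "?X ^ p = (?X - 1) ^ p + 1 + Polynomial.smult (int p) S" using S by simp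
  hence "iev (?X ^ p) y = iev ((?X - 1) ^ p + 1 + Polynomial.smult (int p) S) y" by (simp only:)
  hence "\<one> = (y \<ominus> \<one>) [^] p \<oplus> \<one>"
    using y e by (simp add: iev_power iev_add iev_diff iev_smult iev_monom kint_p)
  hence "(y \<ominus> \<one>) [^] p = \<zero>" using y by (simp add: add.r_cancel_one')
  hence "y \<ominus> \<one> = \<zero>" by (rule nat_pow_eq_0[rotated]) (use y in simp)
  thus ?thesis using y by simp
qed

lemma frobenius_power_inj:
  assumes y: "y \<in> carrier F" and e: "y [^] (p ^ k) = \<one>"
  shows "y = \<one>"
  using e
proof (induction k)
  case (Suc k)
  have "(y [^] (p ^ k)) [^] p = y [^] (p ^ Suc k)" unfolding nat_pow_pow[OF y] power_Suc2 ..
  also have "\<dots> = \<one>" by (rule Suc.prems)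
  finally have "(y [^] (p ^ k)) [^] p = \<one>" .
  hence "y [^] (p ^ k) = \<one>" by (rule frobenius_inj[OF nat_pow_closed[OF y]])
  thus ?case by (rule Suc.IH)
next
  case 0
  thus ?case using nat_pow_eone[OF y] by (simp only: power_0)
qed

text \<open>The element x lies in a finite extension of the finite field Fp, so two of its powers
  coincide. The p-part of the resulting exponent is removed by the injectivity of Frobenius.\<close>

lemma torsion:
  assumes x: "x \<in> carrier M"
  obtains n :: nat where "n > 0" "coprime n p" "x [^] n = \<one>"
proof -
  have xc: "x \<in> carrier F" "x \<noteq> \<zero>" using x by auto
  let ?E = "simple_extension Fp x"
  note K = subfield_axioms
  have sub: "subring Fp F" by (rule subfieldE(1)[OF K])
  have E: "subring ?E F" by (rule simple_extension_is_subring[OF sub xc(1)])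
  obtain Us where Us: "set Us \<subseteq> carrier F" "Span Fp Us = ?E"
    using exists_base[OF K dimension_simple_extension[OF K xc(1) algebraic_extension[OF xc(1)]]] by blast
  have "finite Fp" using card_Fp p_gt_1 by (auto intro: card_ge_0_finite)
  hence "finite {Ks. set Ks \<subseteq> Fp \<and> length Ks = length Us}" by (rule finite_lists_length_eq)
  moreover have "Span Fp Us = (\<lambda>Ks. combine Ks Us) ` {Ks. set Ks \<subseteq> Fp \<and> length Ks = length Us}"
    using Span_eq_combine_set_length_version[OF K Us(1)] by auto
  ultimately have fin: "finite ?E" unfolding Us(2)[symmetric] by (simp only: finite_imageI)
  have "x [^] i \<in> ?E" for i :: nat
    using subringE(3,6)[OF E] simple_extension_mem[OF sub xc(1)] by (induction i) auto
  hence "range (\<lambda>i::nat. x [^] i) \<subseteq> ?E" by blast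
  hence "\<not> inj (\<lambda>i::nat. x [^] i)" using fin finite_subset range_inj_infinite by blast
  then obtain a b :: nat where ab: "x [^] a = x [^] b" "a \<noteq> b"
    unfolding inj_def by blast
  define i j where "i = min a b" and "j = max a b"
  have ij: "x [^] i = x [^] j" "i < j" using ab by (auto simp: i_def j_def min_def max_def)
  have "x [^] i \<otimes> x [^] (j - i) = x [^] i \<otimes> \<one>"
    using nat_pow_mult[OF xc(1), of i "j - i"] ij(2) xc by (simp add: ij(1))
  moreover have "x [^] i \<noteq> \<zero>" using nat_pow_eq_0[OF xc(1)] xc(2) by blast
  ultimately have e: "x [^] (j - i) = \<one>"
    using m_lcancel[of "x [^] i" "x [^] (j - i)" \<one>] xc by blast
  have "j - i > 0" using ij by simp
  then obtain n k where n: "j - i = n * p ^ k" "n > 0" "coprime n p"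
    by (rule prime_decompose[OF prime_p])
  have "(x [^] n) [^] (p ^ k) = \<one>" using e xc n(1) by (simp add: nat_pow_pow)
  hence "x [^] n = \<one>" by (rule frobenius_power_inj[OF nat_pow_closed[OF xc(1)]])
  thus ?thesis using that n by blast
qed

lemma generates:
  assumes n: "n > 0" and y: "mult_of.has_order y n" and x: "x \<in> carrier M" "x [^]\<^bsub>M\<^esub> (n::nat) = \<one>\<^bsub>M\<^esub>"
  shows "\<exists>i::nat. x = y [^]\<^bsub>M\<^esub> i"
proof (rule ccontr)
  assume ne: "\<not> (\<exists>i::nat. x = y [^]\<^bsub>M\<^esub> i)"
  let ?f = "Polynomial.monom 1 n - 1 :: int poly"
  have d: "Polynomial.degree ?f = n"
    using n by (intro antisym degree_diff_le le_degree) (auto simp: degree_monom_eq)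
  hence f: "Polynomial.lead_coeff ?f = 1" using n by simp
  let ?S = "insert x ((\<lambda>i::nat. y [^]\<^bsub>M\<^esub> i) ` {..<n})"
  have yc: "y \<in> carrier M" using y by (simp add: mult_of.has_order_def)
  have "card ?S \<le> n"
  proof (rule iev_card_roots[OF f, unfolded d])
    fix z assume "z \<in> ?S"
    moreover have "(y [^]\<^bsub>M\<^esub> i) [^]\<^bsub>M\<^esub> n = \<one>\<^bsub>M\<^esub>" for i :: nat
      using y yc unfolding mult_of.has_order_def by (simp add: mult_of.nat_pow_pow)
    ultimately have z: "z \<in> carrier M" "z [^]\<^bsub>M\<^esub> n = \<one>\<^bsub>M\<^esub>"
      using x mult_of.nat_pow_closed[OF yc] by blast+
    thus "z \<in> carrier F \<and> iev ?f z = \<zero>"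
      by (simp add: units_monoid_pow iev_diff iev_monom)
  qed simp
  moreover have "inj_on (\<lambda>i::nat. y [^]\<^bsub>M\<^esub> i) {..<n}"
    by (rule inj_onI) (simp add: M.has_order_pow_eq[OF y] cong_def)
  hence "card ?S = Suc n" using ne by (subst card_insert_disjoint) (auto simp: card_image)
  ultimately show False by simp
qed

lemma exists_order:
  assumes n: "n > 0" "coprime n p"
  shows "\<exists>x. mult_of.has_order x n"
proof -
  have "\<exists>x\<in>carrier M. M.ord x = n"
  proof (rule M.exists_ord[OF n(1)])
    fix l k :: nat assume l: "prime l" "l dvd n"
    have l1: "l > 1" by (rule prime_gt_1_nat[OF l(1)])
    \<comment> \<open>Again the quotient of X^(l^(k+1)) - 1 by X^(l^k) - 1. Here a root with x^(l^k)
      = 1 is excluded because the sum would be l, and l is invertible modulo p as a divisor of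
      n.\<close>
    define f where "f = (\<Sum>i<l. Polynomial.monom 1 (l ^ k * i) :: int poly)"
    let ?d = "l ^ k * (l - 1)"
    have d0: "?d > 0" using l1 by simp
    have "poly.coeff f ?d = (\<Sum>i<l. if i = l - 1 then 1 else 0)"
      unfolding f_def coeff_sum using l1 by (intro sum.cong) auto
    also have "\<dots> = 1" using l1 by simp
    finally have c: "poly.coeff f ?d = 1" .
    have "Polynomial.degree f \<le> ?d" unfolding f_def
      by (intro degree_sum_le) (auto intro: order.trans[OF degree_monom_le])
    hence df: "Polynomial.degree f = ?d" using c le_degree[of f ?d] by simp
    obtain x where x: "x \<in> carrier F" "iev f x = \<zero>"
      using iev_root_exists[of f] c df d0 by auto
    let ?y = "x [^] (l ^ k)"
    have y1: "?y \<noteq> \<one>"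
    proof
      assume "?y = \<one>"
      hence lz: "kint (int l) = \<zero>" using x iev_geometric[of x "l ^ k" l] by (simp add: f_def)
      have "coprime l p" using n(2) l(2) by (rule coprime_divisors[rotated -1]) auto
      then obtain u v where uv: "u * int l + v * int p = 1" using bezout_int[of "int l" "int p"] by auto
      have "kint (u * int l + v * int p) = \<zero>" by (simp add: kint_add kint_mult lz kint_p)
      thus False unfolding uv by simp
    qed
    have "(Polynomial.monom 1 (l ^ k) - 1) * f = Polynomial.monom 1 (l ^ Suc k) - 1"
      using power_diff_1_eq[of "Polynomial.monom 1 (l ^ k) :: int poly" l]
      by (simp add: f_def monom_power mult.commute)
    hence "iev ((Polynomial.monom 1 (l ^ k) - 1) * f) x = iev (Polynomial.monom 1 (l ^ Suc k) - 1) x"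
      by (simp only:)
    hence "x [^] (l ^ Suc k) \<ominus> \<one> = \<zero>" using x by (simp add: iev_mult iev_diff iev_monom)
    hence xl: "x [^] (l ^ Suc k) = \<one>" using x by (simp del: power_Suc)
    have "x \<noteq> \<zero>"
    proof
      assume "x = \<zero>"
      moreover have "l ^ Suc k > 0" using l1 by simp
      ultimately show False using xl by (simp add: nat_pow_zero del: power_Suc)
    qed
    thus "\<exists>x\<in>carrier M. x [^]\<^bsub>M\<^esub> (l ^ Suc k) = \<one>\<^bsub>M\<^esub> \<and> x [^]\<^bsub>M\<^esub> (l ^ k) \<noteq> \<one>\<^bsub>M\<^esub>"
      using x(1) xl y1 by (intro bexI[of _ x]) (simp_all add: units_monoid_pow del: power_Suc)
  qed
  thus ?thesis using M.pow_eq_id by (auto simp: mult_of.has_order_def)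
qed

section \<open>The torsor of embeddings\<close>

lemma tower_exhausts:
  assumes c: "M.tower p c" and x: "x \<in> carrier M"
  shows "\<exists>k (i::nat). x = c k [^]\<^bsub>M\<^esub> i"
proof -
  obtain n :: nat where n: "n > 0" "coprime n p" "x [^] n = \<one>" using torsion[OF x] .
  obtain k where "n dvd level p k" using dvd_level[OF n(2,1)] p_gt_1 by auto
  then obtain d where d: "level p k = n * d" by (elim dvdE)
  have "(x [^]\<^bsub>M\<^esub> n) [^]\<^bsub>M\<^esub> d = \<one>\<^bsub>M\<^esub>" using n(3) by (simp add: units_monoid_pow)
  hence "x [^]\<^bsub>M\<^esub> level p k = \<one>\<^bsub>M\<^esub>" unfolding d using x by (simp add: mult_of.nat_pow_pow)
  moreover have "mult_of.has_order (c k) (level p k)" using c by (simp add: M.tower_def)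
  ultimately show ?thesis using generates[OF level_pos[OF p_gt_1]] x by metis
qed

abbreviation embeddings :: "('a \<Rightarrow> 'c::{alg_closed_field,field_char_0}) set" where "embeddings \<equiv> X_set F"

text \<open>The image is exactly \<open>mu p\<close>: units of F are torsion of order prime to p,
  and for each such n there is a unit of order n, whose image generates the n-th roots of unity by
  injectivity.\<close>

lemma embeddingD:
  assumes "\<phi> \<in> (embeddings :: ('a \<Rightarrow> 'c::{alg_closed_field,field_char_0}) set)"
  shows "\<phi> \<in> extensional (carrier M)" "bij_betw \<phi> (carrier M) (mu p)"
    "\<And>x y. x \<in> carrier M \<Longrightarrow> y \<in> carrier M \<Longrightarrow> \<phi> (x \<otimes> y) = \<phi> x * \<phi> y" "\<phi> \<one> = 1"
proof -
  have h: "\<phi> \<in> hom M (units_monoid Qcyc)" "inj_on \<phi> (carrier M)"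
    using assms by (auto simp: X_set_def mon_def)
  show "\<phi> \<in> extensional (carrier M)" using assms by (simp add: X_set_def)
  show mult: "\<phi> (x \<otimes> y) = \<phi> x * \<phi> y" if "x \<in> carrier M" "y \<in> carrier M" for x y
    using hom_mult[OF h(1) that] by (simp add: Qcyc_ops)
  have nz: "\<phi> x \<noteq> 0" if "x \<in> carrier M" for x
    using hom_in_carrier[OF h(1) that] by (simp add: Qcyc_ops)
  have "\<phi> \<one> * \<phi> \<one> = \<phi> \<one>" using mult[of \<one> \<one>] by simp
  thus one: "\<phi> \<one> = 1" using nz[of \<one>] by simp
  have pow: "\<phi> (x [^] n) = \<phi> x ^ n" if "x \<in> carrier M" for x and n :: nat
  proof (induction n)
    case (Suc n)
    have "x [^] n \<in> carrier M" using mult_of.nat_pow_closed[OF that, of n] by (simp only: units_monoid_pow)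
    thus ?case using mult[OF _ that] Suc by simp
  qed (simp add: one)
  have "\<phi> ` carrier M = mu p"
  proof
    show "\<phi> ` carrier M \<subseteq> mu p"
    proof
      fix z assume "z \<in> \<phi> ` carrier M"
      then obtain x where x: "x \<in> carrier M" "z = \<phi> x" by blast
      obtain n :: nat where n: "n > 0" "coprime n p" "x [^] n = \<one>" using torsion[OF x(1)] .
      have "z ^ n = 1" using pow[OF x(1), of n] n(3) one x(2) by simp
      thus "z \<in> mu p" using n by (intro muI)
    qed
    show "mu p \<subseteq> \<phi> ` carrier M"
    proof
      fix z :: 'c assume "z \<in> mu p"
      then obtain n where n: "n > 0" "coprime n p" "z ^ n = 1" by (rule muE)
      obtain y where y: "mult_of.has_order y n" using exists_order[OF n(1,2)] by blast
      have yc: "y \<in> carrier M" using y by (simp add: mult_of.has_order_def)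
      have "\<phi> y ^ i = 1 \<longleftrightarrow> n dvd i" for i
      proof -
        have yi: "y [^]\<^bsub>M\<^esub> i \<in> carrier M" by (rule mult_of.nat_pow_closed[OF yc])
        have "\<phi> y ^ i = 1 \<longleftrightarrow> \<phi> (y [^]\<^bsub>M\<^esub> i) = \<phi> \<one>"
          using pow[OF yc, of i] by (simp add: units_monoid_pow one)
        also have "\<dots> \<longleftrightarrow> y [^]\<^bsub>M\<^esub> i = \<one>\<^bsub>M\<^esub>"
          using inj_on_eq_iff[OF h(2) yi mult_of.one_closed] by simp
        also have "\<dots> \<longleftrightarrow> n dvd i" using y by (simp add: mult_of.has_order_def)
        finally show ?thesis .
      qed
      hence "primroot n (\<phi> y)" by (simp add: primroot_def)
      then obtain i where "z = \<phi> y ^ i" using primroot_generates[OF _ n(1,3)] by metis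
      hence "z = \<phi> (y [^]\<^bsub>M\<^esub> i)" using pow[OF yc] by (simp add: units_monoid_pow)
      thus "z \<in> \<phi> ` carrier M" using mult_of.nat_pow_closed[OF yc, of i] by blast
    qed
  qed
  thus "bij_betw \<phi> (carrier M) (mu p)" using h(2) by (simp add: bij_betw_def)
qed

lemma mu_Qcyc: "x \<in> mu p \<Longrightarrow> x \<in> carrier (units_monoid (Qcyc :: 'c::{alg_closed_field,field_char_0} ring))"
  using cycint_Qcyc[OF mu_cycint] mu_nonzero by (auto simp: Qcyc_ops)

lemma embeddingI:
  assumes "\<phi> \<in> extensional (carrier M)" "bij_betw \<phi> (carrier M) (mu p)"
    "\<And>x y. x \<in> carrier M \<Longrightarrow> y \<in> carrier M \<Longrightarrow> \<phi> (x \<otimes> y) = \<phi> x * \<phi> y"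
  shows "\<phi> \<in> (embeddings :: ('a \<Rightarrow> 'c::{alg_closed_field,field_char_0}) set)"
proof -
  have "\<phi> \<in> hom M (units_monoid Qcyc)"
  proof (rule homI)
    fix x assume "x \<in> carrier M"
    thus "\<phi> x \<in> carrier (units_monoid Qcyc)" using bij_betw_apply[OF assms(2)] mu_Qcyc by blast
  next
    fix x y assume "x \<in> carrier M" "y \<in> carrier M"
    thus "\<phi> (x \<otimes>\<^bsub>M\<^esub> y) = \<phi> x \<otimes>\<^bsub>units_monoid Qcyc\<^esub> \<phi> y" using assms(3) by (simp add: Qcyc_ops)
  qed
  thus ?thesis using assms(1,2) by (simp add: X_set_def mon_def bij_betw_def)
qed

text \<open>A tower in the units of F is matched with a tower in \<open>mu p\<close>; both exhaust
  their groups.\<close>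

lemma embeddings_nonempty: "(embeddings :: ('a \<Rightarrow> 'c::{alg_closed_field,field_char_0}) set) \<noteq> {}"
proof -
  obtain c where c: "M.tower p c" using M.tower_exists[OF p_gt_1] generates exists_order by blast
  obtain b :: "nat \<Rightarrow> 'c" where b: "mu_group.tower p p b" using mu_tower_exists[OF p_gt_1] by blast
  obtain h where h: "h \<in> hom M (mu_group p)" "inj_on h (carrier M)" "h \<in> extensional (carrier M)"
    "\<forall>k i. h (c k [^]\<^bsub>M\<^esub> (i::nat)) = b k [^]\<^bsub>mu_group p\<^esub> i"
    by (rule tower_isomorphism[OF M.comm_group_axioms mu_group.comm_group_axioms p_gt_1 c b
          tower_exhausts[OF c]])
  have "h ` carrier M = mu p"
  proof
    show "h ` carrier M \<subseteq> mu p" using h(1) by (auto simp: hom_def mu_group_simps)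
    show "mu p \<subseteq> h ` carrier M"
    proof
      fix z :: 'c assume "z \<in> mu p"
      then obtain k i where "z = b k ^ i" using mu_tower_exhausts[OF p_gt_1 b] by blast
      hence "z = h (c k [^]\<^bsub>M\<^esub> i)" using h(4) by (simp add: mu_group_pow)
      thus "z \<in> h ` carrier M" using mult_of.nat_pow_closed[OF M.tower_mem[OF c]] by blast
    qed
  qed
  hence "bij_betw h (carrier M) (mu p)" using h(2) by (simp add: bij_betw_def)
  moreover have "h (x \<otimes> y) = h x * h y" if "x \<in> carrier M" "y \<in> carrier M" for x y
    using hom_mult[OF h(1) that] by (simp add: mu_group_simps)
  ultimately have "h \<in> embeddings" using h(3) by (intro embeddingI) auto
  thus ?thesis by blast
qed

lemma act_apply:
  assumes "\<phi> \<in> embeddings"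
  shows "act F g \<phi> = compose (carrier M) g \<phi>"
  using assms by (simp add: act_def)

lemma act_closed:
  assumes g: "g \<in> carrier (Gp p)" and \<phi>: "\<phi> \<in> (embeddings :: ('a \<Rightarrow> 'c::{alg_closed_field,field_char_0}) set)"
  shows "act F g \<phi> \<in> embeddings"
  unfolding act_apply[OF \<phi>]
proof (rule embeddingI)
  show "compose (carrier M) g \<phi> \<in> extensional (carrier M)" by (rule compose_extensional)
  show "bij_betw (compose (carrier M) g \<phi>) (carrier M) (mu p)"
    using g embeddingD(2)[OF \<phi>] by (intro bij_betw_compose) (auto simp: Gp_iff)
  fix x y assume xy: "x \<in> carrier M" "y \<in> carrier M"
  have "x \<otimes> y \<in> carrier M" using mult_of.m_closed[OF xy] by simp
  thus "compose (carrier M) g \<phi> (x \<otimes> y) = compose (carrier M) g \<phi> x * compose (carrier M) g \<phi> y"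
    using xy embeddingD(3)[OF \<phi> xy] Gp_mult_apply[OF g bij_betw_apply[OF embeddingD(2)[OF \<phi>] xy(1)]
      bij_betw_apply[OF embeddingD(2)[OF \<phi>] xy(2)]] by (simp add: compose_eq)
qed

lemma act_apply_val:
  assumes "\<phi> \<in> embeddings" "x \<in> carrier M"
  shows "act F g \<phi> x = g (\<phi> x)"
  using assms by (simp add: act_apply compose_eq)

lemma act_mult:
  assumes g: "g \<in> carrier (Gp p)" and h: "h \<in> carrier (Gp p)"
    and \<phi>: "\<phi> \<in> (embeddings :: ('a \<Rightarrow> 'c::{alg_closed_field,field_char_0}) set)"
  shows "act F (g \<otimes>\<^bsub>Gp p\<^esub> h) \<phi> = act F g (act F h \<phi>)"
proof (rule extensionalityI[of _ "carrier M"])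
  show "act F (g \<otimes>\<^bsub>Gp p\<^esub> h) \<phi> \<in> extensional (carrier M)"
    unfolding act_apply[OF \<phi>] by (rule compose_extensional)
  show "act F g (act F h \<phi>) \<in> extensional (carrier M)"
    by (rule embeddingD(1)[OF act_closed[OF g act_closed[OF h \<phi>]]])
  fix x assume x: "x \<in> carrier M"
  show "act F (g \<otimes>\<^bsub>Gp p\<^esub> h) \<phi> x = act F g (act F h \<phi>) x"
    unfolding act_apply_val[OF \<phi> x] act_apply_val[OF act_closed[OF h \<phi>] x] Gp_mult[OF g h]
    by (rule compose_eq[OF bij_betw_apply[OF embeddingD(2)[OF \<phi>] x]])
qed

lemma act_one:
  assumes \<phi>: "\<phi> \<in> (embeddings :: ('a \<Rightarrow> 'c::{alg_closed_field,field_char_0}) set)"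
  shows "act F \<one>\<^bsub>Gp p\<^esub> \<phi> = \<phi>"
  unfolding act_apply[OF \<phi>] Gp_one
proof (rule extensionalityI[OF compose_extensional embeddingD(1)[OF \<phi>]])
  fix x assume "x \<in> carrier M"
  thus "compose (carrier M) (\<lambda>x\<in>mu p. x) \<phi> x = \<phi> x"
    using bij_betw_apply[OF embeddingD(2)[OF \<phi>]] by (simp add: compose_eq)
qed

lemma act_transitive:
  assumes \<phi>: "\<phi> \<in> (embeddings :: ('a \<Rightarrow> 'c::{alg_closed_field,field_char_0}) set)" and \<psi>: "\<psi> \<in> embeddings"
  shows "\<exists>g\<in>carrier (Gp p). act F g \<phi> = \<psi>"
proof -
  define r where "r = the_inv_into (carrier M) \<phi>"
  have r: "r z \<in> carrier M" "\<phi> (r z) = z" if "z \<in> mu p" for z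
    unfolding r_def using that bij_betw_apply[OF bij_betw_the_inv_into[OF embeddingD(2)[OF \<phi>]]]
      f_the_inv_into_f_bij_betw[OF embeddingD(2)[OF \<phi>]] by blast+
  have r\<phi>: "r (\<phi> x) = x" if "x \<in> carrier M" for x
    using that embeddingD(2)[OF \<phi>] unfolding r_def bij_betw_def by (auto intro: the_inv_into_f_f)
  \<comment> \<open>The automorphism \<psi> \<circ> \<phi>^(-1), which makes sense because both
    embeddings have the same image \<open>mu p\<close>.\<close>
  define g where "g = (\<lambda>z\<in>mu p. \<psi> (r z))"
  have "bij_betw r (mu p) (carrier M)"
    unfolding r_def by (rule bij_betw_the_inv_into[OF embeddingD(2)[OF \<phi>]])
  hence "bij_betw (\<psi> \<circ> r) (mu p) (mu p)" by (rule bij_betw_trans[OF _ embeddingD(2)[OF \<psi>]])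
  hence "bij_betw g (mu p) (mu p)" by (rule bij_betw_cong[THEN iffD1, rotated]) (simp add: g_def)
  moreover have "g (x * y) = g x * g y" if xy: "x \<in> mu p" "y \<in> mu p" for x y
  proof -
    have "r (x * y) = r x \<otimes> r y"
    proof -
      have m: "r x \<otimes> r y \<in> carrier M" using mult_of.m_closed[OF r(1) r(1)] xy by simp
      have "\<phi> (r x \<otimes> r y) = x * y" using embeddingD(3)[OF \<phi> r(1) r(1)] r(2) xy by simp
      thus ?thesis using r\<phi>[OF m] by simp
    qed
    thus ?thesis using embeddingD(3)[OF \<psi> r(1) r(1)] xy by (simp add: g_def mu_mult)
  qed
  ultimately have g: "g \<in> carrier (Gp p)" by (simp add: Gp_iff g_def)
  moreover have "act F g \<phi> = \<psi>"
  proof (rule extensionalityI[OF embeddingD(1)[OF act_closed[OF g \<phi>]] embeddingD(1)[OF \<psi>]])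
    fix x assume x: "x \<in> carrier M"
    show "act F g \<phi> x = \<psi> x"
      using act_apply_val[OF \<phi> x] r\<phi>[OF x] bij_betw_apply[OF embeddingD(2)[OF \<phi>] x] by (simp add: g_def)
  qed
  ultimately show ?thesis by blast
qed

lemma act_free:
  assumes \<phi>: "\<phi> \<in> (embeddings :: ('a \<Rightarrow> 'c::{alg_closed_field,field_char_0}) set)"
    and g: "g \<in> carrier (Gp p)" and fx: "act F g \<phi> = \<phi>"
  shows "g = \<one>\<^bsub>Gp p\<^esub>"
proof (rule extensionalityI[of _ "mu p"])
  show "g \<in> extensional (mu p)" using g by (simp add: Gp_iff)
  show "\<one>\<^bsub>Gp p\<^esub> \<in> extensional (mu p)" by (simp add: Gp_one)
  fix z :: 'c assume z: "z \<in> mu p"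
  then obtain x where x: "x \<in> carrier M" "z = \<phi> x"
    using embeddingD(2)[OF \<phi>] by (auto simp: bij_betw_def)
  have "g z = z" using act_apply_val[OF \<phi> x(1), of g] fx x(2) by simp
  thus "g z = \<one>\<^bsub>Gp p\<^esub> z" using z by (simp add: Gp_one)
qed

lemma group_action_embeddings:
  "group_action (Gp p) (embeddings :: ('a \<Rightarrow> 'c::{alg_closed_field,field_char_0}) set) (act F)"
proof -
  let ?X = "embeddings :: ('a \<Rightarrow> 'c) set"
  interpret G: group "Gp p :: ('c \<Rightarrow> 'c) monoid" by (rule group_Gp)
  have Bij: "act F g \<in> Bij ?X" if g: "g \<in> carrier (Gp p)" for g :: "'c \<Rightarrow> 'c"
  proof -
    have i: "inv\<^bsub>Gp p\<^esub> g \<in> carrier (Gp p)" using g by simp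
    have "bij_betw (act F g) ?X ?X"
    proof (rule bij_betw_byWitness[where f' = "act F (inv\<^bsub>Gp p\<^esub> g)"])
      show "\<forall>\<phi>\<in>?X. act F (inv\<^bsub>Gp p\<^esub> g) (act F g \<phi>) = \<phi>"
        using act_mult[OF i g] act_one G.l_inv[OF g] by metis
      show "\<forall>\<phi>\<in>?X. act F g (act F (inv\<^bsub>Gp p\<^esub> g) \<phi>) = \<phi>"
        using act_mult[OF g i] act_one G.r_inv[OF g] by metis
    qed (use act_closed[OF g] act_closed[OF i] in blast)+
    thus ?thesis by (simp add: Bij_def act_def)
  qed
  have "act F \<in> hom (Gp p) (BijGroup ?X)"
  proof (rule homI)
    fix g :: "'c \<Rightarrow> 'c" assume "g \<in> carrier (Gp p)"
    thus "act F g \<in> carrier (BijGroup ?X)" using Bij by (simp add: carrier_BijGroup)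
  next
    fix g h :: "'c \<Rightarrow> 'c" assume gh: "g \<in> carrier (Gp p)" "h \<in> carrier (Gp p)"
    show "act F (g \<otimes>\<^bsub>Gp p\<^esub> h) = act F g \<otimes>\<^bsub>BijGroup ?X\<^esub> act F h"
    proof (rule extensionalityI[of _ ?X])
      show "act F (g \<otimes>\<^bsub>Gp p\<^esub> h) \<in> extensional ?X" by (simp add: act_def)
      show "act F g \<otimes>\<^bsub>BijGroup ?X\<^esub> act F h \<in> extensional ?X"
        using BijGroup_mult[OF Bij Bij] gh by simp
      fix \<phi> assume "\<phi> \<in> ?X"
      thus "act F (g \<otimes>\<^bsub>Gp p\<^esub> h) \<phi> = (act F g \<otimes>\<^bsub>BijGroup ?X\<^esub> act F h) \<phi>"
        using BijGroup_mult[OF Bij Bij] act_mult gh by simp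
    qed
  qed
  thus ?thesis
    by (intro group_action.intro group_hom.intro group_hom_axioms.intro group_BijGroup G.group_axioms)
qed

section \<open>The successor map of an embedding\<close>

context
  fixes \<phi> :: "'a \<Rightarrow> 'c::{alg_closed_field,field_char_0}"
  assumes \<phi>: "\<phi> \<in> embeddings"
begin

abbreviation \<epsilon> where "\<epsilon> \<equiv> extend0 F \<phi>"

lemma \<epsilon>_0: "\<epsilon> \<zero> = 0" and \<epsilon>_M: "x \<in> carrier M \<Longrightarrow> \<epsilon> x = \<phi> x" and \<epsilon>_1: "\<epsilon> \<one> = 1"
  using embeddingD(4)[OF \<phi>] by (auto simp: extend0_def)

lemma \<epsilon>_bij: "bij_betw \<epsilon> (carrier F) (Mp p)"
proof -
  have "bij_betw \<epsilon> (carrier M) (mu p)"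
    using embeddingD(2)[OF \<phi>] by (rule bij_betw_cong[THEN iffD1, rotated]) (simp add: \<epsilon>_M)
  hence "bij_betw \<epsilon> (carrier M \<union> {\<zero>}) (mu p \<union> {0})"
    using notIn_Un_bij_betw3[of \<zero> "carrier M" \<epsilon> "mu p"] \<epsilon>_0 by simp
  moreover have "carrier M \<union> {\<zero>} = carrier F" by auto
  ultimately show ?thesis by (simp add: Mp_def)
qed

lemma \<epsilon>_mult: "x \<in> carrier F \<Longrightarrow> y \<in> carrier F \<Longrightarrow> \<epsilon> (x \<otimes> y) = \<epsilon> x * \<epsilon> y"
  using embeddingD(3)[OF \<phi>, of x y] by (auto simp: extend0_def integral_iff)

lemma \<epsilon>_surj:
  assumes "z \<in> Mp p" obtains x where "x \<in> carrier F" "z = \<epsilon> x"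
  using \<epsilon>_bij assms by (auto simp: bij_betw_def)

lemma \<epsilon>_closed: "x \<in> carrier F \<Longrightarrow> \<epsilon> x \<in> Mp p"
  using \<epsilon>_bij by (rule bij_betw_apply)

lemma \<epsilon>_eq_iff: "x \<in> carrier F \<Longrightarrow> y \<in> carrier F \<Longrightarrow> \<epsilon> x = \<epsilon> y \<longleftrightarrow> x = y"
  using \<epsilon>_bij by (auto simp: bij_betw_def dest: inj_onD)

text \<open>The exceptional value 0 at -1 agrees with the general formula, since the extended
  embedding sends zero to 0.\<close>

lemma successor_\<epsilon>:
  assumes x: "x \<in> carrier F"
  shows "s_of_embedding p F \<phi> (\<epsilon> x) = \<epsilon> (x \<oplus> \<one>)"
proof -
  have inv: "the_inv_into (carrier F) \<epsilon> (\<epsilon> x) = x"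
    using \<epsilon>_bij x by (simp add: bij_betw_def the_inv_into_f_f)
  have m1: "\<ominus> \<one> \<in> carrier M" using M_carrier by auto
  show ?thesis
  proof (cases "\<epsilon> x = \<phi> (\<ominus> \<one>)")
    case True
    hence "\<epsilon> x = \<epsilon> (\<ominus> \<one>)" using \<epsilon>_M[OF m1] by simp
    hence "x = \<ominus> \<one>" using \<epsilon>_eq_iff x by simp
    thus ?thesis using True \<epsilon>_closed[OF x] \<epsilon>_0 by (simp add: s_of_embedding_def l_neg)
  next
    case False
    thus ?thesis using \<epsilon>_closed[OF x] inv by (simp add: s_of_embedding_def)
  qed
qed

lemma s_of_embedding_in_Sigma: "s_of_embedding p F \<phi> \<in> Sigma_set p"
proof -
  let ?s = "s_of_embedding p F \<phi>"
  have p0: "p > 0" using p_gt_1 by simp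
  \<comment> \<open>The conjugate of the successor map by \<epsilon> b is translation by b in F,
    transported to \<open>Mp p\<close>. The axioms of \<open>Sigma_set\<close> then reduce to
    addition in F being commutative and of characteristic p.\<close>
  have translate: "\<epsilon> b * ?s (\<epsilon> y / \<epsilon> b) = \<epsilon> (y \<oplus> b)"
    if y: "y \<in> carrier F" and b: "b \<in> carrier M" for y b
  proof -
    have bF: "b \<in> carrier F" "b \<noteq> \<zero>" using b by auto
    have ib: "inv b \<in> carrier F" "b \<otimes> inv b = \<one>" using bF by (auto simp: field_Units)
    have "\<epsilon> b * \<epsilon> (inv b) = 1" using \<epsilon>_mult[OF bF(1) ib(1)] ib(2) \<epsilon>_1 by simp
    hence "inverse (\<epsilon> b) = \<epsilon> (inv b)" by (rule inverse_unique)
    hence "\<epsilon> y / \<epsilon> b = \<epsilon> (y \<otimes> inv b)"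
      using \<epsilon>_mult[OF y ib(1)] by (simp add: divide_inverse)
    hence "\<epsilon> b * ?s (\<epsilon> y / \<epsilon> b) = \<epsilon> (b \<otimes> (y \<otimes> inv b \<oplus> \<one>))"
      using successor_\<epsilon>[of "y \<otimes> inv b"] \<epsilon>_mult[of b "y \<otimes> inv b \<oplus> \<one>"] y bF ib by simp
    also have "b \<otimes> (y \<otimes> inv b \<oplus> \<one>) = y \<otimes> (b \<otimes> inv b) \<oplus> b"
      using y bF ib(1) by (simp add: r_distr m_ac)
    finally show ?thesis using ib(2) y by simp
  qed
  show ?thesis unfolding Sigma_set_iff[OF p0]
  proof (intro conjI ballI)
    show "?s \<in> extensional (Mp p)" by (simp add: s_of_embedding_def)
    show "?s \<in> Mp p \<rightarrow> Mp p"
      using successor_\<epsilon> \<epsilon>_closed by (auto elim!: \<epsilon>_surj)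
    show "?s 0 = 1" using successor_\<epsilon>[of \<zero>] \<epsilon>_0 \<epsilon>_1 by simp
  next
    fix a x :: 'c assume a: "a \<in> mu p" and x: "x \<in> Mp p"
    obtain y where y: "y \<in> carrier F" "x = \<epsilon> y" using \<epsilon>_surj[OF x] .
    obtain b where b: "b \<in> carrier F" "a = \<epsilon> b" using \<epsilon>_surj[OF MpI[OF a]] .
    have "b \<noteq> \<zero>" using b(2) \<epsilon>_0 a by auto
    hence bM: "b \<in> carrier M" using b(1) by simp
    have "?s (a * ?s (x / a)) = \<epsilon> (y \<oplus> b \<oplus> \<one>)"
      using translate[OF y(1) bM] successor_\<epsilon>[of "y \<oplus> b"] y b by simp
    also have "y \<oplus> b \<oplus> \<one> = (y \<oplus> \<one>) \<oplus> b" using y b by (simp add: a_ac)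
    also have "\<epsilon> \<dots> = a * ?s (?s x / a)"
      using translate[of "y \<oplus> \<one>", OF _ bM] successor_\<epsilon>[OF y(1)] y b by simp
    finally show "?s (a * ?s (x / a)) = a * ?s (?s x / a)" .
  next
    fix x :: 'c assume x: "x \<in> Mp p"
    obtain y where y: "y \<in> carrier F" "x = \<epsilon> y" using \<epsilon>_surj[OF x] .
    have "(?s ^^ n) x = \<epsilon> (y \<oplus> kint (int n))" for n
    proof (induction n)
      case (Suc n)
      have "y \<oplus> kint (int n) \<oplus> \<one> = y \<oplus> kint (int (Suc n))"
        using y(1) kint_add[of "int n" 1] by (simp add: a_assoc add.commute)
      thus ?case using Suc successor_\<epsilon>[of "y \<oplus> kint (int n)"] y(1) by simp
    qed (use y in simp)
    thus "(?s ^^ p) x = x" using y kint_p by simp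
  qed
qed

end

section \<open>Equivariance of the successor map and orbits of Frobenius\<close>

lemma s_of_embedding_act:
  assumes g: "g \<in> carrier (Gp p)" and \<phi>: "\<phi> \<in> (embeddings :: ('a \<Rightarrow> 'c::{alg_closed_field,field_char_0}) set)"
    and x: "x \<in> Mp p"
  shows "s_of_embedding p F (act F g \<phi>) (ext0 g x) = ext0 g (s_of_embedding p F \<phi> x)"
proof -
  have e: "extend0 F (act F g \<phi>) y = ext0 g (extend0 F \<phi> y)" if y: "y \<in> carrier F" for y
  proof (cases "y = \<zero>")
    case False
    hence yM: "y \<in> carrier M" using y by simp
    have "\<phi> y \<in> mu p" by (rule bij_betw_apply[OF embeddingD(2)[OF \<phi>] yM])
    thus ?thesis using False y act_apply_val[OF \<phi> yM] by (simp add: extend0_def ext0_mu)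
  qed (simp add: extend0_def)
  obtain y where y: "y \<in> carrier F" "x = extend0 F \<phi> y" using \<epsilon>_surj[OF \<phi> x] .
  show ?thesis
    using successor_\<epsilon>[OF act_closed[OF g \<phi>] y(1)] successor_\<epsilon>[OF \<phi> y(1)] e[OF y(1)] e[of "y \<oplus> \<one>"] y
    by simp
qed

lemma ext0_surj:
  assumes g: "g \<in> carrier (Gp p)" and z: "z \<in> Mp p"
  shows "\<exists>x\<in>Mp p. z = ext0 g x"
proof (cases "z = 0")
  case False
  hence "z \<in> mu p" using Mp_mu[OF z] by blast
  hence "z \<in> g ` mu p" using g by (simp add: Gp_iff bij_betw_def)
  then obtain x where x: "x \<in> mu p" "z = g x" by blast
  show ?thesis by (rule bexI[of _ x]) (use x in \<open>simp_all add: ext0_mu MpI\<close>)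
qed (auto intro: bexI[of _ 0])

text \<open>Acting by g conjugates the successor map by the extension of g, so it is unchanged
  exactly when g lies in the centralizer.\<close>

lemma s_of_embedding_eq_iff:
  assumes g: "g \<in> carrier (Gp p)" and \<phi>: "\<phi> \<in> (embeddings :: ('a \<Rightarrow> 'c::{alg_closed_field,field_char_0}) set)"
  shows "s_of_embedding p F (act F g \<phi>) = s_of_embedding p F \<phi> \<longleftrightarrow> g \<in> carrier (frob_group p)"
proof -
  let ?s = "s_of_embedding p F \<phi>" and ?t = "s_of_embedding p F (act F g \<phi>)"
  interpret s: successor_map p ?s
    by unfold_locales (rule prime_p, rule s_of_embedding_in_Sigma[OF \<phi>])
  have "g \<in> carrier (frob_group p) \<longleftrightarrow> (\<forall>x\<in>Mp p. ?s (ext0 g x) = ext0 g (?s x))"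
    unfolding s.frob_group_eq_centralizer using g by (simp add: s.centralizer_def)
  also have "\<dots> \<longleftrightarrow> (\<forall>x\<in>Mp p. ?s (ext0 g x) = ?t (ext0 g x))"
    using s_of_embedding_act[OF g \<phi>] by simp
  also have "\<dots> \<longleftrightarrow> (\<forall>z\<in>Mp p. ?s z = ?t z)"
    using ext0_surj[OF g] ext0_closed[OF g] by metis
  also have "\<dots> \<longleftrightarrow> ?t = ?s"
  proof
    assume "\<forall>z\<in>Mp p. ?s z = ?t z"
    hence "\<And>z. z \<in> Mp p \<Longrightarrow> ?t z = ?s z" by simp
    moreover have "?s \<in> extensional (Mp p)" "?t \<in> extensional (Mp p)"
      unfolding s_of_embedding_def by (rule restrict_extensional)+
    ultimately show "?t = ?s" by (intro extensionalityI[of ?t "Mp p" ?s])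
  qed simp
  finally show ?thesis by blast
qed

text \<open>Starting from an arbitrary embedding, the prime ideal of its successor map is conjugate
  to that of s, and acting by the conjugating automorphism yields s.\<close>

lemma s_of_embedding_surj:
  assumes s: "s \<in> Sigma_set p"
  shows "\<exists>\<phi>\<in>(embeddings :: ('a \<Rightarrow> 'c::{alg_closed_field,field_char_0}) set). s_of_embedding p F \<phi> = s"
proof -
  obtain \<phi> :: "'a \<Rightarrow> 'c" where \<phi>: "\<phi> \<in> embeddings" using embeddings_nonempty by blast
  interpret s0: successor_map p "s_of_embedding p F \<phi>"
    by unfold_locales (rule prime_p, rule s_of_embedding_in_Sigma[OF \<phi>])
  interpret s1: successor_map p s by unfold_locales (rule prime_p, rule s)
  interpret two_primes p s0.ker s1.ker by unfold_locales
  obtain g where g: "g \<in> carrier (Gp p)"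
    "\<And>x. x \<in> Mp p \<Longrightarrow> s (ext0 g x) = ext0 g (s_of_embedding p F \<phi> x)"
    using conjugating_automorphism unfolding s0.ker_successor s1.ker_successor by blast
  have "s_of_embedding p F (act F g \<phi>) = s"
  proof (rule extensionalityI[OF _ s1.s_ext])
    show "s_of_embedding p F (act F g \<phi>) \<in> extensional (Mp p)" by (simp add: s_of_embedding_def)
    fix z :: 'c assume "z \<in> Mp p"
    then obtain x where x: "x \<in> Mp p" "z = ext0 g x" using ext0_surj[OF g(1)] by blast
    thus "s_of_embedding p F (act F g \<phi>) z = s z"
      using s_of_embedding_act[OF g(1) \<phi> x(1)] g(2)[OF x(1)] by simp
  qed
  thus ?thesis using act_closed[OF g(1) \<phi>] by blast
qed

text \<open>The definition of \<open>frob_group p\<close> mentions no embedding, yet its subgroup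
  properties are read off from the centralizer of the successor map of any one.\<close>

lemma frob_group_closed:
  fixes g h :: "'c::{alg_closed_field,field_char_0} \<Rightarrow> 'c"
  shows "carrier (frob_group p) \<subseteq> carrier (Gp p :: ('c \<Rightarrow> 'c) monoid)"
    and "\<one>\<^bsub>Gp p\<^esub> \<in> carrier (frob_group p :: ('c \<Rightarrow> 'c) monoid)"
    and "\<lbrakk>g \<in> carrier (frob_group p); h \<in> carrier (frob_group p)\<rbrakk> \<Longrightarrow> g \<otimes>\<^bsub>Gp p\<^esub> h \<in> carrier (frob_group p)"
    and "g \<in> carrier (frob_group p) \<Longrightarrow> inv\<^bsub>Gp p\<^esub> g \<in> carrier (frob_group p)"
proof -
  obtain \<phi> :: "'a \<Rightarrow> 'c" where \<phi>: "\<phi> \<in> embeddings" using embeddings_nonempty by blast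
  interpret s: successor_map p "s_of_embedding p F \<phi>"
    by unfold_locales (rule prime_p, rule s_of_embedding_in_Sigma[OF \<phi>])
  interpret subgroup "carrier (frob_group p)" "Gp p :: ('c \<Rightarrow> 'c) monoid"
    unfolding s.frob_group_eq_centralizer by (rule s.centralizer_subgroup)
  show "carrier (frob_group p) \<subseteq> carrier (Gp p :: ('c \<Rightarrow> 'c) monoid)"
    "\<one>\<^bsub>Gp p\<^esub> \<in> carrier (frob_group p :: ('c \<Rightarrow> 'c) monoid)"
    "\<lbrakk>g \<in> carrier (frob_group p); h \<in> carrier (frob_group p)\<rbrakk> \<Longrightarrow> g \<otimes>\<^bsub>Gp p\<^esub> h \<in> carrier (frob_group p)"
    "g \<in> carrier (frob_group p) \<Longrightarrow> inv\<^bsub>Gp p\<^esub> g \<in> carrier (frob_group p)"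
    using subset by auto
qed

lemma same_orbit_iff:
  assumes \<phi>: "\<phi> \<in> (embeddings :: ('a \<Rightarrow> 'c::{alg_closed_field,field_char_0}) set)" and \<psi>: "\<psi> \<in> embeddings"
  shows "\<psi> \<in> orbit (frob_group p) (act F) \<phi> \<longleftrightarrow> s_of_embedding p F \<psi> = s_of_embedding p F \<phi>"
proof
  assume "\<psi> \<in> orbit (frob_group p) (act F) \<phi>"
  then obtain g where g: "g \<in> carrier (frob_group p)" "\<psi> = act F g \<phi>" by (auto simp: orbit_def)
  have "g \<in> carrier (Gp p)" using g(1) frob_group_closed(1) by blast
  thus "s_of_embedding p F \<psi> = s_of_embedding p F \<phi>" using s_of_embedding_eq_iff[OF _ \<phi>] g by blast
next
  assume e: "s_of_embedding p F \<psi> = s_of_embedding p F \<phi>"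
  obtain g where g: "g \<in> carrier (Gp p)" "act F g \<phi> = \<psi>" using act_transitive[OF \<phi> \<psi>] by blast
  hence "g \<in> carrier (frob_group p)" using s_of_embedding_eq_iff[OF g(1) \<phi>] e by simp
  thus "\<psi> \<in> orbit (frob_group p) (act F) \<phi>" using g(2) by (auto simp: orbit_def)
qed

lemma orbit_subset: "\<phi> \<in> (embeddings :: ('a \<Rightarrow> 'c::{alg_closed_field,field_char_0}) set) \<Longrightarrow>
    orbit (frob_group p) (act F) \<phi> \<subseteq> embeddings"
  using act_closed frob_group_closed(1) by (auto simp: orbit_def)

lemma orbit_eq:
  assumes \<phi>: "\<phi> \<in> (embeddings :: ('a \<Rightarrow> 'c::{alg_closed_field,field_char_0}) set)"
  shows "orbit (frob_group p) (act F) \<phi> = {\<psi> \<in> embeddings. s_of_embedding p F \<psi> = s_of_embedding p F \<phi>}"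
  using same_orbit_iff[OF \<phi>] orbit_subset[OF \<phi>] by blast

end

theorem proposition8p14:
  fixes p :: nat and F :: "('a, 'm) ring_scheme" and Fp :: "'a set"
    and Xp :: "('a \<Rightarrow> 'c::{alg_closed_field, field_char_0}) set"
  assumes "prime p"
    and "algebraic_closure F Fp" and "card Fp = p"
    and "Xp = X_set F"
  shows "(Xp \<noteq> {} \<and> transitive_action (Gp p) Xp (act F) \<and>
          (\<forall>\<sigma>\<in>Xp. stabilizer (Gp p) (act F) \<sigma> = {\<one>\<^bsub>Gp p\<^esub>})) \<and>
         (\<exists>\<Phi>. bij_betw \<Phi> (orbits (frob_group p) Xp (act F)) (Sigma_set p) \<and>
              (\<forall>\<sigma>\<in>Xp. \<Phi> (orbit (frob_group p) (act F) \<sigma>) = s_of_embedding p F \<sigma>)) \<and>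
         bij_betw (s_of_val p) (Val p :: ('c \<Rightarrow> ereal) set) (Sigma_set p)"
proof -
  interpret prime_field_closure F Fp p
    by (intro prime_field_closure.intro prime_field_closure_axioms.intro assms)
  interpret G: group "Gp p :: ('c \<Rightarrow> 'c) monoid" by (rule group_Gp)
  note X = assms(4)
  have trans: "transitive_action (Gp p) Xp (act F)"
    unfolding transitive_action_def transitive_action_axioms_def X
    using group_action_embeddings act_transitive by blast
  have stab: "stabilizer (Gp p) (act F) \<phi> = {\<one>\<^bsub>Gp p\<^esub>}" if "\<phi> \<in> Xp" for \<phi>
    using that act_free[of \<phi>] act_one[of \<phi>] G.one_closed unfolding X stabilizer_def by blast
  \<comment> \<open>Any member of an orbit may be used, because an orbit is a full fibre of
    \<open>s_of_embedding p F\<close> by \<open>orbit_eq\<close>.\<close>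
  define \<Phi> where "\<Phi> A = s_of_embedding p F (SOME \<phi>. \<phi> \<in> A)" for A :: "('a \<Rightarrow> 'c) set"
  have \<Phi>: "\<Phi> (orbit (frob_group p) (act F) \<phi>) = s_of_embedding p F \<phi>" if \<phi>: "\<phi> \<in> Xp" for \<phi>
  proof -
    have "\<phi> \<in> {\<psi> \<in> X_set F. s_of_embedding p F \<psi> = s_of_embedding p F \<phi>}" using \<phi> X by simp
    from someI[of "\<lambda>\<psi>. \<psi> \<in> {\<psi> \<in> X_set F. s_of_embedding p F \<psi> = s_of_embedding p F \<phi>}", OF this]
    show ?thesis using \<phi> unfolding \<Phi>_def X by (simp add: orbit_eq)
  qed
  have "bij_betw \<Phi> (orbits (frob_group p) Xp (act F)) (Sigma_set p)"
    unfolding bij_betw_def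
  proof (intro conjI)
    show "inj_on \<Phi> (orbits (frob_group p) Xp (act F))"
    proof (rule inj_onI)
      fix A B assume "A \<in> orbits (frob_group p) Xp (act F)" "B \<in> orbits (frob_group p) Xp (act F)"
        and e: "\<Phi> A = \<Phi> B"
      then obtain \<phi> \<psi> where st: "\<phi> \<in> Xp" "A = orbit (frob_group p) (act F) \<phi>"
        "\<psi> \<in> Xp" "B = orbit (frob_group p) (act F) \<psi>" by (auto simp: orbits_def)
      hence "s_of_embedding p F \<phi> = s_of_embedding p F \<psi>" using e \<Phi> by simp
      thus "A = B" using st by (simp add: X orbit_eq)
    qed
    show "\<Phi> ` orbits (frob_group p) Xp (act F) = Sigma_set p"
    proof (intro equalityI subsetI)
      fix s assume "s \<in> \<Phi> ` orbits (frob_group p) Xp (act F)"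
      then obtain \<phi> where "\<phi> \<in> Xp" "s = s_of_embedding p F \<phi>" using \<Phi> by (auto simp: orbits_def)
      thus "s \<in> Sigma_set p" using s_of_embedding_in_Sigma X by simp
      next
      fix s :: "'c \<Rightarrow> 'c" assume "s \<in> Sigma_set p"
      then obtain \<phi> where \<phi>: "\<phi> \<in> Xp" "s = s_of_embedding p F \<phi>"
        using s_of_embedding_surj X by metis
      thus "s \<in> \<Phi> ` orbits (frob_group p) Xp (act F)"
        using \<Phi>[OF \<phi>(1)] by (intro image_eqI[of _ _ "orbit (frob_group p) (act F) \<phi>"])
          (auto simp: orbits_def)
    qed
  qed
  moreover have "Xp \<noteq> {}" using embeddings_nonempty X by simp
  ultimately show ?thesis using trans stab \<Phi> bij_betw_s_of_val[OF assms(1)] by blast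
qed

end
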